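(* Let $N,m\in\mathbb{N}$, let $A\in\mathbb{R}^{m\times N}$ be a Gaussian matrix, i.e. $A=m^{-1/2}[a_{ij}]$ with $a_{ij}$ i.i.d. $\mathcal{N}(0,1)$. Let $K\subset[N]$ with $|K|=k$ and $x_0=\mathbb{1}_K$ (the indicator vector of $K$). Fix $\varepsilon>0$. If $$m\ge \min\{\Delta_{\mathrm{bin}}(k),\Delta_{\mathrm{bin}}(N-k)\}+\sqrt{8\log(4/\varepsilon)N},$$ then with probability larger than $1-\varepsilon$, $x_0$ is the unique solution of MiBi-BP with $b=Ax_0$, i.e. for every choice of minimizers in its steps the algorithm returns $x_0$.
   Context: For $k\in\{0,\dots,N\}$, $$\Delta_{\mathrm{bin}}(k):=\inf_{\tau\ge0}\Big\{k\int_{-\infty}^{\tau}(u-\tau)^2\phi(u)\,du+(N-k)\int_{\tau}^{\infty}(u-\tau)^2\phi(u)\,du\Big\},\qquad \phi(u)=(2\pi)^{-1/2}e^{-u^2/2}.$$ Mirrored Binary Basis Pursuit (MiBi-BP) with data $A,b$: (1) let $\hat x_1$ be a solution of $\min\|x\|_1$ subject to $Ax=b$, $x\in[0,1]^N$; (2) let $\hat x_2$ be a solution of $\min\|\mathbb{1}-x\|_1$ subject to $Ax=b$, $x\in[0,1]^N$, where $\mathbb{1}\in\mathbb{R}^N$ is the all-ones vector; (3) output $\hat x=\hat x_{i^*}$ where $i^*\in\arg\min_{i=1,2}\|\mathrm{round}(\hat x_i)-\hat x_i\|$, with $\mathrm{round}(x)$ the vector of $\mathbb{Z}^N$ closest to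 $x$ (componentwise rounding) and $\|\cdot\|$ a norm on $\mathbb{R}^N$. *)

theory Defs
  imports "HOL-Probability.Probability"
begin

text \<open>Vectors in R^N are represented as functions nat => real that vanish outside {..<N};
  m x N matrices as functions nat => nat => real (row index j < m, column index i < N).\<close>

definition Delta_bin :: "nat \<Rightarrow> nat \<Rightarrow> real" where
  "Delta_bin N k = (INF \<tau>\<in>{0::real..}.
      real k * (LINT u:{..\<tau>}|lborel. (u - \<tau>)\<^sup>2 * std_normal_density u)
    + real (N - k) * (LINT u:{\<tau>..}|lborel. (u - \<tau>)\<^sup>2 * std_normal_density u))"

definition supp_vec :: "nat \<Rightarrow> (nat \<Rightarrow> real) \<Rightarrow> bool" where
  "supp_vec N x \<longleftrightarrow> (\<forall>i\<ge>N. x i = 0)"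

definition is_norm_on :: "nat \<Rightarrow> ((nat \<Rightarrow> real) \<Rightarrow> real) \<Rightarrow> bool" where
  "is_norm_on N nrm \<longleftrightarrow>
     (\<forall>x. supp_vec N x \<longrightarrow> nrm x \<ge> 0 \<and> (nrm x = 0 \<longleftrightarrow> (\<forall>i. x i = 0))) \<and>
     (\<forall>x c. supp_vec N x \<longrightarrow> nrm (\<lambda>i. c * x i) = \<bar>c\<bar> * nrm x) \<and>
     (\<forall>x y. supp_vec N x \<longrightarrow> supp_vec N y \<longrightarrow> nrm (\<lambda>i. x i + y i) \<le> nrm x + nrm y)"

definition feasible ::
  "nat \<Rightarrow> nat \<Rightarrow> (nat \<Rightarrow> nat \<Rightarrow> real) \<Rightarrow> (nat \<Rightarrow> real) \<Rightarrow> (nat \<Rightarrow> real) set" where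
  "feasible m N A b = {x. supp_vec N x \<and> (\<forall>i<N. 0 \<le> x i \<and> x i \<le> 1) \<and>
                        (\<forall>j<m. (\<Sum>i<N. A j i * x i) = b j)}"

definition step1_sols ::
  "nat \<Rightarrow> nat \<Rightarrow> (nat \<Rightarrow> nat \<Rightarrow> real) \<Rightarrow> (nat \<Rightarrow> real) \<Rightarrow> (nat \<Rightarrow> real) set" where
  "step1_sols m N A b = {x \<in> feasible m N A b.
      \<forall>y\<in>feasible m N A b. (\<Sum>i<N. \<bar>x i\<bar>) \<le> (\<Sum>i<N. \<bar>y i\<bar>)}"

definition step2_sols ::
  "nat \<Rightarrow> nat \<Rightarrow> (nat \<Rightarrow> nat \<Rightarrow> real) \<Rightarrow> (nat \<Rightarrow> real) \<Rightarrow> (nat \<Rightarrow> real) set" where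
  "step2_sols m N A b = {x \<in> feasible m N A b.
      \<forall>y\<in>feasible m N A b. (\<Sum>i<N. \<bar>1 - x i\<bar>) \<le> (\<Sum>i<N. \<bar>1 - y i\<bar>)}"

text \<open>Componentwise rounding (library round, ties rounded up).\<close>
definition round_vec :: "nat \<Rightarrow> (nat \<Rightarrow> real) \<Rightarrow> nat \<Rightarrow> real" where
  "round_vec N x = (\<lambda>i. if i < N then real_of_int (round (x i)) else 0)"

definition round_err :: "((nat \<Rightarrow> real) \<Rightarrow> real) \<Rightarrow> nat \<Rightarrow> (nat \<Rightarrow> real) \<Rightarrow> real" where
  "round_err nrm N x = nrm (\<lambda>i. round_vec N x i - x i)"

definition mibi_outputs ::
  "((nat \<Rightarrow> real) \<Rightarrow> real) \<Rightarrow> nat \<Rightarrow> nat \<Rightarrow> (nat \<Rightarrow> nat \<Rightarrow> real) \<Rightarrow> (nat \<Rightarrow> real)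
     \<Rightarrow> (nat \<Rightarrow> real) set" where
  "mibi_outputs nrm m N A b = {x. \<exists>x1\<in>step1_sols m N A b. \<exists>x2\<in>step2_sols m N A b.
      (x = x1 \<and> round_err nrm N x1 \<le> round_err nrm N x2) \<or>
      (x = x2 \<and> round_err nrm N x2 \<le> round_err nrm N x1)}"

definition gauss_entries :: "nat \<Rightarrow> nat \<Rightarrow> (nat \<times> nat \<Rightarrow> real) measure" where
  "gauss_entries m N = PiM ({..<m} \<times> {..<N}) (\<lambda>_. density lborel std_normal_density)"

definition gauss_matrix :: "nat \<Rightarrow> (nat \<times> nat \<Rightarrow> real) \<Rightarrow> nat \<Rightarrow> nat \<Rightarrow> real" where
  "gauss_matrix m a = (\<lambda>j i. a (j, i) / sqrt (real m))"

definition mat_vec :: "nat \<Rightarrow> nat \<Rightarrow> (nat \<Rightarrow> nat \<Rightarrow> real) \<Rightarrow> (nat \<Rightarrow> real) \<Rightarrow> nat \<Rightarrow> real" where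
  "mat_vec m N A x = (\<lambda>j. if j < m then (\<Sum>i<N. A j i * x i) else 0)"

end

theory Submission
  imports Defs "HOL-Real_Asymp.Real_Asymp"
begin

text \<open>
  Step 1 of the algorithm fails to return only \<open>x0 = indicator K\<close> iff the kernel of the Gaussian matrix
  meets the descent cone of the sum over the box at \<open>x0\<close>, a cone given by sign conditions and one
  linear inequality; step 2 is the mirror image, with the complement of \<open>K\<close>. If one step is
  exact, the selection rule can only go wrong through another binary point with the same image, an
  event of probability zero.

  The cone is controlled by Gordon's Gaussian comparison, in exponential form. For a finite set of
  unit vectors \<open>h\<close>, the processes \<open>|A h| + \<gamma>\<close> and \<open>|G| + \<langle>g, h\<rangle>\<close> satisfy
  \<open>E max_h exp (- s (|A h| + \<gamma>)) \<le> E max_h exp (- s (|G| + \<langle>g, h\<rangle>))\<close>, by interpolating between them and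
  integrating by parts. The auxiliary \<open>\<gamma>\<close> contributes the factor \<open>exp (s^2/2)\<close> on the left. Since
  \<open>sup_h \<langle>g, h\<rangle>\<close> is at most the distance of \<open>g\<close> to the set whose expected squared distance defines
  \<open>Delta_bin\<close>, the right-hand side is a product of one-dimensional integrals: the Laplace transform of
  \<open>|G|\<close> is at most \<open>(1 + sqrt pi) exp (- s sqrt m + s^2/2)\<close>, and a truncated Gaussian \<open>f\<close> with
  \<open>E f^2 = a\<close> satisfies \<open>E exp (\<mu> f^2) \<le> (1 - 4\<mu>) powr (-a/4)\<close>. Optimizing \<open>s\<close> gives failure probability at
  most \<open>(1 + sqrt pi) exp (- (m - \<delta>)^2 / (8 m))\<close> for \<open>m \<le> N\<close>, and \<open>1 + sqrt pi < 4\<close>. For \<open>m > N\<close> the same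
  comparison with \<open>s\<close> tending to infinity shows that the kernel is almost surely trivial.
\<close>

section \<open>Gaussian integration by parts\<close>

text \<open>Gordon's theorem is usually stated for expectations and followed by Gaussian
  concentration. Comparing Laplace transforms gives the tail bound at once, through one-dimensional
  integrals and with the constants that the claim demands: prefactor strictly below
  \<open>4\<close>, rate \<open>1/8\<close>. Thanks to \<open>\<gamma>\<close>, every row of the
  interpolation keeps a constant variance at each unit vector.

  Calculus applies neither to the norm at zero, nor to a maximum, nor to an infinite cone. Hence
  \<open>\<eta>\<close> smooths the norm, the power \<open>\<kappa>\<close> of a sum of exponentials
  replaces the maximum at the price of \<open>card T powr \<kappa>\<close>, and a tolerance
  \<open>\<rho>\<close> lets finite subsets stand for the cone; all of them tend to zero.

  The rate: for a large shift, the square of a truncated Gaussian with second moment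
  \<open>a\<close> has variance close to \<open>4 * a\<close>, the variance encoded in
  \<open>(1 - 4 * \<mu>) powr (- a / 4)\<close>; the chi-square form
  \<open>(1 - 2 * \<mu>) powr (- a / 2)\<close> would be too small. The \<open>N\<close> under the
  root of the hypothesis dominates the \<open>m\<close> of the rate because \<open>m \<le> N\<close>
  in the main case.\<close>

abbreviation std_normal :: "real measure" where
  "std_normal \<equiv> density lborel std_normal_density"

lemma prob_space_std_normal: "prob_space std_normal"
  by (rule prob_space_normal_density) simp

lemma integrable_std_normal_iff:
  fixes f :: "real \<Rightarrow> real"
  assumes [measurable]: "f \<in> borel_measurable borel"
  shows "integrable std_normal f \<longleftrightarrow> integrable lborel (\<lambda>x. std_normal_density x * f x)"
  by (subst integrable_density) auto

lemma integral_std_normal_eq: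
  fixes f :: "real \<Rightarrow> real"
  assumes [measurable]: "f \<in> borel_measurable borel"
  shows "integral\<^sup>L std_normal f = (LINT x|lborel. std_normal_density x * f x)"
  by (subst integral_density) auto

lemma std_normal_density_exp:
  "std_normal_density x * exp (s * x) = exp (s\<^sup>2 / 2) * normal_density s 1 x"
proof -
  have "- x\<^sup>2 / 2 + s * x = s\<^sup>2 / 2 + - (x - s)\<^sup>2 / 2"
    by (simp add: power2_eq_square field_simps)
  then show ?thesis
    by (simp add: normal_density_def exp_add[symmetric])
qed

lemma integrable_std_normal_exp: "integrable std_normal (\<lambda>x. exp (s * x))"
  by (subst integrable_std_normal_iff) (auto simp: std_normal_density_exp)

lemma integral_std_normal_exp: "(LINT x|std_normal. exp (s * x)) = exp (s\<^sup>2 / 2)"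
  by (subst integral_std_normal_eq) (auto simp: std_normal_density_exp)

lemma integrable_std_normal_exp_abs: "integrable std_normal (\<lambda>x. exp (s * \<bar>x\<bar>))"
proof (rule Bochner_Integration.integrable_bound)
  show "integrable std_normal (\<lambda>x. exp (s * x) + exp (- s * x))"
    by (intro Bochner_Integration.integrable_add integrable_std_normal_exp)
  show "AE x in std_normal. norm (exp (s * \<bar>x\<bar>)) \<le> norm (exp (s * x) + exp (- s * x))"
  proof (intro AE_I2)
    fix x
    have "exp (s * \<bar>x\<bar>) \<le> exp (s * x) + exp (- s * x)" by (auto simp: abs_if)
    then show "norm (exp (s * \<bar>x\<bar>)) \<le> norm (exp (s * x) + exp (- s * x))" by simp
  qed
qed simp

lemma integrable_std_normal_bound:
  fixes f :: "real \<Rightarrow> real"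
  assumes "f \<in> borel_measurable borel" and "\<And>x. \<bar>f x\<bar> \<le> C * exp (s * \<bar>x\<bar>)"
  shows "integrable std_normal f"
proof (rule Bochner_Integration.integrable_bound)
  show "integrable std_normal (\<lambda>x. C * exp (s * \<bar>x\<bar>))"
    using integrable_std_normal_exp_abs by simp
  show "f \<in> borel_measurable std_normal" using assms by simp
  show "AE x in std_normal. norm (f x) \<le> norm (C * exp (s * \<bar>x\<bar>))"
    using assms(2) by (intro AE_I2) (metis abs_ge_self order_trans real_norm_def)
qed

lemma abs_le_exp: "0 \<le> (y::real) \<Longrightarrow> y \<le> exp y"
  using exp_ge_add_one_self[of y] by linarith

lemma gaussian_tail_mult_exp:
  "((\<lambda>x::real. exp (s * \<bar>x\<bar>) * std_normal_density x) \<longlongrightarrow> 0) at_top"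
  "((\<lambda>x::real. exp (s * \<bar>x\<bar>) * std_normal_density x) \<longlongrightarrow> 0) at_bot"
proof -
  have "((\<lambda>x::real. 1 / sqrt (2 * pi) * exp (s * x - x\<^sup>2 / 2)) \<longlongrightarrow> 0) at_top"
    by real_asymp
  moreover have "exp (s * x) * std_normal_density x = 1 / sqrt (2 * pi) * exp (s * x - x\<^sup>2 / 2)" for x
    by (simp add: std_normal_density_def exp_add[symmetric])
  ultimately have 1: "((\<lambda>x::real. exp (s * x) * std_normal_density x) \<longlongrightarrow> 0) at_top"
    by simp
  show A: "((\<lambda>x::real. exp (s * \<bar>x\<bar>) * std_normal_density x) \<longlongrightarrow> 0) at_top"
    by (rule Lim_transform_eventually[OF 1])
       (auto simp: eventually_at_top_linorder intro!: exI[of _ 0])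
  have "((\<lambda>x::real. exp (s * \<bar>-x\<bar>) * std_normal_density (-x)) \<longlongrightarrow> 0) at_top"
    using A by (simp add: std_normal_density_def)
  then show "((\<lambda>x::real. exp (s * \<bar>x\<bar>) * std_normal_density x) \<longlongrightarrow> 0) at_bot"
    unfolding at_bot_mirror filterlim_filtermap by simp
qed

lemma set_integral_derivative:
  fixes F F' :: "real \<Rightarrow> real"
  assumes F: "\<And>x. (F has_real_derivative F' x) (at x)"
    and int: "set_integrable lborel {a..b} F'" and "a \<le> b"
  shows "(LINT x|lborel. indicator {a..b} x * F' x) = F b - F a"
proof -
  have "(F' has_integral F b - F a) {a..b}"
    using \<open>a \<le> b\<close> by (intro fundamental_theorem_of_calculus)
       (auto intro: has_field_derivative_at_within[OF F] simp: has_real_derivative_iff_has_vector_derivative[symmetric])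
  then show ?thesis
    using set_borel_integral_eq_integral(2)[OF int] by (simp add: set_lebesgue_integral_def integral_unique)
qed

text \<open>The fundamental theorem on \<open>[-n, n]\<close> and dominated convergence: the
  integrals converge while the boundary values die out.\<close>

lemma integral_derivative_eq_zero:
  fixes F F' :: "real \<Rightarrow> real"
  assumes F: "\<And>x. (F has_real_derivative F' x) (at x)"
    and int: "integrable lborel F'"
    and lim: "(F \<longlongrightarrow> 0) at_top" "(F \<longlongrightarrow> 0) at_bot"
  shows "(LINT x|lborel. F' x) = 0"
proof -
  have eq: "(LINT x|lborel. indicator {- real n..real n} x * F' x) = F (real n) - F (- real n)" for n
    by (intro set_integral_derivative F, unfold set_integrable_def, intro integrable_mult_indicator int) auto
  have "(\<lambda>n. LINT x|lborel. indicator {- real n..real n} x * F' x) \<longlonglongrightarrow> (LINT x|lborel. F' x)"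
  proof (rule integral_dominated_convergence)
    show "integrable lborel (\<lambda>x. \<bar>F' x\<bar>)" using int by simp
    show "AE x in lborel. (\<lambda>n. indicator {- real n..real n} x * F' x) \<longlonglongrightarrow> F' x"
    proof (rule AE_I2, rule tendsto_eventually)
      fix x :: real
      obtain n0 where n0: "\<bar>x\<bar> \<le> real n0" using real_arch_simple by blast
      show "eventually (\<lambda>n. indicator {- real n..real n} x * F' x = F' x) sequentially"
        using eventually_ge_at_top[of n0]
        by eventually_elim (use n0 in \<open>auto simp: indicator_def abs_le_iff\<close>)
    qed
    show "\<And>n. AE x in lborel. norm (indicator {- real n..real n} x * F' x) \<le> \<bar>F' x\<bar>"
      by (auto simp: indicator_def)
  qed (use int in auto)
  moreover have "(\<lambda>n. F (real n) - F (- real n)) \<longlonglongrightarrow> 0 - 0"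
  proof (intro tendsto_diff)
    show "(\<lambda>n. F (real n)) \<longlonglongrightarrow> 0"
      by (rule filterlim_compose[OF lim(1) filterlim_real_sequentially])
    show "(\<lambda>n. F (- real n)) \<longlonglongrightarrow> 0"
      by (rule filterlim_compose[OF lim(2)])
         (rule filterlim_compose[OF filterlim_uminus_at_bot_at_top filterlim_real_sequentially])
  qed
  ultimately show ?thesis
    unfolding eq using LIMSEQ_unique by fastforce
qed

text \<open>Stein's identity. The density \<open>d\<close> satisfies \<open>d' = - x d\<close>, so
  the difference of the two integrands, weighted by \<open>d\<close>, is up to sign the derivative
  of \<open>f d\<close>; the exponential bound on \<open>f\<close> makes \<open>f d\<close> vanish
  at both ends.\<close>

lemma std_normal_stein:
  fixes f f' :: "real \<Rightarrow> real"
  assumes f: "\<And>x. (f has_real_derivative f' x) (at x)"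
    and [measurable]: "f' \<in> borel_measurable borel"
    and bd: "\<And>x. \<bar>f x\<bar> \<le> C * exp (s * \<bar>x\<bar>)" and bd': "\<And>x. \<bar>f' x\<bar> \<le> C * exp (s * \<bar>x\<bar>)"
  shows "(LINT x|std_normal. x * f x) = (LINT x|std_normal. f' x)"
proof -
  have "continuous_on UNIV f"
    using f by (auto intro!: continuous_at_imp_continuous_on DERIV_isCont)
  then have [measurable]: "f \<in> borel_measurable borel" by (rule borel_measurable_continuous_onI)
  have int': "integrable std_normal f'"
    by (rule integrable_std_normal_bound[OF _ bd']) simp
  have intx: "integrable std_normal (\<lambda>x. x * f x)"
  proof (rule integrable_std_normal_bound)
    fix x
    have "\<bar>x * f x\<bar> \<le> exp \<bar>x\<bar> * (C * exp (s * \<bar>x\<bar>))"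
      unfolding abs_mult by (intro mult_mono bd abs_le_exp) auto
    also have "\<dots> = C * exp ((s + 1) * \<bar>x\<bar>)"
      by (simp add: exp_add[symmetric] algebra_simps)
    finally show "\<bar>x * f x\<bar> \<le> C * exp ((s + 1) * \<bar>x\<bar>)" .
  qed simp
  have d: "((\<lambda>x. f x * std_normal_density x) has_real_derivative
          std_normal_density x * f' x - std_normal_density x * (x * f x)) (at x)" for x
    unfolding std_normal_density_def
    by (rule derivative_eq_intros f refl | simp)+ (simp add: field_simps)
  have lim0: "((\<lambda>x. f x * std_normal_density x) \<longlongrightarrow> 0) F"
    if "((\<lambda>x. exp (s * \<bar>x\<bar>) * std_normal_density x) \<longlongrightarrow> 0) F" for F
  proof (rule Lim_null_comparison)
    show "eventually (\<lambda>x. norm (f x * std_normal_density x)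
            \<le> C * (exp (s * \<bar>x\<bar>) * std_normal_density x)) F"
      using bd by (intro always_eventually) (auto simp: abs_mult mult.assoc[symmetric] intro!: mult_right_mono)
    show "((\<lambda>x. C * (exp (s * \<bar>x\<bar>) * std_normal_density x)) \<longlongrightarrow> 0) F"
      using tendsto_mult_right_zero[OF that] .
  qed
  have i1: "integrable lborel (\<lambda>x. std_normal_density x * f' x)"
    using int' by (simp add: integrable_std_normal_iff)
  have i2: "integrable lborel (\<lambda>x. std_normal_density x * (x * f x))"
    using intx by (subst (asm) integrable_std_normal_iff) auto
  have "(LINT x|lborel. std_normal_density x * f' x - std_normal_density x * (x * f x)) = 0"
    by (rule integral_derivative_eq_zero[OF d])
       (use i1 i2 lim0 gaussian_tail_mult_exp in auto)
  then have "(LINT x|lborel. std_normal_density x * f' x) = (LINT x|lborel. std_normal_density x * (x * f x))"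
    using i1 i2 by simp
  then show ?thesis
    by (simp add: integral_std_normal_eq)
qed

section \<open>Gaussian vectors and functions of exponential growth\<close>

abbreviation gauss :: "'i set \<Rightarrow> ('i \<Rightarrow> real) measure" where
  "gauss I \<equiv> PiM I (\<lambda>_. std_normal)"

abbreviation gauss_mat :: "nat \<Rightarrow> nat \<Rightarrow> (nat \<times> nat \<Rightarrow> real) measure" where
  "gauss_mat m N \<equiv> gauss ({..<m} \<times> {..<N})"

lemma product_sigma_finite_std_normal: "product_sigma_finite (\<lambda>_. std_normal)"
  by (simp add: product_sigma_finite_def prob_space_std_normal prob_space_imp_sigma_finite)

lemma prob_space_gauss: "prob_space (gauss I)"
  by (intro prob_space_PiM prob_space_std_normal)

lemma measurable_gauss_component:
  "c \<in> I \<Longrightarrow> (\<lambda>x. x c) \<in> borel_measurable (gauss I)"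
  using measurable_component_singleton[of c I "\<lambda>_. std_normal"] by simp

text \<open>The class in which every integral and integration by parts of the interpolation is
  justified: closed under sums and products, and integrable because Gaussians have all exponential
  moments. One \<open>C\<close> serves both as factor and as rate; \<open>exp_boundedI\<close>
  merges two different constants.\<close>

definition exp_bounded :: "'i set \<Rightarrow> (('i \<Rightarrow> real) \<Rightarrow> real) \<Rightarrow> bool" where
  "exp_bounded I f \<longleftrightarrow> f \<in> borel_measurable (gauss I) \<and>
     (\<exists>C\<ge>0. \<forall>x. \<bar>f x\<bar> \<le> C * exp (C * (\<Sum>i\<in>I. \<bar>x i\<bar>)))"

lemma exp_boundedI:
  assumes "f \<in> borel_measurable (gauss I)" and "\<And>x. \<bar>f x\<bar> \<le> A * exp (B * (\<Sum>i\<in>I. \<bar>x i\<bar>))"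
  shows "exp_bounded I f"
proof -
  define M where "M = max 0 (max A B)"
  have M: "0 \<le> M" "A \<le> M" "B \<le> M" by (auto simp: M_def)
  have "\<bar>f x\<bar> \<le> M * exp (M * (\<Sum>i\<in>I. \<bar>x i\<bar>))" for x
  proof (rule order_trans[OF assms(2)], rule mult_mono)
    have "0 \<le> (\<Sum>i\<in>I. \<bar>x i\<bar>)" by (intro sum_nonneg) auto
    with M(3) have "B * (\<Sum>i\<in>I. \<bar>x i\<bar>) \<le> M * (\<Sum>i\<in>I. \<bar>x i\<bar>)"
      by (rule mult_right_mono)
    then show "exp (B * (\<Sum>i\<in>I. \<bar>x i\<bar>)) \<le> exp (M * (\<Sum>i\<in>I. \<bar>x i\<bar>))"
      by (simp only: exp_le_cancel_iff)
  qed (use M in simp_all)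
  then show ?thesis
    unfolding exp_bounded_def using assms(1) M(1) by (intro conjI exI[of _ M] allI)
qed

lemma exp_boundedE:
  assumes "exp_bounded I f"
  obtains C where "0 \<le> C" "\<forall>x. \<bar>f x\<bar> \<le> C * exp (C * (\<Sum>i\<in>I. \<bar>x i\<bar>))"
  using assms unfolding exp_bounded_def by (elim conjE exE)

lemma exp_bounded_measurable: "exp_bounded I f \<Longrightarrow> f \<in> borel_measurable (gauss I)"
  unfolding exp_bounded_def by (rule conjunct1)

lemma exp_bounded_bound:
  assumes "exp_bounded I g" "f \<in> borel_measurable (gauss I)" "\<And>x. \<bar>f x\<bar> \<le> \<bar>g x\<bar>"
  shows "exp_bounded I f"
proof -
  obtain C where C0: "0 \<le> C" "\<forall>x. \<bar>g x\<bar> \<le> C * exp (C * (\<Sum>i\<in>I. \<bar>x i\<bar>))"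
    by (rule exp_boundedE[OF assms(1)])
  note C = C0(1) C0(2)[rule_format]
  from C show ?thesis
    by (intro exp_boundedI[OF assms(2), of C C] order_trans[OF assms(3)])
qed

lemma exp_bounded_const: "exp_bounded I (\<lambda>_. c)"
  by (rule exp_boundedI[of _ _ "\<bar>c\<bar>" 0]) auto

lemma exp_bounded_component:
  assumes "finite I" "c \<in> I"
  shows "exp_bounded I (\<lambda>x. x c)"
proof (rule exp_boundedI[of _ _ 1 1])
  fix x :: "'a \<Rightarrow> real"
  have "\<bar>x c\<bar> \<le> (\<Sum>i\<in>I. \<bar>x i\<bar>)" using assms by (intro member_le_sum) auto
  also have "\<dots> \<le> exp (\<Sum>i\<in>I. \<bar>x i\<bar>)" by (intro abs_le_exp sum_nonneg) auto
  finally show "\<bar>x c\<bar> \<le> 1 * exp (1 * (\<Sum>i\<in>I. \<bar>x i\<bar>))" by simp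
qed (use assms in simp)

lemma exp_bounded_of_bounded:
  "f \<in> borel_measurable (gauss I) \<Longrightarrow> (\<And>x. \<bar>f x\<bar> \<le> C) \<Longrightarrow> exp_bounded I f"
  by (rule exp_boundedI[where A = C and B = 0]) (simp_all only: mult_zero_left exp_zero mult_1_right)

lemma exp_bounded_mult:
  assumes "exp_bounded I f" "exp_bounded I g"
  shows "exp_bounded I (\<lambda>x. f x * g x)"
proof -
  obtain C where C0: "0 \<le> C" "\<forall>x. \<bar>f x\<bar> \<le> C * exp (C * (\<Sum>i\<in>I. \<bar>x i\<bar>))"
    by (rule exp_boundedE[OF assms(1)])
  note C = C0(1) C0(2)[rule_format]
  obtain D where D0: "0 \<le> D" "\<forall>x. \<bar>g x\<bar> \<le> D * exp (D * (\<Sum>i\<in>I. \<bar>x i\<bar>))"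
    by (rule exp_boundedE[OF assms(2)])
  note D = D0(1) D0(2)[rule_format]
  show ?thesis
  proof (rule exp_boundedI)
    fix x
    have "\<bar>f x * g x\<bar> \<le> (C * exp (C * (\<Sum>i\<in>I. \<bar>x i\<bar>))) * (D * exp (D * (\<Sum>i\<in>I. \<bar>x i\<bar>)))"
      unfolding abs_mult by (intro mult_mono C D) (use C in auto)
    also have "\<dots> = (C * D) * exp ((C + D) * (\<Sum>i\<in>I. \<bar>x i\<bar>))"
      by (simp add: exp_add[symmetric] algebra_simps)
    finally show "\<bar>f x * g x\<bar> \<le> (C * D) * exp ((C + D) * (\<Sum>i\<in>I. \<bar>x i\<bar>))" .
  qed (intro borel_measurable_times borel_measurable_add exp_bounded_measurable assms)
qed

lemma exp_bounded_add:
  assumes "exp_bounded I f" "exp_bounded I g"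
  shows "exp_bounded I (\<lambda>x. f x + g x)"
proof -
  obtain C where C0: "0 \<le> C" "\<forall>x. \<bar>f x\<bar> \<le> C * exp (C * (\<Sum>i\<in>I. \<bar>x i\<bar>))"
    by (rule exp_boundedE[OF assms(1)])
  note C = C0(1) C0(2)[rule_format]
  obtain D where D0: "0 \<le> D" "\<forall>x. \<bar>g x\<bar> \<le> D * exp (D * (\<Sum>i\<in>I. \<bar>x i\<bar>))"
    by (rule exp_boundedE[OF assms(2)])
  note D = D0(1) D0(2)[rule_format]
  show ?thesis
  proof (rule exp_boundedI)
    fix x :: "'a \<Rightarrow> real"
    have nn: "0 \<le> (\<Sum>i\<in>I. \<bar>x i\<bar>)" by (intro sum_nonneg) auto
    have "\<bar>f x + g x\<bar> \<le> C * exp (C * (\<Sum>i\<in>I. \<bar>x i\<bar>)) + D * exp (D * (\<Sum>i\<in>I. \<bar>x i\<bar>))"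
      using C(2)[of x] D(2)[of x] by linarith
    also have "\<dots> \<le> C * exp ((C + D) * (\<Sum>i\<in>I. \<bar>x i\<bar>)) + D * exp ((C + D) * (\<Sum>i\<in>I. \<bar>x i\<bar>))"
      using C(1) D(1) nn by (intro add_mono mult_left_mono, unfold exp_le_cancel_iff) (simp_all add: distrib_right)
    finally show "\<bar>f x + g x\<bar> \<le> (C + D) * exp ((C + D) * (\<Sum>i\<in>I. \<bar>x i\<bar>))"
      by (simp add: distrib_right)
  qed (intro borel_measurable_times borel_measurable_add exp_bounded_measurable assms)
qed

lemma exp_bounded_sum:
  "(\<And>a. a \<in> A \<Longrightarrow> exp_bounded I (f a)) \<Longrightarrow> exp_bounded I (\<lambda>x. \<Sum>a\<in>A. f a x)"
proof (induction A rule: infinite_finite_induct)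
  case (insert a A)
  then show ?case
    using exp_bounded_add[of I "f a" "\<lambda>x. \<Sum>a\<in>A. f a x"] by simp
qed (simp_all add: exp_bounded_const)

lemma integrable_exp_bounded:
  assumes "finite I" "exp_bounded I f"
  shows "integrable (gauss I) f"
proof -
  obtain C where C0: "0 \<le> C" "\<forall>x. \<bar>f x\<bar> \<le> C * exp (C * (\<Sum>i\<in>I. \<bar>x i\<bar>))"
    by (rule exp_boundedE[OF assms(2)])
  note C = C0(1) C0(2)[rule_format]
  show ?thesis
  proof (rule Bochner_Integration.integrable_bound)
    have "integrable (gauss I) (\<lambda>x. \<Prod>i\<in>I. exp (C * \<bar>x i\<bar>))"
      by (intro product_sigma_finite.product_integrable_prod[OF product_sigma_finite_std_normal] assms integrable_std_normal_exp_abs)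
    then show "integrable (gauss I) (\<lambda>x. C * exp (C * (\<Sum>i\<in>I. \<bar>x i\<bar>)))"
      using assms(1) by (simp add: exp_sum sum_distrib_left)
    show "AE x in gauss I. norm (f x) \<le> norm (C * exp (C * (\<Sum>i\<in>I. \<bar>x i\<bar>)))"
      by (intro AE_I2) (simp only: real_norm_def, rule order_trans[OF C(2) abs_ge_self])
  qed (intro exp_bounded_measurable assms)
qed

text \<open>Fubini isolates the coordinate \<open>c\<close> and leaves the one-dimensional identity
  on each slice; the other coordinates only enlarge the constant of the growth bound.\<close>

lemma gauss_stein:
  assumes I: "finite I" "c \<in> I" and f: "exp_bounded I f" and f': "exp_bounded I f'"
    and d: "\<And>x y. ((\<lambda>y. f (x(c := y))) has_real_derivative f' (x(c := y))) (at y)"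
  shows "(LINT x|gauss I. x c * f x) = (LINT x|gauss I. f' x)"
proof -
  obtain C where C0: "0 \<le> C" "\<forall>x. \<bar>f x\<bar> \<le> C * exp (C * (\<Sum>i\<in>I. \<bar>x i\<bar>))"
    by (rule exp_boundedE[OF f])
  note C = C0(1) C0(2)[rule_format]
  obtain D where D0: "0 \<le> D" "\<forall>x. \<bar>f' x\<bar> \<le> D * exp (D * (\<Sum>i\<in>I. \<bar>x i\<bar>))"
    by (rule exp_boundedE[OF f'])
  note D = D0(1) D0(2)[rule_format]
  define J where "J = I - {c}"
  have J: "finite J" "c \<notin> J" and IJ: "I = insert c J" using I by (auto simp: J_def)
  have ixf: "integrable (gauss (insert c J)) (\<lambda>x. x c * f x)" and if': "integrable (gauss (insert c J)) f'"
    using I f f' unfolding IJ[symmetric]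
    by (auto intro!: integrable_exp_bounded exp_bounded_mult exp_bounded_component)
  have slice: "(LINT y|std_normal. (x(c := y)) c * f (x(c := y))) = (LINT y|std_normal. f' (x(c := y)))"
    if x: "x \<in> space (gauss J)" for x
  proof -
    let ?s = "\<Sum>i\<in>J. \<bar>x i\<bar>" and ?M = "max C D"
    have s: "(\<Sum>i\<in>I. \<bar>(x(c := y)) i\<bar>) = \<bar>y\<bar> + ?s" for y
      unfolding IJ using J by (auto simp: sum.insert intro!: sum.cong)
    have nn: "0 \<le> ?s" by (intro sum_nonneg) auto
    have bd: "B * exp (B * (\<bar>y\<bar> + ?s)) \<le> (?M * exp (?M * ?s)) * exp (?M * \<bar>y\<bar>)"
      if "0 \<le> B" "B \<le> ?M" for y B
    proof -
      have "B * exp (B * (\<bar>y\<bar> + ?s)) \<le> ?M * exp (?M * (\<bar>y\<bar> + ?s))"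
        using that nn by (intro mult_mono, unfold exp_le_cancel_iff) (auto simp del: mult_le_cancel_right intro: mult_right_mono)
      then show ?thesis by (simp add: exp_add[symmetric] algebra_simps)
    qed
    have "f' \<in> borel_measurable (gauss (insert c J))"
      using exp_bounded_measurable[OF f'] unfolding IJ .
    from measurable_compose[OF measurable_component_update[OF x J(2)] this]
    have "(\<lambda>y. f' (x(c := y))) \<in> borel_measurable std_normal" .
    then have m: "(\<lambda>y. f' (x(c := y))) \<in> borel_measurable borel"
      by (simp only: measurable_density_eq1 measurable_lborel2)
    show ?thesis
      unfolding fun_upd_same
    proof (rule std_normal_stein[OF d m])
      fix y
      show "\<bar>f (x(c := y))\<bar> \<le> (?M * exp (?M * ?s)) * exp (?M * \<bar>y\<bar>)"
        using C(2)[of "x(c := y)"] bd[of C y] C(1) unfolding s by linarith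
      show "\<bar>f' (x(c := y))\<bar> \<le> (?M * exp (?M * ?s)) * exp (?M * \<bar>y\<bar>)"
        using D(2)[of "x(c := y)"] bd[of D y] D(1) unfolding s by linarith
    qed
  qed
  have "(LINT x|gauss I. x c * f x) = (LINT x|gauss J. LINT y|std_normal. (x(c := y)) c * f (x(c := y)))"
    unfolding IJ by (rule product_sigma_finite.product_integral_insert[OF product_sigma_finite_std_normal J ixf])
  also have "\<dots> = (LINT x|gauss J. LINT y|std_normal. f' (x(c := y)))"
    by (intro Bochner_Integration.integral_cong refl slice)
  also have "\<dots> = (LINT x|gauss I. f' x)"
    unfolding IJ by (rule product_sigma_finite.product_integral_insert[OF product_sigma_finite_std_normal J if', symmetric])
  finally show ?thesis .
qed

section \<open>Gordon's comparison\<close>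

text \<open>Cauchy-Schwarz in the unit ball, by AM-GM in each coordinate. Gordon's comparison takes
  both of its signs from here: once for the vectors \<open>h\<close>, once for the gradients
  \<open>dir\<close>.\<close>

lemma sum_mult_le_1:
  fixes f g :: "nat \<Rightarrow> real"
  assumes "(\<Sum>j<n. (f j)\<^sup>2) \<le> 1" "(\<Sum>j<n. (g j)\<^sup>2) \<le> 1"
  shows "(\<Sum>j<n. f j * g j) \<le> 1"
proof -
  have "f j * g j \<le> ((f j)\<^sup>2 + (g j)\<^sup>2) / 2" for j
    using sum_squares_bound[of "f j" "g j"] by simp
  then have "(\<Sum>j<n. f j * g j) \<le> (\<Sum>j<n. ((f j)\<^sup>2 + (g j)\<^sup>2) / 2)"
    by (intro sum_mono)
  also have "\<dots> = ((\<Sum>j<n. (f j)\<^sup>2) + (\<Sum>j<n. (g j)\<^sup>2)) / 2"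
    by (simp add: sum_divide_distrib[symmetric] sum.distrib)
  also have "\<dots> \<le> 1"
    using add_mono[OF assms] by simp
  finally show ?thesis .
qed

text \<open>
  A matrix \<open>L j h\<close> stands for the value at \<open>h\<close> of the \<open>j\<close>-th coordinate of a vector-valued process
  (rows \<open>j < m\<close>) together with a scalar process (row \<open>m\<close>). The function \<open>F\<close> is a smooth
  surrogate for \<open>max_h exp (- \<beta> \<kappa> (|L h| + L m h))\<close>, and \<open>dir\<close> is the gradient of \<open>soft_norm L h + L m h\<close>.
\<close>

locale gordon_process =
  fixes m N :: nat and T :: "(nat \<Rightarrow> real) set" and \<beta> \<kappa> \<eta> :: real
  assumes finite_T: "finite T" and T_nonempty: "T \<noteq> {}"
    and unit_T: "\<And>h. h \<in> T \<Longrightarrow> (\<Sum>i<N. (h i)\<^sup>2) = 1"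
    and \<beta>: "0 < \<beta>" and \<kappa>: "0 \<le> \<kappa>" "\<kappa> \<le> 1" and \<eta>: "0 < \<eta>"
begin

text \<open>The summand \<open>\<eta>\<^sup>2\<close> removes the singularity of the Euclidean norm
  at zero and keeps its second derivatives below \<open>1 / \<eta>\<close>.\<close>

definition soft_norm :: "(nat \<Rightarrow> (nat \<Rightarrow> real) \<Rightarrow> real) \<Rightarrow> (nat \<Rightarrow> real) \<Rightarrow> real" where
  "soft_norm L h = sqrt (\<eta>\<^sup>2 + (\<Sum>j<m. (L j h)\<^sup>2))"

definition dir :: "(nat \<Rightarrow> (nat \<Rightarrow> real) \<Rightarrow> real) \<Rightarrow> nat \<Rightarrow> (nat \<Rightarrow> real) \<Rightarrow> real" where
  "dir L j h = (if j < m then L j h / soft_norm L h else 1)"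

definition pot :: "(nat \<Rightarrow> (nat \<Rightarrow> real) \<Rightarrow> real) \<Rightarrow> (nat \<Rightarrow> real) \<Rightarrow> real" where
  "pot L h = - \<beta> * (soft_norm L h + L m h)"

definition part :: "(nat \<Rightarrow> (nat \<Rightarrow> real) \<Rightarrow> real) \<Rightarrow> real" where
  "part L = (\<Sum>h\<in>T. exp (pot L h))"

text \<open>Gibbs weights on \<open>T\<close> for the energy \<open>- pot L\<close>, with
  \<open>part\<close> as partition function.\<close>

definition wt :: "(nat \<Rightarrow> (nat \<Rightarrow> real) \<Rightarrow> real) \<Rightarrow> (nat \<Rightarrow> real) \<Rightarrow> real" where
  "wt L h = exp (pot L h) / part L"

text \<open>Since the largest summand is at most \<open>part L\<close>, which is at most
  \<open>card T\<close> times that summand, \<open>F\<close> overestimates the maximum by a factor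
  of at most \<open>card T powr \<kappa>\<close>. With \<open>\<beta> * \<kappa>\<close> fixed and
  \<open>\<kappa>\<close> tending to zero, this factor tends to \<open>1\<close>.\<close>

definition F :: "(nat \<Rightarrow> (nat \<Rightarrow> real) \<Rightarrow> real) \<Rightarrow> real" where
  "F L = part L powr \<kappa>"

lemma soft_norm_ge: "\<eta> \<le> soft_norm L h"
  unfolding soft_norm_def using \<eta> by (intro real_le_rsqrt) (simp add: sum_nonneg)

lemma soft_norm_pos: "0 < soft_norm L h"
  using soft_norm_ge[of L h] \<eta> by linarith

lemma soft_norm_sq: "(soft_norm L h)\<^sup>2 = \<eta>\<^sup>2 + (\<Sum>j<m. (L j h)\<^sup>2)"
  unfolding soft_norm_def by (intro real_sqrt_pow2 add_nonneg_nonneg sum_nonneg) auto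

lemma part_pos: "0 < part L"
  unfolding part_def using finite_T T_nonempty by (intro sum_pos) auto

lemma wt_nonneg: "0 \<le> wt L h"
  unfolding wt_def using part_pos[of L] by simp

lemma sum_wt: "(\<Sum>h\<in>T. wt L h) = 1"
  unfolding wt_def using part_pos[of L] by (simp add: sum_divide_distrib[symmetric] part_def[symmetric])

lemma wt_le_1: "h \<in> T \<Longrightarrow> wt L h \<le> 1"
  using member_le_sum[of h T "wt L"] finite_T by (simp add: sum_wt wt_nonneg)

lemma F_pos: "0 < F L"
  unfolding F_def using part_pos[of L] by simp

lemma sum_dir_sq: "(\<Sum>j<m. (dir L j h)\<^sup>2) \<le> 1"
proof -
  have "(\<Sum>j<m. (dir L j h)\<^sup>2) = (\<Sum>j<m. (L j h)\<^sup>2) / (soft_norm L h)\<^sup>2"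
    by (simp add: dir_def power_divide sum_divide_distrib)
  also have "\<dots> \<le> 1"
  proof (subst divide_le_eq_1_pos)
    show "0 < (soft_norm L h)\<^sup>2" using soft_norm_pos[of L h] by simp
    show "(\<Sum>j<m. (L j h)\<^sup>2) \<le> (soft_norm L h)\<^sup>2" by (simp add: soft_norm_sq)
  qed
  finally show ?thesis .
qed

lemma abs_dir_le_1: "\<bar>dir L j h\<bar> \<le> 1"
proof (cases "j < m")
  case True
  have "(dir L j h)\<^sup>2 \<le> (\<Sum>j<m. (dir L j h)\<^sup>2)"
    using True by (intro member_le_sum) auto
  then have "(dir L j h)\<^sup>2 \<le> 1" using sum_dir_sq[of L h] by linarith
  then show ?thesis by (simp add: abs_square_le_1)
qed (simp add: dir_def)

section \<open>Derivatives of the surrogate along a curve of matrices\<close>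

context
  fixes L :: "real \<Rightarrow> nat \<Rightarrow> (nat \<Rightarrow> real) \<Rightarrow> real" and L' :: "nat \<Rightarrow> (nat \<Rightarrow> real) \<Rightarrow> real" and s :: real
  assumes dL: "\<And>j h. ((\<lambda>s. L s j h) has_real_derivative L' j h) (at s)"
begin

lemma soft_norm_deriv: "((\<lambda>s. soft_norm (L s) h) has_real_derivative (\<Sum>j<m. dir (L s) j h * L' j h)) (at s)"
proof -
  have "((\<lambda>s. \<eta>\<^sup>2 + (\<Sum>j<m. (L s j h)\<^sup>2)) has_real_derivative (\<Sum>j<m. 2 * L s j h * L' j h)) (at s)"
    by ((rule derivative_eq_intros dL refl | simp)+, simp add: mult_ac)
  moreover have "0 < \<eta>\<^sup>2 + (\<Sum>j<m. (L s j h)\<^sup>2)"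
    using \<eta> by (intro add_pos_nonneg sum_nonneg) auto
  ultimately have "((\<lambda>s. soft_norm (L s) h) has_real_derivative
      (inverse (soft_norm (L s) h) / 2) * (\<Sum>j<m. 2 * L s j h * L' j h)) (at s)"
    unfolding soft_norm_def by (intro DERIV_chain2[OF DERIV_real_sqrt])
  moreover have "(inverse (soft_norm (L s) h) / 2) * (\<Sum>j<m. 2 * L s j h * L' j h) = (\<Sum>j<m. dir (L s) j h * L' j h)"
    by (simp add: dir_def sum_distrib_left field_simps)
  ultimately show ?thesis by simp
qed

lemma pot_deriv: "((\<lambda>s. pot (L s) h) has_real_derivative - \<beta> * (\<Sum>j\<le>m. dir (L s) j h * L' j h)) (at s)"
  unfolding pot_def
  by (rule derivative_eq_intros soft_norm_deriv dL refl)+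
     (simp add: dir_def lessThan_Suc_atMost[symmetric])

lemma part_deriv: "((\<lambda>s. part (L s)) has_real_derivative
    part (L s) * (\<Sum>h\<in>T. wt (L s) h * (- \<beta> * (\<Sum>j\<le>m. dir (L s) j h * L' j h)))) (at s)"
  unfolding part_def
  by (rule derivative_eq_intros pot_deriv refl)+
     (use part_pos[of "L s"] in \<open>simp add: wt_def sum_distrib_left part_def\<close>)

text \<open>Needed along two kinds of curves: the angle \<open>\<theta>\<close> of the
  interpolation, and a single entry of the Gaussian matrix for the integration by parts.\<close>

lemma F_deriv: "((\<lambda>s. F (L s)) has_real_derivative
    \<kappa> * F (L s) * (\<Sum>h\<in>T. wt (L s) h * (- \<beta> * (\<Sum>j\<le>m. dir (L s) j h * L' j h)))) (at s)"
proof -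
  have "((\<lambda>s. part (L s) powr \<kappa>) has_real_derivative \<kappa> * part (L s) powr (\<kappa> - 1) *
     (part (L s) * (\<Sum>h\<in>T. wt (L s) h * (- \<beta> * (\<Sum>j\<le>m. dir (L s) j h * L' j h))))) (at s)"
    by (rule DERIV_cong[OF DERIV_fun_powr[OF part_deriv part_pos, of \<kappa>]]) simp
  moreover have "part (L s) powr (\<kappa> - 1) * part (L s) = F (L s)"
    using part_pos[of "L s"] by (simp add: F_def powr_diff)
  ultimately show ?thesis
    unfolding F_def[of "L _"] by (elim DERIV_cong) (simp add: mult.assoc[symmetric] F_def)
qed

text \<open>The logarithmic derivative of a Gibbs weight is the derivative of its own
  \<open>pot\<close> minus the Gibbs mean of these derivatives.\<close>

lemma wt_deriv: "((\<lambda>s. wt (L s) h) has_real_derivative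
    wt (L s) h * (- \<beta> * (\<Sum>j\<le>m. dir (L s) j h * L' j h)
      - (\<Sum>h\<in>T. wt (L s) h * (- \<beta> * (\<Sum>j\<le>m. dir (L s) j h * L' j h))))) (at s)"
  unfolding wt_def[of _ h]
  apply (rule derivative_eq_intros pot_deriv part_deriv refl)+
  using part_pos[of "L s"] apply (simp add: field_simps)
  using part_pos[of "L s"] apply (simp add: field_simps)
  done

lemma dir_deriv: "j < m \<Longrightarrow> ((\<lambda>s. dir (L s) j h) has_real_derivative
    (L' j h - dir (L s) j h * (\<Sum>j<m. dir (L s) j h * L' j h)) / soft_norm (L s) h) (at s)"
  unfolding dir_def[of _ j]
  apply (simp)
  apply (rule derivative_eq_intros soft_norm_deriv dL refl)+
  using soft_norm_pos[of "L s" h] apply (simp_all add: field_simps)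
  done

end

text \<open>
  Both processes are read off a single \<open>(m+1) \<times> (N+1)\<close> Gaussian matrix: its blocks are \<open>A\<close>, the last column
  \<open>G\<close>, the last row \<open>g\<close> and the corner \<open>\<gamma>\<close>. The angle \<open>0\<close> gives \<open>|A h| + \<gamma>\<close>, the angle \<open>pi/2\<close> gives
  \<open>|G| + \<langle>g, h\<rangle>\<close>. By \<open>sum_coef_coef'\<close> below the diagonal terms, which contain the second derivatives of the
  norm, cancel after integration by parts.
\<close>

definition coef :: "real \<Rightarrow> nat \<Rightarrow> (nat \<Rightarrow> real) \<Rightarrow> nat \<Rightarrow> real" where
  "coef \<theta> j h i = (if j < m then (if i < N then cos \<theta> * h i else sin \<theta>)
                  else (if i < N then sin \<theta> * h i else cos \<theta>))"

definition coef' :: "real \<Rightarrow> nat \<Rightarrow> (nat \<Rightarrow> real) \<Rightarrow> nat \<Rightarrow> real" where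
  "coef' \<theta> j h i = (if j < m then (if i < N then - sin \<theta> * h i else cos \<theta>)
                  else (if i < N then cos \<theta> * h i else - sin \<theta>))"

definition lin :: "real \<Rightarrow> (nat \<times> nat \<Rightarrow> real) \<Rightarrow> nat \<Rightarrow> (nat \<Rightarrow> real) \<Rightarrow> real" where
  "lin \<theta> \<omega> j h = (\<Sum>i\<le>N. coef \<theta> j h i * \<omega> (j, i))"

text \<open>Up to the factor \<open>- (\<kappa> * \<beta>)\<close>, the partial derivative of
  \<open>F\<close> with respect to the entry \<open>L j h\<close>.\<close>

definition Phi :: "real \<Rightarrow> (nat \<times> nat \<Rightarrow> real) \<Rightarrow> nat \<Rightarrow> (nat \<Rightarrow> real) \<Rightarrow> real" where
  "Phi \<theta> \<omega> j h = F (lin \<theta> \<omega>) * wt (lin \<theta> \<omega>) h * dir (lin \<theta> \<omega>) j h"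

text \<open>The diagonal of the Hessian of \<open>soft_norm\<close>. It is zero in row
  \<open>m\<close>, where the scalar process enters linearly.\<close>

definition curv :: "(nat \<Rightarrow> (nat \<Rightarrow> real) \<Rightarrow> real) \<Rightarrow> nat \<Rightarrow> (nat \<Rightarrow> real) \<Rightarrow> real" where
  "curv L j h = (if j < m then (1 - (dir L j h)\<^sup>2) / soft_norm L h else 0)"

text \<open>The derivative of \<open>Phi\<close> in the matrix entry \<open>(j, i)\<close>, sorted
  by coefficient: the terms with \<open>coef\<close> at \<open>h\<close> itself, which will cancel,
  and those coupling \<open>h\<close> to \<open>h'\<close>, which decide the sign.\<close>

definition dPhi :: "real \<Rightarrow> (nat \<times> nat \<Rightarrow> real) \<Rightarrow> nat \<Rightarrow> (nat \<Rightarrow> real) \<Rightarrow> nat \<Rightarrow> real" where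
  "dPhi \<theta> \<omega> j h i = (let L = lin \<theta> \<omega> in F L * wt L h *
      (coef \<theta> j h i * (curv L j h + (- \<beta>) * (dir L j h * dir L j h))
       + (1 - \<kappa>) * \<beta> * (\<Sum>h'\<in>T. wt L h' * (dir L j h * dir L j h') * coef \<theta> j h' i)))"

abbreviation idx :: "(nat \<times> nat) set" where "idx \<equiv> {..m} \<times> {..N}"

lemma finite_idx: "finite idx" by simp

section \<open>The interpolation between the two processes\<close>

lemma coef_deriv: "((\<lambda>\<theta>. coef \<theta> j h i) has_real_derivative coef' \<theta> j h i) (at \<theta>)"
  unfolding coef_def coef'_def by (auto intro!: derivative_eq_intros)

lemma lin_deriv: "((\<lambda>\<theta>. lin \<theta> \<omega> j h) has_real_derivative (\<Sum>i\<le>N. coef' \<theta> j h i * \<omega> (j, i))) (at \<theta>)"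
  unfolding lin_def by (auto intro!: derivative_eq_intros coef_deriv)

lemma lin_update_deriv:
  assumes "i \<le> N"
  shows "((\<lambda>y. lin \<theta> (fun_upd \<omega> (j, i) y) j' h) has_real_derivative (if j' = j then coef \<theta> j h i else 0)) (at y)"
proof (cases "j' = j")
  case True
  have "lin \<theta> (fun_upd \<omega> (j, i) y) j h = coef \<theta> j h i * y + (\<Sum>i\<in>{..N} - {i}. coef \<theta> j h i * \<omega> (j, i))" for y
    unfolding lin_def using assms by (subst sum.remove[of _ i]) (auto intro!: sum.cong)
  then show ?thesis using True by (auto intro!: derivative_eq_intros)
next
  case False
  then have "lin \<theta> (fun_upd \<omega> (j, i) y) j' h = lin \<theta> \<omega> j' h" for y
    unfolding lin_def by auto
  then show ?thesis using False by simp
qed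

text \<open>The sum is half the \<open>\<theta>\<close>-derivative of the covariance, in row
  \<open>j\<close>, of the values at \<open>h\<close> and \<open>h'\<close>. It vanishes for
  \<open>h = h'\<close> because unit vectors keep the variance constant, and the exchange of sine
  and cosine reverses its sign in row \<open>m\<close>.\<close>

lemma sum_coef_coef':
  assumes h: "h \<in> T" "h' \<in> T"
  shows "(\<Sum>i\<le>N. coef' \<theta> j h i * coef \<theta> j h' i) =
    (if j < m then 1 else - 1) * (sin \<theta> * cos \<theta>) * (1 - (\<Sum>i<N. h i * h' i))"
proof -
  have "(\<Sum>i<N. coef' \<theta> j h i * coef \<theta> j h' i) =
     (if j < m then - 1 else 1) * (sin \<theta> * cos \<theta>) * (\<Sum>i<N. h i * h' i)"
    unfolding sum_distrib_left by (intro sum.cong) (auto simp: coef_def coef'_def)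
  then show ?thesis
    by (simp add: lessThan_Suc_atMost[symmetric] coef_def coef'_def algebra_simps)
qed

lemma inner_self: "h \<in> T \<Longrightarrow> (\<Sum>i<N. h i * h i) = 1"
  using unit_T by (simp add: power2_eq_square)

lemma abs_h_le_1:
  assumes "h \<in> T" "i < N"
  shows "\<bar>h i\<bar> \<le> 1"
proof -
  have "(h i)\<^sup>2 \<le> (\<Sum>i<N. (h i)\<^sup>2)" using assms by (intro member_le_sum) auto
  then show ?thesis using unit_T[OF assms(1)] by (simp add: abs_square_le_1)
qed

lemma abs_coef_le_1: "h \<in> T \<Longrightarrow> \<bar>coef \<theta> j h i\<bar> \<le> 1"
  and abs_coef'_le_1: "h \<in> T \<Longrightarrow> \<bar>coef' \<theta> j h i\<bar> \<le> 1"
  unfolding coef_def coef'_def using abs_h_le_1[of h i]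
  by (auto simp: abs_mult intro!: mult_le_one)

lemma sum_row_le:
  fixes \<omega> :: "nat \<times> nat \<Rightarrow> real"
  assumes "j \<le> m"
  shows "(\<Sum>i\<le>N. \<bar>\<omega> (j, i)\<bar>) \<le> (\<Sum>c\<in>idx. \<bar>\<omega> c\<bar>)"
proof -
  have "(\<Sum>i\<le>N. \<bar>\<omega> (j, i)\<bar>) \<le> (\<Sum>j\<le>m. \<Sum>i\<le>N. \<bar>\<omega> (j, i)\<bar>)"
    using assms by (intro member_le_sum sum_nonneg) auto
  then show ?thesis by (simp add: sum.cartesian_product)
qed

lemma abs_linear_le:
  fixes \<omega> :: "nat \<times> nat \<Rightarrow> real"
  assumes "j \<le> m" "\<And>i. \<bar>a i\<bar> \<le> 1"
  shows "\<bar>\<Sum>i\<le>N. a i * \<omega> (j, i)\<bar> \<le> (\<Sum>c\<in>idx. \<bar>\<omega> c\<bar>)"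
proof -
  have "\<bar>\<Sum>i\<le>N. a i * \<omega> (j, i)\<bar> \<le> (\<Sum>i\<le>N. \<bar>a i * \<omega> (j, i)\<bar>)" by (rule sum_abs)
  also have "\<dots> \<le> (\<Sum>i\<le>N. \<bar>\<omega> (j, i)\<bar>)"
    using assms(2) by (intro sum_mono) (auto simp: abs_mult intro: mult_left_le_one_le)
  finally show ?thesis using sum_row_le[OF assms(1), of \<omega>] by linarith
qed

lemma F_bound:
  "F (lin \<theta> \<omega>) \<le> real (card T) powr \<kappa> * exp (\<kappa> * \<beta> * (\<Sum>c\<in>idx. \<bar>\<omega> c\<bar>))"
proof -
  let ?s = "\<Sum>c\<in>idx. \<bar>\<omega> c\<bar>"
  have "exp (pot (lin \<theta> \<omega>) h) \<le> exp (\<beta> * ?s)" if "h \<in> T" for h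
  proof -
    have "\<bar>lin \<theta> \<omega> m h\<bar> \<le> ?s"
      unfolding lin_def by (rule abs_linear_le[OF order_refl abs_coef_le_1[OF that]])
    then have "- (soft_norm (lin \<theta> \<omega>) h + lin \<theta> \<omega> m h) \<le> ?s"
      using soft_norm_pos[of "lin \<theta> \<omega>" h] by linarith
    then have "\<beta> * - (soft_norm (lin \<theta> \<omega>) h + lin \<theta> \<omega> m h) \<le> \<beta> * ?s"
      using \<beta> by (intro mult_left_mono) auto
    then show ?thesis by (simp add: pot_def algebra_simps)
  qed
  then have "part (lin \<theta> \<omega>) \<le> real (card T) * exp (\<beta> * ?s)"
    unfolding part_def by (rule sum_bounded_above)
  then have "F (lin \<theta> \<omega>) \<le> (real (card T) * exp (\<beta> * ?s)) powr \<kappa>"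
    unfolding F_def using part_pos[of "lin \<theta> \<omega>"] \<kappa> by (intro powr_mono2) auto
  then show ?thesis
    by (simp add: powr_mult exp_powr_real mult_ac)
qed

lemma sum_dir_single:
  assumes "j \<le> m"
  shows "(\<Sum>j'\<le>m. dir L j' h * (if j' = j then a else 0)) = dir L j h * a"
    and "(\<Sum>j'<m. dir L j' h * (if j' = j then a else 0)) = (if j < m then dir L j h * a else 0)"
proof -
  show "(\<Sum>j'\<le>m. dir L j' h * (if j' = j then a else 0)) = dir L j h * a"
    using assms by (simp add: if_distrib sum.delta cong: if_cong)
  show "(\<Sum>j'<m. dir L j' h * (if j' = j then a else 0)) = (if j < m then dir L j h * a else 0)"
    by (simp add: if_distrib sum.delta cong: if_cong)
qed

lemma Phi_update_deriv:
  assumes j: "j \<le> m" and i: "i \<le> N"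
  shows "((\<lambda>y. Phi \<theta> (fun_upd \<omega> (j, i) y) j h) has_real_derivative
     dPhi \<theta> (fun_upd \<omega> (j, i) y) j h i) (at y)"
proof -
  have dL: "((\<lambda>y. lin \<theta> (fun_upd \<omega> (j, i) y) j' h) has_real_derivative (if j' = j then coef \<theta> j h i else 0)) (at y)"
    for j' h by (rule lin_update_deriv[OF i])
  define L where "L = lin \<theta> (fun_upd \<omega> (j, i) y)"
  \<comment> \<open>\<open>X\<close> is the Gibbs mean of the derivatives of \<open>pot\<close>. It
    enters with factor \<open>\<kappa>\<close> through \<open>F\<close> and with factor
    \<open>-1\<close> through \<open>wt\<close>, hence the coefficient \<open>\<kappa> - 1\<close>
    below.\<close>
  define X where "X = (\<Sum>h\<in>T. wt L h * (- \<beta> * (dir L j h * coef \<theta> j h i)))"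
  have dF: "((\<lambda>y. F (lin \<theta> (fun_upd \<omega> (j, i) y))) has_real_derivative \<kappa> * F L * X) (at y)"
    using F_deriv[where L = "\<lambda>y. lin \<theta> (fun_upd \<omega> (j, i) y)", OF dL]
    unfolding sum_dir_single[OF j] L_def X_def .
  have dw: "((\<lambda>y. wt (lin \<theta> (fun_upd \<omega> (j, i) y)) h) has_real_derivative
      wt L h * (- \<beta> * (dir L j h * coef \<theta> j h i) - X)) (at y)"
    using wt_deriv[where L = "\<lambda>y. lin \<theta> (fun_upd \<omega> (j, i) y)" and h = h, OF dL]
    unfolding sum_dir_single[OF j] L_def X_def .
  have dd: "((\<lambda>y. dir (lin \<theta> (fun_upd \<omega> (j, i) y)) j h) has_real_derivative coef \<theta> j h i * curv L j h) (at y)"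
  proof (cases "j < m")
    case True
    from dir_deriv[where L = "\<lambda>y. lin \<theta> (fun_upd \<omega> (j, i) y)" and h = h, OF dL True] show ?thesis
      unfolding sum_dir_single[OF j] L_def[symmetric]
      by (elim DERIV_cong) (use True in \<open>simp add: curv_def power2_eq_square algebra_simps\<close>)
  next
    case False
    then show ?thesis by (simp add: dir_def curv_def)
  qed
  have X: "(1 - \<kappa>) * \<beta> * (\<Sum>h'\<in>T. wt L h' * (dir L j h * dir L j h') * coef \<theta> j h' i) = (\<kappa> - 1) * (X * dir L j h)"
  proof -
    have "X * dir L j h = - \<beta> * (\<Sum>h'\<in>T. wt L h' * (dir L j h * dir L j h') * coef \<theta> j h' i)"
      unfolding X_def sum_distrib_left sum_distrib_right by (intro sum.cong) auto
    then show ?thesis by (simp only:) (simp add: algebra_simps)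
  qed
  have "((\<lambda>y. Phi \<theta> (fun_upd \<omega> (j, i) y) j h) has_real_derivative
     (\<kappa> * F L * X * wt L h + wt L h * (- \<beta> * (dir L j h * coef \<theta> j h i) - X) * F L) * dir L j h
     + coef \<theta> j h i * curv L j h * (F L * wt L h)) (at y)"
    unfolding Phi_def using DERIV_mult[OF DERIV_mult[OF dF dw] dd] unfolding L_def[symmetric] .
  then show ?thesis
  proof (rule DERIV_cong)
    show "(\<kappa> * F L * X * wt L h + wt L h * (- \<beta> * (dir L j h * coef \<theta> j h i) - X) * F L) * dir L j h
     + coef \<theta> j h i * curv L j h * (F L * wt L h) = dPhi \<theta> (fun_upd \<omega> (j, i) y) j h i"
      unfolding dPhi_def Let_def L_def[symmetric] X
      by (simp add: algebra_simps power2_eq_square)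
  qed
qed

section \<open>Measurability and growth of the integrands\<close>

lemma measurable_process:
  assumes L: "\<And>j h. j \<le> m \<Longrightarrow> (\<lambda>x. L x j h) \<in> borel_measurable M"
  shows "(\<lambda>x. soft_norm (L x) h) \<in> borel_measurable M"
    and "j \<le> m \<Longrightarrow> (\<lambda>x. dir (L x) j h) \<in> borel_measurable M"
    and "(\<lambda>x. F (L x)) \<in> borel_measurable M"
    and "(\<lambda>x. wt (L x) h) \<in> borel_measurable M"
    and "j \<le> m \<Longrightarrow> (\<lambda>x. curv (L x) j h) \<in> borel_measurable M"
proof -
  have soft_norm [measurable]: "(\<lambda>x. soft_norm (L x) h) \<in> borel_measurable M" for h
  proof -
    have sqrt: "(\<lambda>x. sqrt (\<eta>\<^sup>2 + g x)) \<in> borel_measurable M" if "g \<in> borel_measurable M" for g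
      using that by measurable
    show ?thesis
      unfolding soft_norm_def by (intro sqrt borel_measurable_sum borel_measurable_power L) auto
  qed
  have pot: "(\<lambda>x. pot (L x) h) \<in> borel_measurable M" for h
    unfolding pot_def by (intro borel_measurable_times borel_measurable_add borel_measurable_const soft_norm L order_refl)
  have part: "(\<lambda>x. part (L x)) \<in> borel_measurable M"
    unfolding part_def by (intro borel_measurable_sum measurable_compose[OF pot borel_measurable_exp])
  show "(\<lambda>x. soft_norm (L x) h) \<in> borel_measurable M" by (rule soft_norm)
  have dir: "(\<lambda>x. dir (L x) j h) \<in> borel_measurable M" if "j \<le> m" for j h
    unfolding dir_def using borel_measurable_divide[OF L[OF that, of h] soft_norm[of h]]
    by (cases "j < m") (simp_all only: if_True if_False borel_measurable_const)
  then show "j \<le> m \<Longrightarrow> (\<lambda>x. dir (L x) j h) \<in> borel_measurable M" .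
  show "(\<lambda>x. F (L x)) \<in> borel_measurable M"
    unfolding F_def by (rule measurable_compose[OF part, of "\<lambda>x. x powr \<kappa>"]) measurable
  show "(\<lambda>x. wt (L x) h) \<in> borel_measurable M"
    unfolding wt_def by (intro borel_measurable_divide part measurable_compose[OF pot borel_measurable_exp])
  show "(\<lambda>x. curv (L x) j h) \<in> borel_measurable M" if "j \<le> m"
  proof (cases "j < m")
    case True
    have "(\<lambda>x. (1 - (dir (L x) j h)\<^sup>2) / soft_norm (L x) h) \<in> borel_measurable M"
      by (intro borel_measurable_divide borel_measurable_diff borel_measurable_const borel_measurable_power dir that soft_norm)
    then show ?thesis unfolding curv_def by (simp only: True if_True)
  qed (simp only: curv_def if_False borel_measurable_const)
qed

lemma lin_measurable: "j \<le> m \<Longrightarrow> (\<lambda>\<omega>. lin \<theta> \<omega> j h) \<in> borel_measurable (gauss idx)"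
  unfolding lin_def
  by (intro borel_measurable_sum borel_measurable_times borel_measurable_const measurable_gauss_component) auto

lemma exp_bounded_F: "exp_bounded idx (\<lambda>\<omega>. F (lin \<theta> \<omega>))"
  by (rule exp_boundedI[OF measurable_process(3)[OF lin_measurable]])
     (use F_bound F_pos in \<open>simp_all add: less_imp_le\<close>)

lemma abs_Phi_le: "j \<le> m \<Longrightarrow> h \<in> T \<Longrightarrow> \<bar>Phi \<theta> \<omega> j h\<bar> \<le> F (lin \<theta> \<omega>)"
proof -
  assume "j \<le> m" "h \<in> T"
  then have "\<bar>wt (lin \<theta> \<omega>) h\<bar> * \<bar>dir (lin \<theta> \<omega>) j h\<bar> \<le> 1"
    using wt_nonneg wt_le_1 abs_dir_le_1 by (intro mult_le_one) auto
  then have "F (lin \<theta> \<omega>) * (\<bar>wt (lin \<theta> \<omega>) h\<bar> * \<bar>dir (lin \<theta> \<omega>) j h\<bar>) \<le> F (lin \<theta> \<omega>) * 1"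
    using F_pos by (intro mult_left_mono) (auto simp: less_imp_le)
  then show ?thesis
    using F_pos[of "lin \<theta> \<omega>"] by (simp add: Phi_def abs_mult mult.assoc)
qed

lemma Phi_measurable:
  "j \<le> m \<Longrightarrow> (\<lambda>\<omega>. Phi \<theta> \<omega> j h) \<in> borel_measurable (gauss idx)"
  unfolding Phi_def by (intro borel_measurable_times measurable_process lin_measurable)

lemma exp_bounded_Phi: "j \<le> m \<Longrightarrow> h \<in> T \<Longrightarrow> exp_bounded idx (\<lambda>\<omega>. Phi \<theta> \<omega> j h)"
  by (rule exp_bounded_bound[OF exp_bounded_F Phi_measurable])
     (use abs_Phi_le F_pos in \<open>simp_all add: less_imp_le abs_of_nonneg\<close>)

text \<open>This is what the smoothing buys: the Hessian of the plain norm is unbounded near zero,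
  whereas \<open>dPhi\<close> has to be of exponential growth for Stein's identity.\<close>

lemma abs_curv_le: "\<bar>curv L j h\<bar> \<le> 1 / \<eta>"
proof -
  have "(dir L j h)\<^sup>2 \<le> 1" using abs_dir_le_1[of L j h] by (simp add: abs_square_le_1)
  then have "\<bar>(1 - (dir L j h)\<^sup>2) / soft_norm L h\<bar> \<le> 1 / \<eta>"
    using soft_norm_ge[of L h] soft_norm_pos[of L h] \<eta> unfolding abs_divide by (intro frac_le) auto
  then show ?thesis using \<eta> by (simp add: curv_def)
qed

lemma exp_bounded_dPhi:
  assumes "j \<le> m" "h \<in> T"
  shows "exp_bounded idx (\<lambda>\<omega>. dPhi \<theta> \<omega> j h i)"
proof -
  have wt: "exp_bounded idx (\<lambda>\<omega>. wt (lin \<theta> \<omega>) h)" if "h \<in> T" for h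
    by (rule exp_bounded_of_bounded[OF measurable_process(4)[OF lin_measurable], where C = 1])
       (use wt_nonneg wt_le_1[OF that] in auto)
  have dir: "exp_bounded idx (\<lambda>\<omega>. dir (lin \<theta> \<omega>) j h)" for h
    by (rule exp_bounded_of_bounded[OF measurable_process(2)[OF lin_measurable], where C = 1])
       (use abs_dir_le_1 assms in auto)
  have curv: "exp_bounded idx (\<lambda>\<omega>. curv (lin \<theta> \<omega>) j h)" for h
    by (rule exp_bounded_of_bounded[OF measurable_process(5)[OF lin_measurable], where C = "1 / \<eta>"])
       (use abs_curv_le assms in auto)
  show ?thesis
    unfolding dPhi_def Let_def
    by (intro exp_bounded_mult exp_bounded_add exp_bounded_sum exp_bounded_const exp_bounded_F wt dir curv assms)
qed

definition F_rate :: "real \<Rightarrow> (nat \<times> nat \<Rightarrow> real) \<Rightarrow> real" where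
  "F_rate \<theta> \<omega> = - (\<kappa> * \<beta>) * (\<Sum>h\<in>T. \<Sum>j\<le>m. Phi \<theta> \<omega> j h * (\<Sum>i\<le>N. coef' \<theta> j h i * \<omega> (j, i)))"

lemma F_lin_deriv: "((\<lambda>\<theta>. F (lin \<theta> \<omega>)) has_real_derivative F_rate \<theta> \<omega>) (at \<theta>)"
  using F_deriv[where L = "\<lambda>\<theta>. lin \<theta> \<omega>" and s = \<theta>, OF lin_deriv]
  by (elim DERIV_cong) (simp add: F_rate_def Phi_def sum_distrib_left mult_ac)

lemma sum_coef'_dPhi:
  assumes "j \<le> m" "h \<in> T"
  shows "(\<Sum>i\<le>N. coef' \<theta> j h i * dPhi \<theta> \<omega> j h i) = (let L = lin \<theta> \<omega> in
    F L * wt L h * ((1 - \<kappa>) * \<beta>) * (\<Sum>h'\<in>T. wt L h' * (dir L j h * dir L j h') *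
      ((if j < m then 1 else - 1) * (sin \<theta> * cos \<theta>) * (1 - (\<Sum>i<N. h i * h' i)))))"
proof -
  define L where "L = lin \<theta> \<omega>"
  \<comment> \<open>Constant variance: this zero removes the curvature term and the
    \<open>- \<beta>\<close> term together.\<close>
  have 0: "(\<Sum>i\<le>N. coef' \<theta> j h i * coef \<theta> j h i) = 0"
    using sum_coef_coef'[OF assms(2,2)] inner_self[OF assms(2)] by simp
  have "coef' \<theta> j h i * dPhi \<theta> \<omega> j h i =
     F L * wt L h * ((curv L j h + (- \<beta>) * (dir L j h * dir L j h)) * (coef' \<theta> j h i * coef \<theta> j h i)
     + (1 - \<kappa>) * \<beta> * (\<Sum>h'\<in>T. wt L h' * (dir L j h * dir L j h') * (coef' \<theta> j h i * coef \<theta> j h' i)))" for i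
  proof -
    have "(\<Sum>h'\<in>T. wt L h' * (dir L j h * dir L j h') * (coef' \<theta> j h i * coef \<theta> j h' i)) =
      coef' \<theta> j h i * (\<Sum>h'\<in>T. wt L h' * (dir L j h * dir L j h') * coef \<theta> j h' i)"
      unfolding sum_distrib_left by (intro sum.cong) auto
    then show ?thesis
      unfolding dPhi_def Let_def L_def[symmetric] by (simp only:) (simp only: ring_distribs mult_ac)
  qed
  then have "(\<Sum>i\<le>N. coef' \<theta> j h i * dPhi \<theta> \<omega> j h i) =
     F L * wt L h * ((curv L j h + (- \<beta>) * (dir L j h * dir L j h)) * (\<Sum>i\<le>N. coef' \<theta> j h i * coef \<theta> j h i)
     + (1 - \<kappa>) * \<beta> * (\<Sum>i\<le>N. \<Sum>h'\<in>T. wt L h' * (dir L j h * dir L j h') * (coef' \<theta> j h i * coef \<theta> j h' i)))"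
    by (simp only: sum_distrib_left[symmetric] sum.distrib)
  also have "(\<Sum>i\<le>N. \<Sum>h'\<in>T. wt L h' * (dir L j h * dir L j h') * (coef' \<theta> j h i * coef \<theta> j h' i)) =
     (\<Sum>h'\<in>T. wt L h' * (dir L j h * dir L j h') * (\<Sum>i\<le>N. coef' \<theta> j h i * coef \<theta> j h' i))"
    unfolding sum_distrib_left by (rule sum.swap)
  also have "\<dots> = (\<Sum>h'\<in>T. wt L h' * (dir L j h * dir L j h') *
      ((if j < m then 1 else - 1) * (sin \<theta> * cos \<theta>) * (1 - (\<Sum>i<N. h i * h' i))))"
    by (intro sum.cong refl) (simp add: sum_coef_coef' assms(2))
  finally show ?thesis by (simp add: 0 Let_def L_def)
qed

lemma integral_triple_sum:
  fixes f :: "_ \<Rightarrow> nat \<Rightarrow> nat \<Rightarrow> _ \<Rightarrow> real"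
  assumes f: "\<And>h j i. h \<in> T \<Longrightarrow> j \<le> m \<Longrightarrow> i \<le> N \<Longrightarrow> integrable M (f h j i)"
  shows "(LINT x|M. c * (\<Sum>h\<in>T. \<Sum>j\<le>m. \<Sum>i\<le>N. a h j i * f h j i x)) =
    c * (\<Sum>h\<in>T. \<Sum>j\<le>m. \<Sum>i\<le>N. a h j i * (LINT x|M. f h j i x))"
proof -
  have 1: "integrable M (\<lambda>x. \<Sum>i\<le>N. a h j i * f h j i x)"
    and 2: "(LINT x|M. (\<Sum>i\<le>N. a h j i * f h j i x)) = (\<Sum>i\<le>N. a h j i * (LINT x|M. f h j i x))"
    if "h \<in> T" "j \<le> m" for h j
    using f[OF that] by (auto intro!: Bochner_Integration.integrable_sum simp: Bochner_Integration.integral_sum)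
  have 3: "integrable M (\<lambda>x. \<Sum>j\<le>m. \<Sum>i\<le>N. a h j i * f h j i x)" if "h \<in> T" for h
    by (rule Bochner_Integration.integrable_sum, rule 1[OF that]) simp
  have 4: "(LINT x|M. (\<Sum>j\<le>m. \<Sum>i\<le>N. a h j i * f h j i x)) = (\<Sum>j\<le>m. \<Sum>i\<le>N. a h j i * (LINT x|M. f h j i x))"
    if "h \<in> T" for h
    by (subst Bochner_Integration.integral_sum, rule 1[OF that], simp, rule sum.cong[OF refl], rule 2[OF that]) simp
  have "(LINT x|M. (\<Sum>h\<in>T. \<Sum>j\<le>m. \<Sum>i\<le>N. a h j i * f h j i x)) =
    (\<Sum>h\<in>T. \<Sum>j\<le>m. \<Sum>i\<le>N. a h j i * (LINT x|M. f h j i x))"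
    by (subst Bochner_Integration.integral_sum, rule 3, simp, rule sum.cong[OF refl], rule 4) simp
  then show ?thesis by (simp only: integral_mult_right_zero)
qed

text \<open>Stein's identity, entry by entry, trades each factor \<open>\<omega> (j, i)\<close> for
  a derivative of \<open>Phi\<close>.\<close>

lemma integral_F_rate:
  "(LINT \<omega>|gauss idx. F_rate \<theta> \<omega>) =
   (LINT \<omega>|gauss idx. - (\<kappa> * \<beta>) * (\<Sum>h\<in>T. \<Sum>j\<le>m. \<Sum>i\<le>N. coef' \<theta> j h i * dPhi \<theta> \<omega> j h i))"
proof -
  have ib: "exp_bounded idx (\<lambda>\<omega>. \<omega> (j, i))" if "j \<le> m" "i \<le> N" for j i
    using that by (intro exp_bounded_component) auto
  have *: "(LINT \<omega>|gauss idx. \<omega> (j, i) * Phi \<theta> \<omega> j h) = (LINT \<omega>|gauss idx. dPhi \<theta> \<omega> j h i)"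
    if "h \<in> T" "j \<le> m" "i \<le> N" for h j i
    by (rule gauss_stein) (use that in \<open>auto intro: exp_bounded_Phi exp_bounded_dPhi Phi_update_deriv\<close>)
  have i1: "integrable (gauss idx) (\<lambda>\<omega>. \<omega> (j, i) * Phi \<theta> \<omega> j h)"
    if "h \<in> T" "j \<le> m" "i \<le> N" for h j i
    using that by (intro integrable_exp_bounded finite_idx exp_bounded_mult exp_bounded_Phi ib)
  have i2: "integrable (gauss idx) (\<lambda>\<omega>. dPhi \<theta> \<omega> j h i)"
    if "h \<in> T" "j \<le> m" "i \<le> N" for h j i
    using that by (intro integrable_exp_bounded finite_idx exp_bounded_dPhi)
  have "(LINT \<omega>|gauss idx. F_rate \<theta> \<omega>) = (LINT \<omega>|gauss idx. - (\<kappa> * \<beta>) *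
     (\<Sum>h\<in>T. \<Sum>j\<le>m. \<Sum>i\<le>N. coef' \<theta> j h i * (\<omega> (j, i) * Phi \<theta> \<omega> j h)))"
    unfolding F_rate_def by (simp add: sum_distrib_left mult_ac)
  also have "\<dots> = - (\<kappa> * \<beta>) * (\<Sum>h\<in>T. \<Sum>j\<le>m. \<Sum>i\<le>N. coef' \<theta> j h i * (LINT \<omega>|gauss idx. \<omega> (j, i) * Phi \<theta> \<omega> j h))"
    by (rule integral_triple_sum[OF i1])
  also have "\<dots> = - (\<kappa> * \<beta>) * (\<Sum>h\<in>T. \<Sum>j\<le>m. \<Sum>i\<le>N. coef' \<theta> j h i * (LINT \<omega>|gauss idx. dPhi \<theta> \<omega> j h i))"
    by (simp add: *)
  also have "\<dots> = (LINT \<omega>|gauss idx. - (\<kappa> * \<beta>) * (\<Sum>h\<in>T. \<Sum>j\<le>m. \<Sum>i\<le>N. coef' \<theta> j h i * dPhi \<theta> \<omega> j h i))"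
    by (rule integral_triple_sum[OF i2, symmetric])
  finally show ?thesis .
qed

text \<open>After integration by parts the integrand is nonnegative pointwise. Each pair
  \<open>h\<close>, \<open>h'\<close> contributes nonnegative weights times
  \<open>(1 - \<kappa>)\<close>, \<open>sin \<theta> * cos \<theta>\<close> and
  \<open>1 - \<langle>h, h'\<rangle>\<close>, times the signed sum over the rows, which is
  nonpositive; the factor \<open>- (\<kappa> * \<beta>)\<close> in front turns the sign.\<close>

lemma integral_F_rate_nonneg:
  assumes "0 \<le> \<theta>" "\<theta> \<le> pi / 2"
  shows "0 \<le> (LINT \<omega>|gauss idx. F_rate \<theta> \<omega>)"
  unfolding integral_F_rate
proof (rule Bochner_Integration.integral_nonneg)
  fix \<omega>
  define L where "L = lin \<theta> \<omega>"
  define sc where "sc = sin \<theta> * cos \<theta>"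
  have sc: "0 \<le> sc" unfolding sc_def using assms by (intro mult_nonneg_nonneg sin_ge_zero cos_ge_zero) auto
  define D where "D = (\<lambda>h h'. 1 - (\<Sum>i<N. h i * h' i :: real))"
  have D: "0 \<le> D h h'" if "h \<in> T" "h' \<in> T" for h h'
    unfolding D_def using sum_mult_le_1[of h N h'] unit_T[OF that(1)] unit_T[OF that(2)] by simp
  have "(\<Sum>h\<in>T. \<Sum>j\<le>m. \<Sum>i\<le>N. coef' \<theta> j h i * dPhi \<theta> \<omega> j h i) =
     (\<Sum>h\<in>T. \<Sum>j\<le>m. F L * wt L h * ((1 - \<kappa>) * \<beta>) * (\<Sum>h'\<in>T. wt L h' * (dir L j h * dir L j h') *
      ((if j < m then 1 else - 1) * sc * D h h')))"
    by (intro sum.cong refl) (simp add: sum_coef'_dPhi L_def sc_def D_def Let_def)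
  also have "\<dots> = (\<Sum>h\<in>T. \<Sum>h'\<in>T. F L * wt L h * ((1 - \<kappa>) * \<beta>) * wt L h' * sc * D h h' *
      (\<Sum>j\<le>m. (if j < m then 1 else - 1) * (dir L j h * dir L j h')))"
    unfolding sum_distrib_left by (subst sum.swap[of _ T "{..m}"]) (simp add: mult_ac)
  also have "\<dots> \<le> 0"
  proof (rule sum_nonpos, rule sum_nonpos, rule mult_nonneg_nonpos)
    fix h h' assume "h \<in> T" "h' \<in> T"
    then show "0 \<le> F L * wt L h * ((1 - \<kappa>) * \<beta>) * wt L h' * sc * D h h'"
      using F_pos[of L] \<kappa> \<beta> by (intro mult_nonneg_nonneg sc D wt_nonneg) auto
    \<comment> \<open>Row \<open>m\<close> has \<open>dir = 1\<close> for both vectors and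
      contributes exactly \<open>-1\<close>; Cauchy-Schwarz bounds the other rows by
      \<open>1\<close>.\<close>
    show "(\<Sum>j\<le>m. (if j < m then 1 else - 1) * (dir L j h * dir L j h')) \<le> 0"
      using sum_mult_le_1[OF sum_dir_sq[of L h] sum_dir_sq[of L h']]
      by (simp add: lessThan_Suc_atMost[symmetric] dir_def[of _ m])
  qed
  finally show "0 \<le> - (\<kappa> * \<beta>) * (\<Sum>h\<in>T. \<Sum>j\<le>m. \<Sum>i\<le>N. coef' \<theta> j h i * dPhi \<theta> \<omega> j h i)"
    using \<kappa> \<beta> by (simp add: mult_nonneg_nonpos)
qed

lemma coef_measurable: "(\<lambda>\<theta>. coef \<theta> j h i) \<in> borel_measurable borel"
  and coef'_measurable: "(\<lambda>\<theta>. coef' \<theta> j h i) \<in> borel_measurable borel"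
proof -
  have "continuous_on UNIV (\<lambda>\<theta>. coef \<theta> j h i)"
    unfolding coef_def by (cases "j < m"; cases "i < N") (auto intro!: continuous_intros)
  then show "(\<lambda>\<theta>. coef \<theta> j h i) \<in> borel_measurable borel" by (rule borel_measurable_continuous_onI)
  have "continuous_on UNIV (\<lambda>\<theta>. coef' \<theta> j h i)"
    unfolding coef'_def by (cases "j < m"; cases "i < N") (auto intro!: continuous_intros)
  then show "(\<lambda>\<theta>. coef' \<theta> j h i) \<in> borel_measurable borel" by (rule borel_measurable_continuous_onI)
qed

lemma F_rate_measurable: "(\<lambda>p. F_rate (fst p) (snd p)) \<in> borel_measurable (lborel \<Otimes>\<^sub>M gauss idx)"
proof -
  have c: "(\<lambda>p. coef (fst p) j h i) \<in> borel_measurable (lborel \<Otimes>\<^sub>M gauss idx)"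
    and c': "(\<lambda>p. coef' (fst p) j h i) \<in> borel_measurable (lborel \<Otimes>\<^sub>M gauss idx)" for j h i
    using measurable_compose[OF measurable_fst coef_measurable[unfolded measurable_lborel2[symmetric]]]
      measurable_compose[OF measurable_fst coef'_measurable[unfolded measurable_lborel2[symmetric]]] by this+
  have w: "(\<lambda>p. snd p (j, i)) \<in> borel_measurable (lborel \<Otimes>\<^sub>M gauss idx)" if "j \<le> m" "i \<le> N" for j i
    by (rule measurable_compose[OF measurable_snd measurable_gauss_component]) (use that in simp)
  have l: "(\<lambda>p. lin (fst p) (snd p) j h) \<in> borel_measurable (lborel \<Otimes>\<^sub>M gauss idx)" if "j \<le> m" for j h
    unfolding lin_def using that by (intro borel_measurable_sum borel_measurable_times c w) auto
  show ?thesis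
    unfolding F_rate_def Phi_def
    by (intro borel_measurable_times borel_measurable_sum borel_measurable_const c' w
        measurable_process(2)[OF l] measurable_process(3)[OF l] measurable_process(4)[OF l]) auto
qed

definition F_rate_bound :: "(nat \<times> nat \<Rightarrow> real) \<Rightarrow> real" where
  "F_rate_bound \<omega> = \<kappa> * \<beta> * real (card T) * real (m + 1) *
     ((real (card T) powr \<kappa> * exp (\<kappa> * \<beta> * (\<Sum>c\<in>idx. \<bar>\<omega> c\<bar>))) * (\<Sum>c\<in>idx. \<bar>\<omega> c\<bar>))"

lemma abs_F_rate_le: "\<bar>F_rate \<theta> \<omega>\<bar> \<le> F_rate_bound \<omega>"
proof -
  let ?s = "\<Sum>c\<in>idx. \<bar>\<omega> c\<bar>"
  define B where "B = (real (card T) powr \<kappa> * exp (\<kappa> * \<beta> * ?s)) * ?s"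
  have "\<bar>Phi \<theta> \<omega> j h * (\<Sum>i\<le>N. coef' \<theta> j h i * \<omega> (j, i))\<bar> \<le> B" if "h \<in> T" "j \<le> m" for h j
    unfolding abs_mult B_def
  proof (rule mult_mono)
    show "\<bar>Phi \<theta> \<omega> j h\<bar> \<le> real (card T) powr \<kappa> * exp (\<kappa> * \<beta> * ?s)"
      using abs_Phi_le[OF that(2,1), of \<theta> \<omega>] F_bound[of \<theta> \<omega>] by linarith
    show "\<bar>\<Sum>i\<le>N. coef' \<theta> j h i * \<omega> (j, i)\<bar> \<le> ?s"
      by (rule abs_linear_le[OF that(2) abs_coef'_le_1[OF that(1)]])
  qed auto
  then have "\<bar>\<Sum>h\<in>T. \<Sum>j\<le>m. Phi \<theta> \<omega> j h * (\<Sum>i\<le>N. coef' \<theta> j h i * \<omega> (j, i))\<bar> \<le> (\<Sum>h\<in>T. \<Sum>j\<le>m. B)"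
    by (intro order_trans[OF sum_abs] sum_mono) auto
  then have "\<bar>F_rate \<theta> \<omega>\<bar> \<le> (\<kappa> * \<beta>) * (\<Sum>h\<in>T. \<Sum>j\<le>m. B)"
    unfolding F_rate_def abs_mult abs_minus_cancel using \<kappa> \<beta> by (intro mult_mono) auto
  then show ?thesis by (simp add: F_rate_bound_def B_def)
qed

lemma integrable_F_rate_bound: "integrable (gauss idx) F_rate_bound"
proof -
  have s: "exp_bounded idx (\<lambda>\<omega>. \<Sum>c\<in>idx. \<bar>\<omega> c\<bar>)"
    by (intro exp_bounded_sum exp_bounded_bound[OF exp_bounded_component[OF finite_idx]]
        measurable_compose[OF measurable_gauss_component borel_measurable_abs]) auto
  have e: "exp_bounded idx (\<lambda>\<omega>. exp (\<kappa> * \<beta> * (\<Sum>c\<in>idx. \<bar>\<omega> c\<bar>)))"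
    by (rule exp_boundedI[where A = 1 and B = "\<kappa> * \<beta>"])
       (intro measurable_compose[OF borel_measurable_times borel_measurable_exp] borel_measurable_const
          exp_bounded_measurable[OF s], simp)
  show ?thesis
    unfolding F_rate_bound_def
    by (intro integrable_exp_bounded finite_idx exp_bounded_mult exp_bounded_const s e)
qed

text \<open>The fundamental theorem in \<open>\<theta>\<close> is applied for each fixed
  \<open>\<omega>\<close>, and Fubini exchanges the two integrals, so that no integral has to be
  differentiated with respect to \<open>\<theta>\<close>.\<close>

theorem gordon_comparison: "(LINT \<omega>|gauss idx. F (lin 0 \<omega>)) \<le> (LINT \<omega>|gauss idx. F (lin (pi / 2) \<omega>))"
proof -
  interpret G: prob_space "gauss idx" by (rule prob_space_gauss)
  interpret P: pair_sigma_finite lborel "gauss idx" by standard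
  define A where "A = {0..pi / 2}"
  have ind: "integrable lborel (indicator A :: real \<Rightarrow> real)"
    unfolding A_def by (rule integrable_real_indicator) auto
  have intb: "integrable (lborel \<Otimes>\<^sub>M gauss idx) (\<lambda>p. indicator A (fst p) * F_rate_bound (snd p))"
  proof (rule P.Fubini_integrable)
    show "(\<lambda>p. indicator A (fst p) * F_rate_bound (snd p)) \<in> borel_measurable (lborel \<Otimes>\<^sub>M gauss idx)"
      by (intro borel_measurable_times measurable_compose[OF measurable_fst borel_measurable_integrable[OF ind]]
          measurable_compose[OF measurable_snd borel_measurable_integrable[OF integrable_F_rate_bound]])
    have "integrable lborel (\<lambda>x. indicator A x * (LINT y|gauss idx. \<bar>F_rate_bound y\<bar>))"
      using ind by (rule integrable_mult_left)
    then show "integrable lborel (\<lambda>x. LINT y|gauss idx. norm (indicator A (fst (x, y)) * F_rate_bound (snd (x, y)) :: real))"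
      by (simp add: abs_mult)
  qed (use integrable_F_rate_bound in auto)
  have int: "integrable (lborel \<Otimes>\<^sub>M gauss idx) (\<lambda>(\<theta>, \<omega>). indicator A \<theta> * F_rate \<theta> \<omega>)"
  proof (rule Bochner_Integration.integrable_bound[OF intb])
    show "(\<lambda>(\<theta>, \<omega>). indicator A \<theta> * F_rate \<theta> \<omega>) \<in> borel_measurable (lborel \<Otimes>\<^sub>M gauss idx)"
      unfolding case_prod_beta
      by (intro borel_measurable_times measurable_compose[OF measurable_fst borel_measurable_integrable[OF ind]] F_rate_measurable)
    show "AE p in lborel \<Otimes>\<^sub>M gauss idx. norm (case p of (\<theta>, \<omega>) \<Rightarrow> indicator A \<theta> * F_rate \<theta> \<omega>)
        \<le> norm (indicator A (fst p) * F_rate_bound (snd p))"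
    proof (rule AE_I2)
      fix p :: "real \<times> (nat \<times> nat \<Rightarrow> real)"
      show "norm (case p of (\<theta>, \<omega>) \<Rightarrow> indicator A \<theta> * F_rate \<theta> \<omega>) \<le> norm (indicator A (fst p) * F_rate_bound (snd p))"
        using order_trans[OF abs_F_rate_le[of "fst p" "snd p"] abs_ge_self]
        by (auto simp: case_prod_beta abs_mult intro!: mult_left_mono)
    qed
  qed
  have FTC: "(LINT \<theta>|lborel. indicator A \<theta> * F_rate \<theta> \<omega>) = F (lin (pi / 2) \<omega>) - F (lin 0 \<omega>)"
    if "\<omega> \<in> space (gauss idx)" for \<omega>
    unfolding A_def
  proof (rule set_integral_derivative[OF F_lin_deriv])
    have m: "(\<lambda>\<theta>. F_rate \<theta> \<omega>) \<in> borel_measurable lborel"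
      using measurable_compose[OF measurable_Pair2'[OF that] F_rate_measurable] by (simp only: fst_conv snd_conv)
    show "set_integrable lborel {0..pi / 2} (\<lambda>\<theta>. F_rate \<theta> \<omega>)"
      unfolding set_integrable_def A_def[symmetric]
    proof (rule Bochner_Integration.integrable_bound)
      show "integrable lborel (\<lambda>x. indicator A x * F_rate_bound \<omega>)" using ind by (rule integrable_mult_left)
      show "(\<lambda>x. indicat_real A x *\<^sub>R F_rate x \<omega>) \<in> borel_measurable lborel"
        by (intro borel_measurable_scaleR borel_measurable_integrable[OF ind] m)
      show "AE x in lborel. norm (indicat_real A x *\<^sub>R F_rate x \<omega>) \<le> norm (indicator A x * F_rate_bound \<omega>)"
        using order_trans[OF abs_F_rate_le abs_ge_self, of _ \<omega>]
        by (intro AE_I2) (auto simp: abs_mult intro!: mult_left_mono)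
    qed
  qed simp
  have intF: "integrable (gauss idx) (\<lambda>\<omega>. F (lin \<theta> \<omega>))" for \<theta>
    by (intro integrable_exp_bounded finite_idx exp_bounded_F)
  have "0 \<le> (LINT \<theta>|lborel. indicator A \<theta> * (LINT \<omega>|gauss idx. F_rate \<theta> \<omega>))"
    by (intro Bochner_Integration.integral_nonneg) (auto simp: A_def indicator_def integral_F_rate_nonneg)
  also have "\<dots> = (LINT \<theta>|lborel. LINT \<omega>|gauss idx. indicator A \<theta> * F_rate \<theta> \<omega>)"
    by (simp only: integral_mult_right_zero)
  also have "\<dots> = (LINT \<omega>|gauss idx. LINT \<theta>|lborel. indicator A \<theta> * F_rate \<theta> \<omega>)"
    by (rule P.Fubini_integral[OF int, symmetric])
  also have "\<dots> = (LINT \<omega>|gauss idx. F (lin (pi / 2) \<omega>) - F (lin 0 \<omega>))"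
    by (intro Bochner_Integration.integral_cong FTC refl)
  also have "\<dots> = (LINT \<omega>|gauss idx. F (lin (pi / 2) \<omega>)) - (LINT \<omega>|gauss idx. F (lin 0 \<omega>))"
    by (intro Bochner_Integration.integral_diff intF)
  finally show ?thesis by simp
qed

end

section \<open>Escape through a set of unit vectors\<close>

text \<open>Independence of a block of entries from the single entries outside it. It is used with
  the block of \<open>A\<close> at angle zero, and with the block of the last column
  \<open>G\<close> at angle \<open>pi / 2\<close>.\<close>

lemma nn_integral_gauss_factor:
  fixes f :: "('i \<Rightarrow> real) \<Rightarrow> ennreal" and u :: "'i \<Rightarrow> real \<Rightarrow> ennreal"
  assumes I: "finite I" "A \<subseteq> I" and f: "f \<in> borel_measurable (gauss A)"
    and u: "\<And>c. u c \<in> borel_measurable borel"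
  shows "(\<integral>\<^sup>+\<omega>. f (restrict \<omega> A) * (\<Prod>c\<in>I - A. u c (\<omega> c)) \<partial>gauss I) =
    (\<integral>\<^sup>+\<omega>. f \<omega> \<partial>gauss A) * (\<Prod>c\<in>I - A. \<integral>\<^sup>+x. u c x \<partial>std_normal)"
proof -
  define B where "B = I - A"
  have IB: "I = A \<union> B" "A \<inter> B = {}" "finite A" "finite B" using I by (auto simp: B_def intro: finite_subset)
  have u': "u c \<in> borel_measurable std_normal" for c
    using u[of c] by (simp only: measurable_density_eq1 measurable_lborel2)
  have mp: "(\<lambda>\<omega>. \<Prod>c\<in>B. u c (\<omega> c)) \<in> borel_measurable (gauss J)" if "B \<subseteq> J" for J
    using that by (intro borel_measurable_prod_ennreal measurable_compose[OF measurable_gauss_component u]) auto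
  have "(\<lambda>\<omega>. f (restrict \<omega> A) * (\<Prod>c\<in>B. u c (\<omega> c))) \<in> borel_measurable (gauss (A \<union> B))"
    by (intro borel_measurable_times_ennreal mp measurable_compose[OF measurable_restrict_subset f]) auto
  then have "(\<integral>\<^sup>+\<omega>. f (restrict \<omega> A) * (\<Prod>c\<in>B. u c (\<omega> c)) \<partial>gauss (A \<union> B)) =
    (\<integral>\<^sup>+x. \<integral>\<^sup>+y. f (restrict (merge A B (x, y)) A) * (\<Prod>c\<in>B. u c (merge A B (x, y) c)) \<partial>gauss B \<partial>gauss A)"
    by (intro product_sigma_finite.product_nn_integral_fold product_sigma_finite_std_normal IB)
  also have "\<dots> = (\<integral>\<^sup>+x. \<integral>\<^sup>+y. f x * (\<Prod>c\<in>B. u c (y c)) \<partial>gauss B \<partial>gauss A)"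
  proof (intro nn_integral_cong)
    fix x y assume "x \<in> space (gauss A)"
    then have "restrict (merge A B (x, y)) A = x"
      by (auto simp: space_PiM PiE_def extensional_def merge_def fun_eq_iff)
    moreover have "(\<Prod>c\<in>B. u c (merge A B (x, y) c)) = (\<Prod>c\<in>B. u c (y c))"
      using IB(2) by (intro prod.cong) (auto simp: merge_def)
    ultimately show "f (restrict (merge A B (x, y)) A) * (\<Prod>c\<in>B. u c (merge A B (x, y) c)) = f x * (\<Prod>c\<in>B. u c (y c))"
      by simp
  qed
  also have "\<dots> = (\<integral>\<^sup>+x. f x * (\<integral>\<^sup>+y. (\<Prod>c\<in>B. u c (y c)) \<partial>gauss B) \<partial>gauss A)"
    by (intro nn_integral_cong nn_integral_cmult mp order_refl)
  also have "\<dots> = (\<integral>\<^sup>+x. f x \<partial>gauss A) * (\<integral>\<^sup>+y. (\<Prod>c\<in>B. u c (y c)) \<partial>gauss B)"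
    by (rule nn_integral_multc[OF f])
  also have "(\<integral>\<^sup>+y. (\<Prod>c\<in>B. u c (y c)) \<partial>gauss B) = (\<Prod>c\<in>B. \<integral>\<^sup>+x. u c x \<partial>std_normal)"
    by (rule product_sigma_finite.product_nn_integral_prod[OF product_sigma_finite_std_normal IB(4) u'])
  finally show ?thesis unfolding B_def[symmetric] IB(1)[symmetric] .
qed

lemma emeasure_std_normal_UNIV: "emeasure std_normal UNIV = 1"
  using prob_space.emeasure_space_1[OF prob_space_std_normal] by simp

lemma nn_integral_std_normal_exp: "(\<integral>\<^sup>+x. ennreal (exp (s * x)) \<partial>std_normal) = ennreal (exp (s\<^sup>2 / 2))"
  by (subst nn_integral_eq_integral[OF integrable_std_normal_exp]) (auto simp: integral_std_normal_exp)

definition chi_laplace :: "'i set \<Rightarrow> real \<Rightarrow> ennreal" where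
  "chi_laplace J s = (\<integral>\<^sup>+\<omega>. ennreal (exp (- s * sqrt (\<Sum>c\<in>J. (\<omega> c)\<^sup>2))) \<partial>gauss J)"

lemma chi_laplace_measurable:
  "(\<lambda>\<omega>. ennreal (exp (- s * sqrt (\<Sum>c\<in>J. (\<omega> c)\<^sup>2)))) \<in> borel_measurable (gauss J)"
proof -
  have 1: "(\<lambda>x. ennreal (exp (- s * sqrt x))) \<in> borel_measurable borel" by measurable
  have 2: "(\<lambda>\<omega>. \<Sum>c\<in>J. (\<omega> c)\<^sup>2 :: real) \<in> borel_measurable (gauss J)"
    by (intro borel_measurable_sum borel_measurable_power measurable_gauss_component)
  show ?thesis by (rule measurable_compose[OF 2 1])
qed

text \<open>The strict inequality is an open condition on \<open>h\<close>, so an exact kernel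
  vector can be replaced by a nearby member of a dense set.\<close>

definition near_kernel :: "nat \<Rightarrow> nat \<Rightarrow> (nat \<Rightarrow> real) set \<Rightarrow> real \<Rightarrow> (nat \<times> nat \<Rightarrow> real) set" where
  "near_kernel m N T \<rho> = {a \<in> space (gauss_mat m N).
     \<exists>h\<in>T. (\<Sum>j<m. (\<Sum>i<N. a (j, i) * h i)\<^sup>2) < \<rho>\<^sup>2}"

lemma image_sq_measurable:
  "(\<lambda>a. \<Sum>j<m. (\<Sum>i<N. a (j, i) * h i)\<^sup>2) \<in> borel_measurable (gauss_mat m N)"
  by (intro borel_measurable_sum borel_measurable_power borel_measurable_times borel_measurable_const
      measurable_gauss_component) auto

lemma sets_near_kernel: "finite T \<Longrightarrow> near_kernel m N T \<rho> \<in> sets (gauss_mat m N)"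
  unfolding near_kernel_def
  by (intro sets.sets_Collect_finite_Ex borel_measurable_less image_sq_measurable borel_measurable_const)

text \<open>On the event, \<open>F\<close> at angle zero is at least
  \<open>exp (- s * (2 * \<rho>))\<close> times \<open>exp (- s * \<gamma>)\<close>, and integrating
  out \<open>\<gamma>\<close> produces \<open>exp (s\<^sup>2 / 2)\<close>. At angle
  \<open>pi / 2\<close>, the hypothesis \<open>bd\<close> replaces the maximum over \<open>h\<close>
  by a product over the entries of \<open>g\<close>, so the integral factorizes.\<close>

lemma finite_escape_smoothed:
  assumes T: "finite T" "T \<noteq> {}" "\<And>h. h \<in> T \<Longrightarrow> (\<Sum>i<N. (h i)\<^sup>2) = 1"
    and s: "0 < s" and \<rho>: "0 < \<rho>" and k: "0 < \<kappa>" "\<kappa> \<le> 1"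
    and u: "\<And>i. u i \<in> borel_measurable borel" "\<And>i x. 0 \<le> u i x" and c: "0 \<le> c"
    and bd: "\<And>h x. h \<in> T \<Longrightarrow> exp (- s * (\<Sum>i<N. x i * h i)) \<le> c * (\<Prod>i<N. u i (x i))"
  shows "emeasure (gauss_mat m N) (near_kernel m N T \<rho>) * ennreal (exp (s\<^sup>2 / 2)) * ennreal (exp (- s * (2 * \<rho>)))
     \<le> ennreal (real (card T) powr \<kappa>) * (ennreal c * chi_laplace ({..<m} \<times> {N}) s * (\<Prod>i<N. \<integral>\<^sup>+x. ennreal (u i x) \<partial>std_normal))"
proof -
  \<comment> \<open>Keeps \<open>\<beta> * \<kappa> = s\<close>, so that the exponents of the final
    bound do not depend on \<open>\<kappa>\<close>.\<close>
  define b where "b = s / \<kappa>"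
  have b: "0 < b" "b * \<kappa> = s" using s k by (auto simp: b_def)
  \<comment> \<open>The smoothing parameter \<open>\<eta>\<close> is the tolerance
    \<open>\<rho>\<close> itself; this is why the soft norm is at most \<open>2 * \<rho>\<close> on
    the event.\<close>
  interpret gordon_process m N T b \<kappa> \<rho>
    by unfold_locales (use T k b \<rho> in auto)
  let ?A = "{..<m} \<times> {..<N}" and ?G = "{..<m} \<times> {N}"
  have lin0: "lin 0 \<omega> j h = (\<Sum>i<N. \<omega> (j, i) * h i)" if "j < m" for \<omega> j h
    using that by (simp add: lin_def coef_def lessThan_Suc_atMost[symmetric] mult.commute)
  have lin0m: "lin 0 \<omega> m h = \<omega> (m, N)" for \<omega> h
    by (simp add: lin_def coef_def lessThan_Suc_atMost[symmetric])
  have lin1: "lin (pi / 2) \<omega> j h = \<omega> (j, N)" if "j < m" for \<omega> j h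
    using that by (simp add: lin_def coef_def lessThan_Suc_atMost[symmetric])
  have lin1m: "lin (pi / 2) \<omega> m h = (\<Sum>i<N. \<omega> (m, i) * h i)" for \<omega> h
    by (simp add: lin_def coef_def lessThan_Suc_atMost[symmetric] mult.commute)
  have low: "F (lin 0 \<omega>) \<ge> exp (- s * (2 * \<rho>)) * exp (- s * \<omega> (m, N))"
    if "restrict \<omega> ?A \<in> near_kernel m N T \<rho>" for \<omega>
  proof -
    from that obtain h where h: "h \<in> T" "(\<Sum>j<m. (\<Sum>i<N. \<omega> (j, i) * h i)\<^sup>2) < \<rho>\<^sup>2"
      by (auto simp: near_kernel_def)
    have "soft_norm (lin 0 \<omega>) h \<le> 2 * \<rho>"
    proof -
      have "(\<Sum>j<m. (lin 0 \<omega> j h)\<^sup>2) = (\<Sum>j<m. (\<Sum>i<N. \<omega> (j, i) * h i)\<^sup>2)" by (simp add: lin0)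
      moreover have "(2 * \<rho>)\<^sup>2 = 4 * \<rho>\<^sup>2" "0 \<le> \<rho>\<^sup>2" by (simp_all add: power_mult_distrib)
      ultimately have "\<rho>\<^sup>2 + (\<Sum>j<m. (lin 0 \<omega> j h)\<^sup>2) \<le> (2 * \<rho>)\<^sup>2" using h(2) by linarith
      then show ?thesis unfolding soft_norm_def using \<rho> by (intro real_le_lsqrt) auto
    qed
    then have "exp (- b * (2 * \<rho> + \<omega> (m, N))) \<le> exp (pot (lin 0 \<omega>) h)"
      using b(1) by (simp add: pot_def lin0m)
    also have "\<dots> \<le> part (lin 0 \<omega>)"
      unfolding part_def using h(1) T(1) by (intro member_le_sum) auto
    finally have "exp (- b * (2 * \<rho> + \<omega> (m, N))) powr \<kappa> \<le> F (lin 0 \<omega>)"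
      unfolding F_def using k by (intro powr_mono2) auto
    moreover have "exp (- b * (2 * \<rho> + \<omega> (m, N))) powr \<kappa> = exp (- s * (2 * \<rho>)) * exp (- s * \<omega> (m, N))"
      by (simp add: exp_powr_real exp_add[symmetric] b(2)[symmetric] algebra_simps)
    ultimately show ?thesis by simp
  qed
  \<comment> \<open>Factor \<open>1\<close> for the entries of \<open>A\<close> and for the corner:
    they integrate to \<open>1\<close> and drop out of the product.\<close>
  define v where "v = (\<lambda>(j, i) x. if j = m \<and> i < N then u i x else 1)"
  have prod_v: "(\<Prod>c\<in>idx - ?G. g c) = (\<Prod>i<N. g (m, i))"
    if "\<And>j i. \<not> (j = m \<and> i < N) \<Longrightarrow> g (j, i) = 1" for g :: "nat \<times> nat \<Rightarrow> 'z::comm_monoid_mult"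
  proof -
    have "(\<Prod>c\<in>idx - ?G. g c) = (\<Prod>c\<in>Pair m ` {..<N}. g c)"
      using that by (intro prod.mono_neutral_right) auto
    also have "\<dots> = (\<Prod>i<N. g (m, i))"
      by (subst prod.reindex) (auto simp: inj_on_def)
    finally show ?thesis .
  qed
  have up: "F (lin (pi / 2) \<omega>) \<le> real (card T) powr \<kappa> * (c * (exp (- s * sqrt (\<Sum>c\<in>?G. (restrict \<omega> ?G c)\<^sup>2)) * (\<Prod>c\<in>idx - ?G. v c (\<omega> c))))" for \<omega>
  proof -
    define r where "r = sqrt (\<Sum>c\<in>?G. (restrict \<omega> ?G c)\<^sup>2)"
    define P where "P = c * (\<Prod>i<N. u i (\<omega> (m, i)))"
    have r: "r = sqrt (\<Sum>j<m. (\<omega> (j, N))\<^sup>2)"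
      using sum.cartesian_product[of "\<lambda>j i. (\<omega> (j, i))\<^sup>2" "{N}" "{..<m}"]
      unfolding r_def by (simp add: case_prod_beta)
    obtain h0 where "h0 \<in> T" using T(2) by auto
    then have "exp (- s * (\<Sum>i<N. \<omega> (m, i) * h0 i)) \<le> P"
      unfolding P_def using bd[of h0 "\<lambda>i. \<omega> (m, i)"] by simp
    then have P: "0 < P" using exp_gt_zero less_le_trans by blast
    have "exp (pot (lin (pi / 2) \<omega>) h) \<le> exp (- b * r) * P powr (1 / \<kappa>)" if h: "h \<in> T" for h
    proof -
      have "r \<le> soft_norm (lin (pi / 2) \<omega>) h"
        unfolding r soft_norm_def by (intro real_sqrt_le_mono) (simp add: lin1)
      then have "exp (pot (lin (pi / 2) \<omega>) h) \<le> exp (- b * (r + (\<Sum>i<N. \<omega> (m, i) * h i)))"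
        using b(1) by (simp add: pot_def lin1m)
      also have "\<dots> = exp (- b * r) * exp (- s * (\<Sum>i<N. \<omega> (m, i) * h i)) powr (1 / \<kappa>)"
        by (simp add: exp_powr_real exp_add[symmetric] b_def algebra_simps)
      also have "\<dots> \<le> exp (- b * r) * P powr (1 / \<kappa>)"
        unfolding P_def using bd[OF h, of "\<lambda>i. \<omega> (m, i)"] k
        by (intro mult_left_mono powr_mono2) auto
      finally show ?thesis .
    qed
    then have "part (lin (pi / 2) \<omega>) \<le> real (card T) * (exp (- b * r) * P powr (1 / \<kappa>))"
      unfolding part_def by (rule sum_bounded_above)
    then have "F (lin (pi / 2) \<omega>) \<le> (real (card T) * (exp (- b * r) * P powr (1 / \<kappa>))) powr \<kappa>"
      unfolding F_def using k part_pos[of "lin (pi / 2) \<omega>"] by (intro powr_mono2) auto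
    also have "\<dots> = real (card T) powr \<kappa> * (exp (- s * r) * P)"
      using P k by (simp add: powr_mult exp_powr_real powr_powr b(2)[symmetric])
    also have "P = c * (\<Prod>c\<in>idx - ?G. v c (\<omega> c))"
      unfolding P_def by (subst prod_v) (auto simp: v_def)
    finally show ?thesis unfolding r_def by (simp only: mult_ac)
  qed
  have vm: "(\<lambda>x. ennreal (v c x)) \<in> borel_measurable borel" for c
  proof (cases c)
    case (Pair j i)
    then show ?thesis
      using measurable_compose[OF u(1) measurable_ennreal, of i]
      by (cases "j = m \<and> i < N") (simp_all only: v_def prod.case if_True if_False borel_measurable_const simp_thms)
  qed
  have v0: "0 \<le> v c x" for c x
    using u(2) by (cases c) (auto simp: v_def)
  define w where "w = (\<lambda>c x. if c = (m, N) then exp (- s * x) else 1)"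
  have wm: "(\<lambda>x. ennreal (w c x)) \<in> borel_measurable borel" for c
  proof (cases "c = (m, N)")
    case True
    have "(\<lambda>x. ennreal (exp (- s * x))) \<in> borel_measurable borel" by measurable
    then show ?thesis by (simp only: w_def True if_True simp_thms)
  qed (simp only: w_def if_False borel_measurable_const)
  have prod_w: "(\<Prod>c\<in>idx - ?A. g c) = g (m, N)"
    if "\<And>c. c \<noteq> (m, N) \<Longrightarrow> g c = 1" for g :: "nat \<times> nat \<Rightarrow> 'z::comm_monoid_mult"
  proof -
    have "(\<Prod>c\<in>idx - ?A. g c) = (\<Prod>c\<in>{(m, N)}. g c)"
      using that by (intro prod.mono_neutral_right) auto
    then show ?thesis by simp
  qed
  have A: "?A \<subseteq> idx" and G: "?G \<subseteq> idx" by auto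
  let ?E = "near_kernel m N T \<rho>"
  have mE: "(indicator ?E :: _ \<Rightarrow> ennreal) \<in> borel_measurable (gauss ?A)"
    by (rule borel_measurable_indicator[OF sets_near_kernel[OF T(1)]])
  note mR = chi_laplace_measurable[of s ?G]
  have intF: "integrable (gauss idx) (\<lambda>\<omega>. F (lin \<theta> \<omega>))" for \<theta>
    by (intro integrable_exp_bounded finite_idx exp_bounded_F)
  have "emeasure (gauss ?A) ?E * ennreal (exp (s\<^sup>2 / 2)) =
      (\<integral>\<^sup>+\<omega>. indicator ?E (restrict \<omega> ?A) * (\<Prod>c\<in>idx - ?A. ennreal (w c (\<omega> c))) \<partial>gauss idx)"
  proof -
    have "(\<Prod>c\<in>idx - ?A. \<integral>\<^sup>+x. ennreal (w c x) \<partial>std_normal) = ennreal (exp (s\<^sup>2 / 2))"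
      by (subst prod_w) (simp_all add: w_def emeasure_std_normal_UNIV nn_integral_std_normal_exp[of "- s", simplified])
    then show ?thesis
      using nn_integral_indicator[OF sets_near_kernel[OF T(1), of m N \<rho>]]
      by (subst nn_integral_gauss_factor[OF finite_idx A mE wm]) simp
  qed
  then have "emeasure (gauss ?A) ?E * ennreal (exp (s\<^sup>2 / 2)) * ennreal (exp (- s * (2 * \<rho>))) =
      (\<integral>\<^sup>+\<omega>. indicator ?E (restrict \<omega> ?A) * (\<Prod>c\<in>idx - ?A. ennreal (w c (\<omega> c))) \<partial>gauss idx) * ennreal (exp (- s * (2 * \<rho>)))"
    by (simp only:)
  also have "\<dots> = (\<integral>\<^sup>+\<omega>. indicator ?E (restrict \<omega> ?A) * (\<Prod>c\<in>idx - ?A. ennreal (w c (\<omega> c))) * ennreal (exp (- s * (2 * \<rho>))) \<partial>gauss idx)"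
    by (intro nn_integral_multc[symmetric] borel_measurable_times_ennreal borel_measurable_prod_ennreal
       measurable_compose[OF measurable_restrict_subset[OF A] mE] measurable_compose[OF measurable_gauss_component wm]) auto
  also have "\<dots> \<le> (\<integral>\<^sup>+\<omega>. ennreal (F (lin 0 \<omega>)) \<partial>gauss idx)"
  proof (rule nn_integral_mono)
    fix \<omega>
    have "(\<Prod>c\<in>idx - ?A. ennreal (w c (\<omega> c))) = ennreal (exp (- s * \<omega> (m, N)))"
      by (subst prod_w) (auto simp: w_def)
    then show "indicator ?E (restrict \<omega> ?A) * (\<Prod>c\<in>idx - ?A. ennreal (w c (\<omega> c))) * ennreal (exp (- s * (2 * \<rho>))) \<le> ennreal (F (lin 0 \<omega>))"
      using low[of \<omega>] by (auto simp: indicator_def ennreal_mult[symmetric] mult.commute intro!: ennreal_leI)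
  qed
  also have "\<dots> = ennreal (LINT \<omega>|gauss idx. F (lin 0 \<omega>))"
    by (rule nn_integral_eq_integral[OF intF]) (auto simp: F_pos less_imp_le)
  also have "\<dots> \<le> ennreal (LINT \<omega>|gauss idx. F (lin (pi / 2) \<omega>))"
    by (rule ennreal_leI[OF gordon_comparison])
  also have "\<dots> = (\<integral>\<^sup>+\<omega>. ennreal (F (lin (pi / 2) \<omega>)) \<partial>gauss idx)"
    by (rule nn_integral_eq_integral[OF intF, symmetric]) (auto simp: F_pos less_imp_le)
  also have "\<dots> \<le> (\<integral>\<^sup>+\<omega>. ennreal (real (card T) powr \<kappa>) * (ennreal c * (ennreal (exp (- s * sqrt (\<Sum>c\<in>?G. (restrict \<omega> ?G c)\<^sup>2))) * (\<Prod>c\<in>idx - ?G. ennreal (v c (\<omega> c))))) \<partial>gauss idx)"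
  proof (rule nn_integral_mono)
    fix \<omega>
    have "ennreal (F (lin (pi / 2) \<omega>)) \<le> ennreal (real (card T) powr \<kappa> * (c * (exp (- s * sqrt (\<Sum>c\<in>?G. (restrict \<omega> ?G c)\<^sup>2)) * (\<Prod>c\<in>idx - ?G. v c (\<omega> c)))))"
      by (rule ennreal_leI[OF up])
    then show "ennreal (F (lin (pi / 2) \<omega>)) \<le> ennreal (real (card T) powr \<kappa>) * (ennreal c * (ennreal (exp (- s * sqrt (\<Sum>c\<in>?G. (restrict \<omega> ?G c)\<^sup>2))) * (\<Prod>c\<in>idx - ?G. ennreal (v c (\<omega> c)))))"
      using c v0 by (simp add: ennreal_mult prod_ennreal prod_nonneg del: ennreal_eq_0_iff)
  qed
  also have "\<dots> = ennreal (real (card T) powr \<kappa>) * (ennreal c * (\<integral>\<^sup>+\<omega>. ennreal (exp (- s * sqrt (\<Sum>c\<in>?G. (restrict \<omega> ?G c)\<^sup>2))) * (\<Prod>c\<in>idx - ?G. ennreal (v c (\<omega> c))) \<partial>gauss idx))"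
  proof -
    have m: "(\<lambda>\<omega>. ennreal (exp (- s * sqrt (\<Sum>c\<in>?G. (restrict \<omega> ?G c)\<^sup>2))) * (\<Prod>c\<in>idx - ?G. ennreal (v c (\<omega> c)))) \<in> borel_measurable (gauss idx)"
      by (intro borel_measurable_times_ennreal borel_measurable_prod_ennreal
       measurable_compose[OF measurable_restrict_subset[OF G] mR] measurable_compose[OF measurable_gauss_component vm]) auto
    show ?thesis
      by (subst nn_integral_cmult, intro borel_measurable_times_ennreal m borel_measurable_const,
          subst nn_integral_cmult[OF m], rule refl)
  qed
  also have "(\<integral>\<^sup>+\<omega>. ennreal (exp (- s * sqrt (\<Sum>c\<in>?G. (restrict \<omega> ?G c)\<^sup>2))) * (\<Prod>c\<in>idx - ?G. ennreal (v c (\<omega> c))) \<partial>gauss idx) =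
     chi_laplace ?G s * (\<Prod>c\<in>idx - ?G. \<integral>\<^sup>+x. ennreal (v c x) \<partial>std_normal)"
    unfolding chi_laplace_def by (rule nn_integral_gauss_factor[OF finite_idx G mR vm])
  also have "(\<Prod>c\<in>idx - ?G. \<integral>\<^sup>+x. ennreal (v c x) \<partial>std_normal) = (\<Prod>i<N. \<integral>\<^sup>+x. ennreal (u i x) \<partial>std_normal)"
    by (subst prod_v) (auto simp: v_def emeasure_std_normal_UNIV)
  finally show ?thesis by (simp only: mult.assoc)
qed

text \<open>The common form of the limits \<open>\<kappa> \<rightarrow> 0\<close> and
  \<open>\<rho> \<rightarrow> 0\<close>. Once infinite values are split off, it is a limit of real
  inequalities.\<close>

lemma ennreal_le_of_mult_tendsto_1:
  fixes X Y :: ennreal and f g :: "nat \<Rightarrow> real"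
  assumes le: "\<And>n. X * ennreal (f n) \<le> ennreal (g n) * Y"
    and f: "f \<longlonglongrightarrow> 1" "\<And>n. 0 < f n" and g: "g \<longlonglongrightarrow> 1" "\<And>n. 0 < g n"
  shows "X \<le> Y"
proof (cases Y)
  case (real y)
  have "X < top"
  proof (rule ccontr)
    assume "\<not> X < top"
    then have "X = top" by (simp add: less_top[symmetric])
    then have "X * ennreal (f 0) = top"
      using f(2)[of 0] by (simp add: ennreal_top_mult)
    moreover have "ennreal (g 0) * Y < top" using real by (simp add: ennreal_mult_less_top)
    ultimately show False using le[of 0] by (simp add: top_unique)
  qed
  then obtain x where x: "0 \<le> x" "X = ennreal x" by (cases X) auto
  have "x * f n \<le> g n * y" for n
  proof -
    have "ennreal (x * f n) \<le> ennreal (g n * y)"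
      using le[of n] x real f(2)[of n] g(2)[of n] by (simp add: ennreal_mult less_imp_le)
    then show ?thesis
      using real g(2)[of n] by (subst (asm) ennreal_le_iff) (auto simp: less_imp_le)
  qed
  moreover have "(\<lambda>n. x * f n) \<longlonglongrightarrow> x * 1" "(\<lambda>n. g n * y) \<longlonglongrightarrow> 1 * y"
    by (intro tendsto_intros f g)+
  ultimately have "x * 1 \<le> 1 * y" by (intro LIMSEQ_le[of "\<lambda>n. x * f n" _ "\<lambda>n. g n * y"]) auto
  then show ?thesis using x real by (simp add: ennreal_leI)
qed simp

text \<open>With \<open>\<kappa>\<close> tending to zero, the factor
  \<open>card T powr \<kappa>\<close> tends to \<open>1\<close>. The bound thereby becomes uniform
  over finite sets, as the passage to an infinite set requires.\<close>

lemma finite_escape: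
  assumes T: "finite T" "T \<noteq> {}" "\<And>h. h \<in> T \<Longrightarrow> (\<Sum>i<N. (h i)\<^sup>2) = 1"
    and s: "0 < s" and \<rho>: "0 < \<rho>"
    and u: "\<And>i. u i \<in> borel_measurable borel" "\<And>i x. 0 \<le> u i x" and c: "0 \<le> c"
    and bd: "\<And>h x. h \<in> T \<Longrightarrow> exp (- s * (\<Sum>i<N. x i * h i)) \<le> c * (\<Prod>i<N. u i (x i))"
  shows "emeasure (gauss_mat m N) (near_kernel m N T \<rho>) * ennreal (exp (s\<^sup>2 / 2)) * ennreal (exp (- s * (2 * \<rho>)))
     \<le> ennreal c * chi_laplace ({..<m} \<times> {N}) s * (\<Prod>i<N. \<integral>\<^sup>+x. ennreal (u i x) \<partial>std_normal)"
proof (rule ennreal_le_of_mult_tendsto_1)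
  fix n :: nat
  have "emeasure (gauss_mat m N) (near_kernel m N T \<rho>) * ennreal (exp (s\<^sup>2 / 2)) * ennreal (exp (- s * (2 * \<rho>)))
     \<le> ennreal (real (card T) powr (1 / real (Suc n))) * (ennreal c * chi_laplace ({..<m} \<times> {N}) s * (\<Prod>i<N. \<integral>\<^sup>+x. ennreal (u i x) \<partial>std_normal))"
    by (rule finite_escape_smoothed[OF T s \<rho> _ _ u c bd]) auto
  then show "emeasure (gauss_mat m N) (near_kernel m N T \<rho>) * ennreal (exp (s\<^sup>2 / 2)) * ennreal (exp (- s * (2 * \<rho>))) * ennreal 1
     \<le> ennreal (real (card T) powr (1 / real (Suc n))) * (ennreal c * chi_laplace ({..<m} \<times> {N}) s * (\<Prod>i<N. \<integral>\<^sup>+x. ennreal (u i x) \<partial>std_normal))"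
    by (simp only: ennreal_1 mult_1_right)
next
  have c: "0 < real (card T)" using T by (simp add: card_gt_0_iff)
  have "(\<lambda>n. real (card T) powr (1 / real (Suc n))) \<longlonglongrightarrow> real (card T) powr 0"
    using c by (intro tendsto_powr tendsto_const LIMSEQ_Suc lim_1_over_n) auto
  then show "(\<lambda>n. real (card T) powr (1 / real (Suc n))) \<longlonglongrightarrow> 1" using c by simp
  show "0 < real (card T) powr (1 / real (Suc n))" for n using c by simp
qed auto

definition kernel_meets :: "nat \<Rightarrow> nat \<Rightarrow> (nat \<Rightarrow> real) set \<Rightarrow> (nat \<times> nat \<Rightarrow> real) set" where
  "kernel_meets m N C = {a \<in> space (gauss_mat m N). \<exists>h\<in>C. \<forall>j<m. (\<Sum>i<N. a (j, i) * h i) = 0}"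

text \<open>Finite initial segments \<open>T n\<close> of a countable dense subset of
  \<open>C\<close> exhaust it up to the tolerance \<open>\<rho>\<close>. The bound does not depend
  on \<open>n\<close>, so continuity from below carries it to the union, and then
  \<open>\<rho>\<close> tends to zero. Only the covering events have to be measurable at this
  point.\<close>

theorem escape_mesh:
  assumes C: "\<And>h. h \<in> C \<Longrightarrow> (\<Sum>i<N. (h i)\<^sup>2) = 1"
    and s: "0 < s"
    and u: "\<And>i. u i \<in> borel_measurable borel" "\<And>i x. 0 \<le> u i x" and c: "0 \<le> c"
    and bd: "\<And>h x. h \<in> C \<Longrightarrow> exp (- s * (\<Sum>i<N. x i * h i)) \<le> c * (\<Prod>i<N. u i (x i))"
  shows "emeasure (gauss_mat m N) (kernel_meets m N C) * ennreal (exp (s\<^sup>2 / 2))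
     \<le> ennreal c * chi_laplace ({..<m} \<times> {N}) s * (\<Prod>i<N. \<integral>\<^sup>+x. ennreal (u i x) \<partial>std_normal)"
    (is "?P * _ \<le> ?Y")
proof (cases "C = {}")
  case True
  then show ?thesis by (simp add: kernel_meets_def)
next
  case False
  obtain D where D: "countable D" "D \<subseteq> C" "C \<subseteq> closure D" by (rule separable)
  have "D \<noteq> {}" using D False by auto
  define T where "T = (\<lambda>n::nat. from_nat_into D ` {..n})"
  let ?M = "gauss_mat m N"
  have TD: "T n \<subseteq> D" for n using from_nat_into[OF \<open>D \<noteq> {}\<close>] by (auto simp: T_def)
  have step: "?P * ennreal (exp (s\<^sup>2 / 2)) * ennreal (exp (- s * (2 * \<rho>))) \<le> ?Y" if \<rho>: "0 < \<rho>" for \<rho>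
  proof -
    have "kernel_meets m N C \<subseteq> (\<Union>n. near_kernel m N (T n) \<rho>)"
    proof
      fix a assume "a \<in> kernel_meets m N C"
      then obtain h where a: "a \<in> space ?M" and h: "h \<in> C" "\<And>j. j < m \<Longrightarrow> (\<Sum>i<N. a (j, i) * h i) = 0"
        by (auto simp: kernel_meets_def)
      \<comment> \<open>Open in the product topology, because the condition involves finitely many
        coordinates of \<open>h\<close>.\<close>
      let ?U = "{h. (\<Sum>j<m. (\<Sum>i<N. a (j, i) * h i)\<^sup>2) < \<rho>\<^sup>2}"
      have "open ?U"
        by (intro open_Collect_less continuous_intros continuous_on_product_coordinates)
      moreover have "h \<in> ?U" using h(2) \<rho> by simp
      ultimately obtain d where d: "d \<in> D" "d \<in> ?U"
        using h(1) D(3) open_Int_closure_eq_empty[of ?U D] by blast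
      obtain n where "from_nat_into D n = d" using d(1) D(1) from_nat_into_surj by metis
      then have "d \<in> T n" by (auto simp: T_def)
      then show "a \<in> (\<Union>n. near_kernel m N (T n) \<rho>)"
        using a d(2) by (auto simp: near_kernel_def)
    qed
    moreover have sets: "near_kernel m N (T n) \<rho> \<in> sets ?M" for n
      by (rule sets_near_kernel) (simp add: T_def)
    ultimately have "?P \<le> emeasure ?M (\<Union>n. near_kernel m N (T n) \<rho>)"
      by (intro emeasure_mono sets.countable_UN) auto
    also have "\<dots> = (SUP n. emeasure ?M (near_kernel m N (T n) \<rho>))"
    proof (rule SUP_emeasure_incseq[symmetric])
      show "range (\<lambda>n. near_kernel m N (T n) \<rho>) \<subseteq> sets ?M" using sets by blast
      have "T n \<subseteq> T k" if "n \<le> k" for n k using that by (auto simp: T_def)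
      then show "incseq (\<lambda>n. near_kernel m N (T n) \<rho>)"
        unfolding incseq_def near_kernel_def by blast
    qed
    finally have "?P * ennreal (exp (s\<^sup>2 / 2)) * ennreal (exp (- s * (2 * \<rho>))) \<le>
      (SUP n. emeasure ?M (near_kernel m N (T n) \<rho>)) * (ennreal (exp (s\<^sup>2 / 2)) * ennreal (exp (- s * (2 * \<rho>))))"
      unfolding mult.assoc by (rule mult_right_mono) simp
    also have "\<dots> = (SUP n. emeasure ?M (near_kernel m N (T n) \<rho>) * (ennreal (exp (s\<^sup>2 / 2)) * ennreal (exp (- s * (2 * \<rho>)))))"
      by (rule SUP_mult_right_ennreal)
    also have "\<dots> \<le> ?Y"
    proof (rule SUP_least)
      fix n
      have "T n \<noteq> {}" by (simp add: T_def)
      then have "emeasure ?M (near_kernel m N (T n) \<rho>) * ennreal (exp (s\<^sup>2 / 2)) * ennreal (exp (- s * (2 * \<rho>))) \<le> ?Y"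
        using TD[of n] D(2) by (intro finite_escape[OF _ _ C s \<rho> u c bd]) (auto simp: T_def)
      then show "emeasure ?M (near_kernel m N (T n) \<rho>) * (ennreal (exp (s\<^sup>2 / 2)) * ennreal (exp (- s * (2 * \<rho>)))) \<le> ?Y"
        by (simp only: mult.assoc)
    qed
    finally show ?thesis .
  qed
  show ?thesis
  proof (rule ennreal_le_of_mult_tendsto_1)
    fix n :: nat
    show "?P * ennreal (exp (s\<^sup>2 / 2)) * ennreal (exp (- s * (2 * (1 / real (Suc n))))) \<le> ennreal 1 * ?Y"
      unfolding ennreal_1 mult_1_left by (rule step) simp
  next
    have "(\<lambda>n. exp (- s * (2 * (1 / real (Suc n))))) \<longlonglongrightarrow> exp (- s * (2 * 0))"
      by (intro tendsto_intros LIMSEQ_Suc[OF lim_1_over_n])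
    then show "(\<lambda>n. exp (- s * (2 * (1 / real (Suc n))))) \<longlonglongrightarrow> 1" by simp
  qed auto
qed

text \<open>The density is bounded by \<open>1 / 2\<close>, a little above its maximum
  \<open>1 / sqrt (2 * pi)\<close>, so that the two half-lines add up to exactly
  \<open>1 / t\<close>.\<close>

lemma integral_exp_minus_abs_le:
  assumes "0 < (t::real)"
  shows "(\<integral>\<^sup>+x. ennreal (exp (- t * \<bar>x\<bar>)) \<partial>std_normal) \<le> ennreal (1 / t)"
proof -
  let ?g = "\<lambda>x. ennreal (exp (- t * x)) * indicator {0..} x"
  have g: "(\<integral>\<^sup>+x. ?g x \<partial>lborel) = ennreal (1 / t)"
  proof -
    have "(\<integral>\<^sup>+x. ennreal (exp (- t * x)) * indicator {0..} x \<partial>lborel) = ennreal (0 - (- exp (- t * 0) / t))"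
    proof (rule nn_integral_FTC_atLeast)
      show "((\<lambda>x. - exp (- t * x) / t) \<longlongrightarrow> 0) at_top" using assms by real_asymp
      show "((\<lambda>x. - exp (- t * x) / t) has_real_derivative exp (- t * x)) (at x)" for x
        using assms by (auto intro!: derivative_eq_intros)
    qed auto
    then show ?thesis by simp
  qed
  have d: "std_normal_density x \<le> 1 / 2" for x
  proof -
    have "2 \<le> sqrt (2 * pi)" using pi_gt3 by (intro real_le_rsqrt) auto
    then have "1 / sqrt (2 * pi) * exp (- x\<^sup>2 / 2) \<le> 1 / 2 * 1"
      by (intro mult_mono) (auto simp: field_simps)
    then show ?thesis by (simp add: std_normal_density_def)
  qed
  have "(\<integral>\<^sup>+x. ennreal (exp (- t * \<bar>x\<bar>)) \<partial>std_normal) = (\<integral>\<^sup>+x. ennreal (std_normal_density x) * ennreal (exp (- t * \<bar>x\<bar>)) \<partial>lborel)"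
    by (subst nn_integral_density) auto
  also have "\<dots> \<le> (\<integral>\<^sup>+x. ennreal (1 / 2) * (?g x + ?g (- x)) \<partial>lborel)"
  proof (rule nn_integral_mono)
    fix x :: real
    have "ennreal (exp (- t * \<bar>x\<bar>)) \<le> ?g x + ?g (- x)"
      by (cases "0 \<le> x") (auto simp: indicator_def)
    then show "ennreal (std_normal_density x) * ennreal (exp (- t * \<bar>x\<bar>)) \<le> ennreal (1 / 2) * (?g x + ?g (- x))"
      by (intro mult_mono ennreal_leI d) auto
  qed
  also have "\<dots> = ennreal (1 / 2) * (ennreal (1 / t) + ennreal (1 / t))"
  proof -
    have "(\<integral>\<^sup>+x. ?g (- x) \<partial>lborel) = (\<integral>\<^sup>+x. ?g x \<partial>lborel)"
      using nn_integral_real_affine[of ?g "-1" 0] by simp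
    then show ?thesis using g by (simp add: nn_integral_cmult nn_integral_add)
  qed
  also have "\<dots> = ennreal (1 / t)"
  proof -
    have "ennreal (1 / t) + ennreal (1 / t) = ennreal (2 / t)"
      using assms by (simp add: ennreal_plus[symmetric] del: ennreal_plus)
    moreover have "ennreal (1 / 2) * ennreal (2 / t) = ennreal ((1 / 2) * (2 / t))"
      using assms by (intro ennreal_mult[symmetric]) auto
    ultimately show ?thesis by (simp only:) simp
  qed
  finally show ?thesis .
qed

text \<open>The \<open>l1\<close> norm is at most \<open>sqrt (card J)\<close> times the Euclidean
  norm, which reduces the integral to a product. The resulting decay \<open>s ^ (- card J)\<close>
  serves the null events, where \<open>s\<close> tends to infinity;
  \<open>chi_laplace_le_exp\<close> is for moderate \<open>s\<close>.\<close>

lemma chi_laplace_le_power: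
  assumes J: "finite J" "J \<noteq> {}" and s: "0 < s"
  shows "chi_laplace J s \<le> ennreal ((sqrt (card J) / s) ^ card J)"
proof -
  let ?n = "real (card J)"
  have n: "0 < ?n" using J by (simp add: card_gt_0_iff)
  define t where "t = s / sqrt ?n"
  have t: "0 < t" using n s by (simp add: t_def)
  have le: "exp (- s * sqrt (\<Sum>c\<in>J. (\<omega> c)\<^sup>2)) \<le> (\<Prod>c\<in>J. exp (- t * \<bar>\<omega> c\<bar>))" for \<omega> :: "'a \<Rightarrow> real"
  proof -
    have "(\<Sum>c\<in>J. \<bar>\<omega> c\<bar>) = (\<Sum>c\<in>J. \<bar>\<omega> c\<bar> * 1)" by simp
    also have "\<dots> \<le> sqrt (\<Sum>c\<in>J. \<bar>\<omega> c\<bar>\<^sup>2) * sqrt (\<Sum>c\<in>J. 1\<^sup>2)"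
      using L2_set_mult_ineq[of "\<lambda>c. \<bar>\<omega> c\<bar>" "\<lambda>_. 1" J] by (simp add: L2_set_def)
    finally have "(\<Sum>c\<in>J. \<bar>\<omega> c\<bar>) \<le> sqrt (\<Sum>c\<in>J. (\<omega> c)\<^sup>2) * sqrt ?n" by simp
    then have "t * (\<Sum>c\<in>J. \<bar>\<omega> c\<bar>) \<le> t * (sqrt (\<Sum>c\<in>J. (\<omega> c)\<^sup>2) * sqrt ?n)"
      using t by (intro mult_left_mono) auto
    also have "\<dots> = s * sqrt (\<Sum>c\<in>J. (\<omega> c)\<^sup>2)" using n by (simp add: t_def)
    finally show ?thesis
      using J by (simp add: exp_sum[symmetric] sum_negf sum_distrib_left)
  qed
  have "(\<lambda>x::real. ennreal (exp (- t * \<bar>x\<bar>))) \<in> borel_measurable borel" by measurable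
  then have m: "(\<lambda>x::real. ennreal (exp (- t * \<bar>x\<bar>))) \<in> borel_measurable std_normal"
    by (simp only: measurable_density_eq1 measurable_lborel2)
  have "chi_laplace J s \<le> (\<integral>\<^sup>+\<omega>. (\<Prod>c\<in>J. ennreal (exp (- t * \<bar>\<omega> c\<bar>))) \<partial>gauss J)"
    unfolding chi_laplace_def
  proof (rule nn_integral_mono)
    fix \<omega> :: "'a \<Rightarrow> real"
    show "ennreal (exp (- s * sqrt (\<Sum>c\<in>J. (\<omega> c)\<^sup>2))) \<le> (\<Prod>c\<in>J. ennreal (exp (- t * \<bar>\<omega> c\<bar>)))"
      using ennreal_leI[OF le[of \<omega>]] by (simp only: prod_ennreal exp_ge_zero)
  qed
  also have "\<dots> = (\<Prod>c\<in>J. \<integral>\<^sup>+x. ennreal (exp (- t * \<bar>x\<bar>)) \<partial>std_normal)"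
    by (rule product_sigma_finite.product_nn_integral_prod[OF product_sigma_finite_std_normal J(1) m])
  also have "\<dots> \<le> (\<Prod>c\<in>J. ennreal (1 / t))"
    by (intro prod_mono_ennreal integral_exp_minus_abs_le t)
  also have "\<dots> = ennreal ((sqrt ?n / s) ^ card J)"
    using s by (simp add: ennreal_power t_def)
  finally show ?thesis .
qed

section \<open>The Laplace transform of the Gaussian norm\<close>

text \<open>Both sides agree at \<open>y = 1\<close>, and their difference has derivative
  \<open>(1 - x)\<^sup>2 / x\<close>. The quadratic is chosen such that adding
  \<open>(1 - y\<^sup>2) / 2\<close> leaves \<open>- (1 - y)\<^sup>2\<close>, the exponent of the
  next tail bound.\<close>

lemma ln_le_quadratic:
  assumes "0 < y" "y \<le> (1::real)"
  shows "ln y \<le> - (3 - 4 * y + y\<^sup>2) / 2"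
proof -
  have "ln y + (3 - 4 * y + y\<^sup>2) / 2 \<le> ln 1 + (3 - 4 * 1 + 1\<^sup>2) / 2"
  proof (rule DERIV_nonneg_imp_nondecreasing[of y 1 "\<lambda>y. ln y + (3 - 4 * y + y\<^sup>2) / 2"])
    fix x assume x: "y \<le> x" "x \<le> 1"
    then have "0 < x" using assms by linarith
    then have "((\<lambda>y. ln y + (3 - 4 * y + y\<^sup>2) / 2) has_real_derivative (1 - x)\<^sup>2 / x) (at x)"
      by (auto intro!: derivative_eq_intros simp: field_simps power2_eq_square)
    then show "\<exists>y. ((\<lambda>y. ln y + (3 - 4 * y + y\<^sup>2) / 2) has_real_derivative y) (at x) \<and> 0 \<le> y"
      using \<open>0 < x\<close> by (intro exI[of _ "(1 - x)\<^sup>2 / x"]) auto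
  qed (use assms in auto)
  then have "ln y + (3 - 4 * y + y\<^sup>2) / 2 \<le> 0" by simp
  then show ?thesis by linarith
qed

lemma nn_integral_std_normal_exp_sq:
  assumes "- 1 / 2 < \<mu>"
  shows "(\<integral>\<^sup>+x. ennreal (exp (- \<mu> * x\<^sup>2)) \<partial>std_normal) = ennreal (1 / sqrt (1 + 2 * \<mu>))"
proof -
  define \<sigma> where "\<sigma> = 1 / sqrt (1 + 2 * \<mu>)"
  have \<sigma>: "0 < \<sigma>" "\<sigma>\<^sup>2 = 1 / (1 + 2 * \<mu>)" using assms by (auto simp: \<sigma>_def power_divide)
  have eq: "std_normal_density x * exp (- \<mu> * x\<^sup>2) = \<sigma> * normal_density 0 \<sigma> x" for x
  proof -
    have "sqrt (2 * pi * \<sigma>\<^sup>2) = sqrt (2 * pi) * \<sigma>" using \<sigma>(1) by (simp add: real_sqrt_mult)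
    moreover have "- x\<^sup>2 / 2 + - \<mu> * x\<^sup>2 = - (x - 0)\<^sup>2 / (2 * \<sigma>\<^sup>2)"
      using assms unfolding \<sigma>(2) by (simp add: field_simps)
    ultimately show ?thesis
      using \<sigma>(1) unfolding normal_density_def std_normal_density_def by (simp add: exp_add[symmetric])
  qed
  have "(\<integral>\<^sup>+x. ennreal (exp (- \<mu> * x\<^sup>2)) \<partial>std_normal) =
      (\<integral>\<^sup>+x. ennreal (std_normal_density x) * ennreal (exp (- \<mu> * x\<^sup>2)) \<partial>lborel)"
    by (subst nn_integral_density) auto
  also have "\<dots> = (\<integral>\<^sup>+x. ennreal \<sigma> * ennreal (normal_density 0 \<sigma> x) \<partial>lborel)"
    using \<sigma>(1) by (intro nn_integral_cong)
      (simp only: ennreal_mult[symmetric] eq normal_density_nonneg exp_ge_zero less_imp_le)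
  also have "\<dots> = ennreal \<sigma> * (\<integral>\<^sup>+x. ennreal (normal_density 0 \<sigma> x) \<partial>lborel)"
    by (rule nn_integral_cmult) simp
  also have "(\<integral>\<^sup>+x. ennreal (normal_density 0 \<sigma> x) \<partial>lborel) = 1"
    using \<sigma>(1) by (subst nn_integral_eq_integral) auto
  finally show ?thesis by (simp add: \<sigma>_def)
qed

lemma nn_integral_exp_tail:
  assumes s: "0 < (s::real)"
  shows "(\<integral>\<^sup>+x. ennreal (s * exp (- s * x)) * indicator {r..} x \<partial>lborel) = ennreal (exp (- s * r))"
proof -
  have "(\<integral>\<^sup>+x. ennreal (s * exp (- s * x)) * indicator {r..} x \<partial>lborel) = ennreal (0 - (- exp (- s * r)))"
  proof (rule nn_integral_FTC_atLeast)
    show "((\<lambda>x. - exp (- s * x)) \<longlongrightarrow> 0) at_top" using s by real_asymp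
    show "((\<lambda>x. - exp (- s * x)) has_real_derivative s * exp (- s * x)) (at x)" for x
      by (auto intro!: derivative_eq_intros)
  qed (use s in auto)
  then show ?thesis by simp
qed

lemma nn_integral_exp_gauss:
  fixes s a :: real
  assumes s: "0 < s"
  shows "(\<integral>\<^sup>+x. ennreal (s * exp (- s * x) * exp (- (a - x)\<^sup>2)) \<partial>lborel) =
    ennreal (s * sqrt pi * exp (- s * a + s\<^sup>2 / 4))"
proof -
  define \<sigma> :: real where "\<sigma> = 1 / sqrt 2"
  have \<sigma>: "0 < \<sigma>" "2 * \<sigma>\<^sup>2 = 1" by (auto simp: \<sigma>_def power_divide)
  have eq: "s * exp (- s * x) * exp (- (a - x)\<^sup>2) = s * sqrt pi * exp (- s * a + s\<^sup>2 / 4) * normal_density (a - s / 2) \<sigma> x" for x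
  proof -
    have "2 * pi * \<sigma>\<^sup>2 = pi" using \<sigma>(2) by simp
    have "- s * x + - (a - x)\<^sup>2 = (- s * a + s\<^sup>2 / 4) + - (x - (a - s / 2))\<^sup>2"
      by (simp add: power2_eq_square field_simps)
    then have "exp (- s * x) * exp (- (a - x)\<^sup>2) = exp (- s * a + s\<^sup>2 / 4) * exp (- (x - (a - s / 2))\<^sup>2)"
      by (simp only: exp_add[symmetric])
    moreover have "normal_density (a - s / 2) \<sigma> x = 1 / sqrt pi * exp (- (x - (a - s / 2))\<^sup>2)"
      unfolding normal_density_def \<open>2 * pi * \<sigma>\<^sup>2 = pi\<close> \<sigma>(2) by simp
    ultimately show ?thesis by (simp only: mult.assoc) simp
  qed
  have "(\<integral>\<^sup>+x. ennreal (s * exp (- s * x) * exp (- (a - x)\<^sup>2)) \<partial>lborel) =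
     (\<integral>\<^sup>+x. ennreal (s * sqrt pi * exp (- s * a + s\<^sup>2 / 4)) * ennreal (normal_density (a - s / 2) \<sigma> x) \<partial>lborel)"
    unfolding eq using s by (simp add: ennreal_mult)
  also have "\<dots> = ennreal (s * sqrt pi * exp (- s * a + s\<^sup>2 / 4)) * (\<integral>\<^sup>+x. ennreal (normal_density (a - s / 2) \<sigma> x) \<partial>lborel)"
    by (rule nn_integral_cmult) simp
  also have "(\<integral>\<^sup>+x. ennreal (normal_density (a - s / 2) \<sigma> x) \<partial>lborel) = 1"
    using \<sigma>(1) by (subst nn_integral_eq_integral) auto
  finally show ?thesis by simp
qed

text \<open>Chernoff's method for the lower tail of the norm; \<open>ln_le_quadratic\<close> turns
  the optimal exponent into a perfect square.\<close>

lemma gauss_norm_small: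
  assumes J: "finite J" "J \<noteq> {}" and x: "0 < x" "x \<le> sqrt (card J)"
  shows "(\<integral>\<^sup>+\<omega>. indicator {\<omega>. sqrt (\<Sum>c\<in>J. (\<omega> c)\<^sup>2) \<le> x} \<omega> \<partial>gauss J) \<le> ennreal (exp (- (sqrt (card J) - x)\<^sup>2))"
proof -
  define n where "n = real (card J)"
  have n: "0 < n" using J by (simp add: n_def card_gt_0_iff)
  \<comment> \<open>The minimizer of
    \<open>exp (\<mu> * x\<^sup>2) * (1 + 2 * \<mu>) powr (- n / 2)\<close>, that is
    \<open>1 + 2 * \<mu> = n / x\<^sup>2\<close>.\<close>
  define \<mu> where "\<mu> = (n / x\<^sup>2 - 1) / 2"
  have x2: "x\<^sup>2 \<le> n" using x n by (metis n_def less_imp_le real_sqrt_pow2 power_mono)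
  have \<mu>: "0 \<le> \<mu>" "1 + 2 * \<mu> = n / x\<^sup>2" "\<mu> * x\<^sup>2 = (n - x\<^sup>2) / 2"
    using x x2 by (auto simp: \<mu>_def field_simps)
  have le: "indicator {\<omega>. sqrt (\<Sum>c\<in>J. (\<omega> c)\<^sup>2) \<le> x} \<omega> \<le> ennreal (exp (\<mu> * x\<^sup>2)) * (\<Prod>c\<in>J. ennreal (exp (- \<mu> * (\<omega> c)\<^sup>2)))" for \<omega>
  proof (cases "sqrt (\<Sum>c\<in>J. (\<omega> c)\<^sup>2) \<le> x")
    case True
    then have "(\<Sum>c\<in>J. (\<omega> c)\<^sup>2) \<le> x\<^sup>2" using x by (simp add: sqrt_le_D)
    then have "0 \<le> \<mu> * (x\<^sup>2 - (\<Sum>c\<in>J. (\<omega> c)\<^sup>2))" using \<mu> by simp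
    then have "1 \<le> exp (\<mu> * x\<^sup>2 + (\<Sum>c\<in>J. - \<mu> * (\<omega> c)\<^sup>2))"
      by (simp add: sum_distrib_left[symmetric] sum_negf algebra_simps)
    then have "1 \<le> exp (\<mu> * x\<^sup>2) * (\<Prod>c\<in>J. exp (- \<mu> * (\<omega> c)\<^sup>2))"
      using J by (simp only: exp_add exp_sum)
    then have "ennreal 1 \<le> ennreal (exp (\<mu> * x\<^sup>2) * (\<Prod>c\<in>J. exp (- \<mu> * (\<omega> c)\<^sup>2)))"
      by (rule ennreal_leI)
    then show ?thesis
      using True by (simp only: ennreal_mult exp_ge_zero prod_nonneg prod_ennreal) simp
  qed simp
  have m0: "(\<lambda>x::real. ennreal (exp (- \<mu> * x\<^sup>2))) \<in> borel_measurable borel" by measurable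
  then have m1: "(\<lambda>x::real. ennreal (exp (- \<mu> * x\<^sup>2))) \<in> borel_measurable std_normal"
    by (simp only: measurable_density_eq1 measurable_lborel2)
  have "(\<integral>\<^sup>+\<omega>. indicator {\<omega>. sqrt (\<Sum>c\<in>J. (\<omega> c)\<^sup>2) \<le> x} \<omega> \<partial>gauss J) \<le>
     (\<integral>\<^sup>+\<omega>. ennreal (exp (\<mu> * x\<^sup>2)) * (\<Prod>c\<in>J. ennreal (exp (- \<mu> * (\<omega> c)\<^sup>2))) \<partial>gauss J)"
    by (intro nn_integral_mono le)
  also have "\<dots> = ennreal (exp (\<mu> * x\<^sup>2)) * (\<integral>\<^sup>+\<omega>. (\<Prod>c\<in>J. ennreal (exp (- \<mu> * (\<omega> c)\<^sup>2))) \<partial>gauss J)"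
    by (intro nn_integral_cmult borel_measurable_prod_ennreal measurable_compose[OF measurable_gauss_component m0])
  also have "(\<integral>\<^sup>+\<omega>. (\<Prod>c\<in>J. ennreal (exp (- \<mu> * (\<omega> c)\<^sup>2))) \<partial>gauss J) =
      (\<Prod>c\<in>J. \<integral>\<^sup>+x. ennreal (exp (- \<mu> * x\<^sup>2)) \<partial>std_normal)"
    by (rule product_sigma_finite.product_nn_integral_prod[OF product_sigma_finite_std_normal J(1) m1])
  also have "\<dots> = ennreal (x / sqrt n) ^ card J"
    using x \<mu>(1) by (subst nn_integral_std_normal_exp_sq) (simp_all add: \<mu>(2) real_sqrt_divide)
  also have "ennreal (exp (\<mu> * x\<^sup>2)) * \<dots> = ennreal (exp (\<mu> * x\<^sup>2) * (x / sqrt n) ^ card J)"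
    using x n by (simp add: ennreal_power ennreal_mult)
  also have "\<dots> \<le> ennreal (exp (- (sqrt n - x)\<^sup>2))"
  proof (rule ennreal_leI)
    define y where "y = x / sqrt n"
    have y: "0 < y" "y \<le> 1" "x = y * sqrt n" using x n by (auto simp: y_def n_def)
    have "exp (\<mu> * x\<^sup>2) * y ^ card J = exp (\<mu> * x\<^sup>2 + n * ln y)"
      using y by (simp add: exp_add n_def exp_of_nat_mult)
    also have "\<mu> * x\<^sup>2 + n * ln y \<le> (n - x\<^sup>2) / 2 + n * (- (3 - 4 * y + y\<^sup>2) / 2)"
      using n ln_le_quadratic[OF y(1,2)] unfolding \<mu>(3) by (intro add_left_mono mult_left_mono) auto
    also have "\<dots> = - (sqrt n - x)\<^sup>2"
    proof -
      have "sqrt n * sqrt n = n" using n by simp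
      then show ?thesis unfolding y(3) by (simp add: power2_eq_square algebra_simps) (simp add: field_simps)
    qed
    finally show "exp (\<mu> * x\<^sup>2) * (x / sqrt n) ^ card J \<le> exp (- (sqrt n - x)\<^sup>2)"
      unfolding y_def by simp
  qed
  finally show ?thesis unfolding n_def .
qed

lemma layer_measurable:
  assumes r: "r \<in> borel_measurable M"
  shows "(\<lambda>p. ennreal (s * exp (- s * fst p)) * indicator {r (snd p)..} (fst p)) \<in> borel_measurable (lborel \<Otimes>\<^sub>M M)"
proof -
  have "(\<lambda>x. ennreal (s * exp (- s * x))) \<in> borel_measurable borel" by measurable
  then have 1: "(\<lambda>x. ennreal (s * exp (- s * x))) \<in> borel_measurable lborel" by simp
  have "(\<lambda>x::real. x) \<in> borel_measurable lborel" by simp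
  from measurable_compose[OF measurable_fst this]
  have 2: "(\<lambda>p. fst p :: real) \<in> borel_measurable (lborel \<Otimes>\<^sub>M M)" .
  have "(\<lambda>p. ennreal (s * exp (- s * fst p)) * (if r (snd p) \<le> fst p then 1 else 0)) \<in> borel_measurable (lborel \<Otimes>\<^sub>M M)"
    by (intro borel_measurable_times_ennreal measurable_compose[OF measurable_fst 1] measurable_If
        borel_measurable_const borel_measurable_le 2 measurable_compose[OF measurable_snd r])
  moreover have "indicator {r (snd p)..} (fst p) = (if r (snd p) \<le> fst p then 1 else 0 :: ennreal)" for p :: "real \<times> 'a"
    by simp
  ultimately show ?thesis by (simp only:)
qed

lemma nn_integral_layers:
  fixes a s :: real
  shows "(\<integral>\<^sup>+x. ennreal (s * exp (- s * x)) * indicator {a..} x + ennreal (s * exp (- s * x) * exp (- (a - x)\<^sup>2)) \<partial>lborel)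
    = (\<integral>\<^sup>+x. ennreal (s * exp (- s * x)) * indicator {a..} x \<partial>lborel)
     + (\<integral>\<^sup>+x. ennreal (s * exp (- s * x) * exp (- (a - x)\<^sup>2)) \<partial>lborel)"
  by (rule nn_integral_add) measurable

text \<open>Layer cake: \<open>exp (- s * r)\<close> is the integral of
  \<open>s * exp (- s * x)\<close> over \<open>x \<ge> r\<close>, so the transform integrates this
  weight against the probability that the norm is at most \<open>x\<close>. That probability is
  bounded by \<open>1\<close> above \<open>sqrt (card J)\<close> and by
  \<open>gauss_norm_small\<close> below. The summand \<open>s\<^sup>2 / 2\<close> in the exponent is
  affordable: it is what \<open>\<gamma>\<close> supplies on the other side of the
  comparison.\<close>

lemma chi_laplace_le_exp:
  assumes J: "finite J" "J \<noteq> {}" and s: "0 < s"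
  shows "chi_laplace J s \<le> ennreal ((1 + sqrt pi) * exp (- s * sqrt (card J) + s\<^sup>2 / 2))"
proof -
  let ?a = "sqrt (card J)"
  let ?r = "\<lambda>\<omega>. sqrt (\<Sum>c\<in>J. (\<omega> c)\<^sup>2)"
  define f where "f = (\<lambda>x \<omega>. ennreal (s * exp (- s * x)) * indicator {?r \<omega>..} x)"
  have rm: "?r \<in> borel_measurable (gauss J)"
  proof -
    have 1: "(\<lambda>x. sqrt x) \<in> borel_measurable borel" by measurable
    have 2: "(\<lambda>\<omega>. \<Sum>c\<in>J. (\<omega> c)\<^sup>2 :: real) \<in> borel_measurable (gauss J)"
      by (intro borel_measurable_sum borel_measurable_power measurable_gauss_component)
    show ?thesis by (rule measurable_compose[OF 2 1])
  qed
  have fm: "(\<lambda>p. f (fst p) (snd p)) \<in> borel_measurable (lborel \<Otimes>\<^sub>M gauss J)"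
    unfolding f_def by (rule layer_measurable[OF rm])
  have "chi_laplace J s = (\<integral>\<^sup>+\<omega>. \<integral>\<^sup>+x. f x \<omega> \<partial>lborel \<partial>gauss J)"
    unfolding chi_laplace_def f_def by (intro nn_integral_cong nn_integral_exp_tail[OF s, symmetric])
  also have "\<dots> = (\<integral>\<^sup>+x. \<integral>\<^sup>+\<omega>. f x \<omega> \<partial>gauss J \<partial>lborel)"
  proof -
    have "pair_sigma_finite lborel (gauss J)"
      by (intro pair_sigma_finite.intro sigma_finite_lborel prob_space_imp_sigma_finite prob_space_gauss)
    from pair_sigma_finite.Fubini[OF this fm] show ?thesis by (simp only: fst_conv snd_conv)
  qed
  also have "\<dots> \<le> (\<integral>\<^sup>+x. ennreal (s * exp (- s * x)) * indicator {?a..} x + ennreal (s * exp (- s * x) * exp (- (?a - x)\<^sup>2)) \<partial>lborel)"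
  proof (rule nn_integral_mono_AE)
    \<comment> \<open>The tail bound needs \<open>0 < x\<close>; negative \<open>x\<close> give an
      empty event, and the single point zero is a null set.\<close>
    have ae: "AE x in lborel. x \<noteq> (0::real)" by (rule AE_lborel_singleton)
    show "AE x in lborel. (\<integral>\<^sup>+\<omega>. f x \<omega> \<partial>gauss J) \<le>
       ennreal (s * exp (- s * x)) * indicator {?a..} x + ennreal (s * exp (- s * x) * exp (- (?a - x)\<^sup>2))"
      using ae
    proof (eventually_elim)
      fix x :: real assume "x \<noteq> 0"
      have f: "(\<integral>\<^sup>+\<omega>. f x \<omega> \<partial>gauss J) = ennreal (s * exp (- s * x)) * (\<integral>\<^sup>+\<omega>. indicator {\<omega>. ?r \<omega> \<le> x} \<omega> \<partial>gauss J)"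
      proof -
        have "(\<integral>\<^sup>+\<omega>. f x \<omega> \<partial>gauss J) = (\<integral>\<^sup>+\<omega>. ennreal (s * exp (- s * x)) * indicator {\<omega>\<in>space (gauss J). ?r \<omega> \<le> x} \<omega> \<partial>gauss J)"
          by (intro nn_integral_cong) (auto simp: f_def indicator_def)
        also have "\<dots> = ennreal (s * exp (- s * x)) * (\<integral>\<^sup>+\<omega>. indicator {\<omega>\<in>space (gauss J). ?r \<omega> \<le> x} \<omega> \<partial>gauss J)"
          by (intro nn_integral_cmult borel_measurable_indicator borel_measurable_le rm borel_measurable_const)
        also have "(\<integral>\<^sup>+\<omega>. indicator {\<omega>\<in>space (gauss J). ?r \<omega> \<le> x} \<omega> \<partial>gauss J) = (\<integral>\<^sup>+\<omega>. indicator {\<omega>. ?r \<omega> \<le> x} \<omega> \<partial>gauss J)"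
          by (intro nn_integral_cong) (auto simp: indicator_def)
        finally show ?thesis .
      qed
      consider "x < 0" | "0 < x" "x \<le> ?a" | "?a < x" using \<open>x \<noteq> 0\<close> by linarith
      then show "(\<integral>\<^sup>+\<omega>. f x \<omega> \<partial>gauss J) \<le>
       ennreal (s * exp (- s * x)) * indicator {?a..} x + ennreal (s * exp (- s * x) * exp (- (?a - x)\<^sup>2))"
      proof cases
        case 1
        have "\<not> ?r \<omega> \<le> x" for \<omega> :: "'a \<Rightarrow> real"
          using 1 real_sqrt_ge_zero[of "\<Sum>c\<in>J. (\<omega> c)\<^sup>2"] by (auto simp: sum_nonneg not_le intro: less_le_trans)
        then show ?thesis unfolding f by simp
      next
        case 2
        have "(\<integral>\<^sup>+\<omega>. f x \<omega> \<partial>gauss J) \<le> ennreal (s * exp (- s * x)) * ennreal (exp (- (?a - x)\<^sup>2))"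
          unfolding f by (intro mult_left_mono gauss_norm_small J 2) auto
        also have "\<dots> = ennreal (s * exp (- s * x) * exp (- (?a - x)\<^sup>2))"
          using s by (intro ennreal_mult[symmetric]) auto
        finally show ?thesis by (rule order_trans) simp
      next
        case 3
        have "(\<integral>\<^sup>+\<omega>. indicator {\<omega>. ?r \<omega> \<le> x} \<omega> \<partial>gauss J) \<le> (\<integral>\<^sup>+\<omega>. 1 \<partial>gauss J)"
          by (intro nn_integral_mono) (auto simp: indicator_def)
        also have "\<dots> = 1" by (simp add: prob_space.emeasure_space_1[OF prob_space_gauss])
        finally have "(\<integral>\<^sup>+\<omega>. f x \<omega> \<partial>gauss J) \<le> ennreal (s * exp (- s * x)) * 1"
          unfolding f by (intro mult_left_mono) auto
        also have "\<dots> = ennreal (s * exp (- s * x)) * indicator {?a..} x" using 3 by simp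
        finally show ?thesis by (rule order_trans) simp
      qed
    qed
  qed
  also have "\<dots> = (\<integral>\<^sup>+x. ennreal (s * exp (- s * x)) * indicator {?a..} x \<partial>lborel) + (\<integral>\<^sup>+x. ennreal (s * exp (- s * x) * exp (- (?a - x)\<^sup>2)) \<partial>lborel)"
    by (rule nn_integral_layers)
  also have "\<dots> = ennreal (exp (- s * ?a)) + ennreal (s * sqrt pi * exp (- s * ?a + s\<^sup>2 / 4))"
    by (simp only: nn_integral_exp_tail[OF s] nn_integral_exp_gauss[OF s])
  also have "\<dots> = ennreal (exp (- s * ?a) + s * sqrt pi * exp (- s * ?a + s\<^sup>2 / 4))"
    using s by (intro ennreal_plus[symmetric]) auto
  also have "\<dots> \<le> ennreal ((1 + sqrt pi) * exp (- s * ?a + s\<^sup>2 / 2))"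
  proof (rule ennreal_leI)
    have "s \<le> 1 + s\<^sup>2 / 4"
      using zero_le_power2[of "s / 2 - 1"] by (simp add: power2_eq_square field_simps)
    also have "\<dots> \<le> exp (s\<^sup>2 / 4)" by (rule exp_ge_add_one_self)
    finally have "s * exp (s\<^sup>2 / 4) \<le> exp (s\<^sup>2 / 4) * exp (s\<^sup>2 / 4)" by (intro mult_right_mono) auto
    also have "\<dots> = exp (s\<^sup>2 / 2)" by (simp add: exp_add[symmetric])
    finally have "sqrt pi * exp (- s * ?a) * (s * exp (s\<^sup>2 / 4)) \<le> sqrt pi * exp (- s * ?a) * exp (s\<^sup>2 / 2)"
      by (intro mult_left_mono) auto
    moreover have "exp (- s * ?a) * 1 \<le> exp (- s * ?a) * exp (s\<^sup>2 / 2)" by (intro mult_left_mono) auto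
    ultimately have "exp (- s * ?a) * 1 + sqrt pi * exp (- s * ?a) * (s * exp (s\<^sup>2 / 4)) \<le>
      exp (- s * ?a) * exp (s\<^sup>2 / 2) + sqrt pi * exp (- s * ?a) * exp (s\<^sup>2 / 2)"
      by (rule add_mono[rotated])
    moreover have "exp (- s * ?a) + s * sqrt pi * exp (- s * ?a + s\<^sup>2 / 4) =
       exp (- s * ?a) * 1 + sqrt pi * exp (- s * ?a) * (s * exp (s\<^sup>2 / 4))"
      unfolding exp_add by (simp only: mult_ac mult_1)
    moreover have "(1 + sqrt pi) * exp (- s * ?a + s\<^sup>2 / 2) =
      exp (- s * ?a) * exp (s\<^sup>2 / 2) + sqrt pi * exp (- s * ?a) * exp (s\<^sup>2 / 2)"
      unfolding exp_add distrib_right by (simp only: mult_ac mult_1)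
    ultimately show "exp (- s * ?a) + s * sqrt pi * exp (- s * ?a + s\<^sup>2 / 4) \<le> (1 + sqrt pi) * exp (- s * ?a + s\<^sup>2 / 2)"
      by (simp only:)
  qed
  finally show ?thesis .
qed

section \<open>Truncated Gaussian moments\<close>

text \<open>Distances to half-lines: \<open>trunc \<tau> (- x)\<close> is the distance of
  \<open>x\<close> to the numbers above \<open>\<tau>\<close>, and \<open>trunc (- \<tau>) x\<close>
  the distance to those below. Their second moments are the two integrals of
  \<open>Delta_bin\<close>.\<close>

definition trunc :: "real \<Rightarrow> real \<Rightarrow> real" where
  "trunc t x = max 0 (x + t)"

lemma trunc_nonneg: "0 \<le> trunc t x" by (simp add: trunc_def)

lemma trunc_measurable [measurable]: "trunc t \<in> borel_measurable borel"
  unfolding trunc_def by measurable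

lemma max_0_power_deriv:
  assumes "0 < n"
  shows "((\<lambda>y. max 0 y ^ Suc n) has_real_derivative real (Suc n) * max 0 y ^ n) (at y)"
proof -
  consider "y < 0" | "0 < y" | "y = 0" by linarith
  then show ?thesis
  proof cases
    case 1
    have "((\<lambda>y. max 0 y ^ Suc n) has_real_derivative 0) (at y)"
      by (rule has_field_derivative_transform_within_open[where f = "\<lambda>_. 0" and S = "{..<0}"]) (use 1 in auto)
    then show ?thesis by (rule DERIV_cong) (use 1 assms in \<open>simp add: max_def zero_power\<close>)
  next
    case 2
    have "((\<lambda>y. y ^ Suc n) has_real_derivative real (Suc n) * y ^ n) (at y)"
      by (rule derivative_eq_intros refl | simp)+
    then have "((\<lambda>y. max 0 y ^ Suc n) has_real_derivative real (Suc n) * y ^ n) (at y)"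
      by (rule has_field_derivative_transform_within_open[where S = "{0<..}"]) (use 2 in auto)
    then show ?thesis using 2 by simp
  next
    case 3
    \<comment> \<open>At the kink the difference quotient is at most
      \<open>\<bar>h\<bar> ^ n\<close>, which tends to zero because \<open>0 < n\<close>.\<close>
    have "((\<lambda>h. (max 0 (0 + h) ^ Suc n - max 0 0 ^ Suc n) / h) \<longlongrightarrow> 0) (at (0::real))"
    proof (rule Lim_null_comparison)
      have "norm ((max 0 (0 + h) ^ Suc n - max 0 0 ^ Suc n) / h) \<le> \<bar>h\<bar> ^ n" for h :: real
        by (cases "h \<le> 0") (auto simp: abs_mult)
      then show "eventually (\<lambda>h. norm ((max 0 (0 + h) ^ Suc n - max 0 0 ^ Suc n) / h) \<le> \<bar>h\<bar> ^ n) (at (0::real))"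
        by (intro always_eventually) blast
      have "((\<lambda>h. \<bar>h\<bar> ^ n) \<longlongrightarrow> \<bar>0\<bar> ^ n) (at (0::real))" by (intro tendsto_intros)
      then show "((\<lambda>h. \<bar>h\<bar> ^ n) \<longlongrightarrow> 0) (at (0::real))" using assms by (simp only: abs_zero zero_power)
    qed
    then have "((\<lambda>y. max 0 y ^ Suc n) has_real_derivative 0) (at 0)"
      unfolding DERIV_def .
    then show ?thesis unfolding 3 by (rule DERIV_cong) (use assms in \<open>simp add: zero_power\<close>)
  qed
qed

lemma trunc_power_deriv:
  assumes "0 < n"
  shows "((\<lambda>x. trunc t x ^ Suc n) has_real_derivative real (Suc n) * trunc t x ^ n) (at x)"
proof -
  have "((\<lambda>x. x + t) has_real_derivative 1) (at x)" by (auto intro!: derivative_eq_intros)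
  from DERIV_chain2[OF max_0_power_deriv[OF assms] this] show ?thesis
    unfolding trunc_def by (simp only: mult_1_right)
qed

lemma trunc_power_le: "trunc t x ^ n \<le> exp (real n * \<bar>t\<bar>) * exp (real n * \<bar>x\<bar>)"
proof -
  have "trunc t x \<le> \<bar>x\<bar> + \<bar>t\<bar>" by (auto simp: trunc_def)
  also have "\<dots> \<le> exp (\<bar>x\<bar> + \<bar>t\<bar>)" by (intro abs_le_exp) auto
  finally have "trunc t x ^ n \<le> exp (\<bar>x\<bar> + \<bar>t\<bar>) ^ n" by (intro power_mono trunc_nonneg)
  also have "\<dots> = exp (real n * \<bar>t\<bar>) * exp (real n * \<bar>x\<bar>)"
    by (simp add: exp_of_nat_mult[symmetric] exp_add[symmetric] algebra_simps)
  finally show ?thesis .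
qed

lemma integrable_trunc_power: "integrable std_normal (\<lambda>x. trunc t x ^ n)"
  by (rule integrable_std_normal_bound[where C = "exp (real n * \<bar>t\<bar>)" and s = "real n"])
     (use trunc_power_le in \<open>auto simp: trunc_nonneg\<close>)

lemma integrable_trunc_power_reflect: "integrable std_normal (\<lambda>x. trunc t (- x) ^ n)"
proof (rule integrable_std_normal_bound[where C = "exp (real n * \<bar>t\<bar>)" and s = "real n"])
  show "\<bar>trunc t (- x) ^ n\<bar> \<le> exp (real n * \<bar>t\<bar>) * exp (real n * \<bar>x\<bar>)" for x
    using trunc_power_le[of t "- x" n] by (simp add: trunc_nonneg)
qed simp

lemma integrable_mult_trunc_power: "integrable std_normal (\<lambda>x. x * trunc t x ^ n)"
proof (rule integrable_std_normal_bound[where C = "exp (real n * \<bar>t\<bar>)" and s = "real n + 1"])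
  fix x
  have "\<bar>x * trunc t x ^ n\<bar> \<le> exp \<bar>x\<bar> * (exp (real n * \<bar>t\<bar>) * exp (real n * \<bar>x\<bar>))"
    unfolding abs_mult using trunc_power_le[of t x n] by (intro mult_mono abs_le_exp) (auto simp: trunc_nonneg)
  then show "\<bar>x * trunc t x ^ n\<bar> \<le> exp (real n * \<bar>t\<bar>) * exp ((real n + 1) * \<bar>x\<bar>)"
    by (simp add: exp_add algebra_simps)
qed auto

definition trunc_moment :: "real \<Rightarrow> nat \<Rightarrow> real" where
  "trunc_moment t n = (LINT x|std_normal. trunc t x ^ n)"

lemma trunc_moment_nonneg: "0 \<le> trunc_moment t n"
  unfolding trunc_moment_def by (intro Bochner_Integration.integral_nonneg) (simp add: trunc_nonneg)

lemma trunc_moment_0: "trunc_moment t 0 = 1"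
  unfolding trunc_moment_def using prob_space.prob_space[OF prob_space_std_normal] by simp

lemma mult_trunc_power: "x * trunc t x ^ Suc n = trunc t x ^ Suc (Suc n) - t * trunc t x ^ Suc n"
proof (cases "0 \<le> x + t")
  case True
  then have "x = trunc t x - t" by (simp add: trunc_def)
  then have "x * trunc t x ^ Suc n = (trunc t x - t) * trunc t x ^ Suc n" by simp
  then show ?thesis by (simp add: left_diff_distrib)
next
  case False
  then show ?thesis by (simp add: trunc_def)
qed

lemma integral_mult_trunc_power:
  "(LINT x|std_normal. x * trunc t x ^ Suc n) = trunc_moment t (Suc (Suc n)) - t * trunc_moment t (Suc n)"
  unfolding mult_trunc_power trunc_moment_def
  by (subst Bochner_Integration.integral_diff) (auto intro: integrable_trunc_power simp del: power_Suc)

text \<open>Stein's identity for the power \<open>n + 1\<close>, with \<open>x\<close> equal to the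
  truncation minus \<open>t\<close> wherever the truncation is positive. The power must be at least
  two, as the truncation itself has a kink.\<close>

lemma trunc_moment_rec:
  assumes "0 < n"
  shows "trunc_moment t (n + 2) = real (n + 1) * trunc_moment t n + t * trunc_moment t (n + 1)"
proof -
  have "(LINT x|std_normal. x * trunc t x ^ Suc n) = (LINT x|std_normal. real (Suc n) * trunc t x ^ n)"
  proof (rule std_normal_stein[OF trunc_power_deriv[OF assms],
        where C = "real (Suc n) * exp (real (Suc n) * \<bar>t\<bar>)" and s = "real (Suc n)"])
    fix x
    have le: "exp (real j * \<bar>t\<bar>) * exp (real j * \<bar>x\<bar>) \<le> exp (real (Suc n) * \<bar>t\<bar>) * exp (real (Suc n) * \<bar>x\<bar>)"
      if "j \<le> Suc n" for j
      using that by (intro mult_mono, unfold exp_le_cancel_iff) (auto intro!: mult_right_mono simp del: of_nat_Suc)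
    have "trunc t x ^ Suc n \<le> 1 * (exp (real (Suc n) * \<bar>t\<bar>) * exp (real (Suc n) * \<bar>x\<bar>))"
      using trunc_power_le[of t x "Suc n"] by simp
    also have "\<dots> \<le> real (Suc n) * (exp (real (Suc n) * \<bar>t\<bar>) * exp (real (Suc n) * \<bar>x\<bar>))"
      by (intro mult_right_mono) auto
    finally show "\<bar>trunc t x ^ Suc n\<bar> \<le> real (Suc n) * exp (real (Suc n) * \<bar>t\<bar>) * exp (real (Suc n) * \<bar>x\<bar>)"
      unfolding mult.assoc by (simp only: abs_of_nonneg zero_le_power trunc_nonneg)
    have "real (Suc n) * trunc t x ^ n \<le> real (Suc n) * (exp (real (Suc n) * \<bar>t\<bar>) * exp (real (Suc n) * \<bar>x\<bar>))"
      using order_trans[OF trunc_power_le[of t x n] le[of n]] by (intro mult_left_mono) auto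
    then show "\<bar>real (Suc n) * trunc t x ^ n\<bar> \<le> real (Suc n) * exp (real (Suc n) * \<bar>t\<bar>) * exp (real (Suc n) * \<bar>x\<bar>)"
      unfolding mult.assoc by (simp only: abs_of_nonneg zero_le_power trunc_nonneg of_nat_0_le_iff mult_nonneg_nonneg)
  qed auto
  then show ?thesis
    unfolding integral_mult_trunc_power by (simp add: trunc_moment_def)
qed

text \<open>Three consecutive instances of \<open>trunc_moment_rec\<close> eliminate the odd
  moments. The lowest instance has index \<open>2 * (p - 1)\<close>, which must be positive; hence
  \<open>2 \<le> p\<close>.\<close>

lemma trunc_moment_even_rec:
  assumes "2 \<le> p"
  shows "trunc_moment t (2 * (p + 1)) = (4 * real p + 1 + t\<^sup>2) * trunc_moment t (2 * p) - 2 * real p * (2 * real p - 1) * trunc_moment t (2 * (p - 1))"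
proof -
  obtain q where p: "p = Suc (Suc q)" using assms by (metis add_2_eq_Suc le_Suc_ex)
  have 1: "trunc_moment t (2 * (p + 1)) = real (2 * p + 1) * trunc_moment t (2 * p) + t * trunc_moment t (2 * p + 1)"
    using trunc_moment_rec[of "2 * p" t] p by simp
  have 2: "trunc_moment t (2 * p + 1) = real (2 * p) * trunc_moment t (2 * p - 1) + t * trunc_moment t (2 * p)"
    using trunc_moment_rec[of "2 * p - 1" t] p by simp
  have 3: "trunc_moment t (2 * p) = real (2 * p - 1) * trunc_moment t (2 * (p - 1)) + t * trunc_moment t (2 * p - 1)"
    using trunc_moment_rec[of "2 * (p - 1)" t] p by simp
  have "real (2 * p - 1) = 2 * real p - 1" using p by simp
  with 3 have 3: "t * trunc_moment t (2 * p - 1) = trunc_moment t (2 * p) - (2 * real p - 1) * trunc_moment t (2 * (p - 1))" by simp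
  have "t * trunc_moment t (2 * p + 1) = 2 * real p * (t * trunc_moment t (2 * p - 1)) + t\<^sup>2 * trunc_moment t (2 * p)"
    unfolding 2 by (simp add: power2_eq_square algebra_simps)
  then show ?thesis unfolding 1 3 by (simp add: algebra_simps)
qed

lemma integral_std_normal_reflect:
  fixes f :: "real \<Rightarrow> real"
  assumes [measurable]: "f \<in> borel_measurable borel"
  shows "(LINT x|std_normal. f (- x)) = (LINT x|std_normal. f x)"
proof -
  have "(LINT x|lborel. std_normal_density x * f x) = (LINT x|lborel. std_normal_density (- x) * f (- x))"
    using lborel_integral_real_affine[of "- 1" "\<lambda>x. std_normal_density x * f x" 0] by simp
  moreover have "std_normal_density (- x) = std_normal_density x" for x
    by (simp add: std_normal_density_def)
  ultimately have "(LINT x|lborel. std_normal_density x * f x) = (LINT x|lborel. std_normal_density x * f (- x))"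
    by (simp only:)
  then show ?thesis
    by (subst (1 2) integral_std_normal_eq) auto
qed

lemma integrable_std_normal_power: "integrable std_normal (\<lambda>x. x ^ n)"
  by (subst integrable_std_normal_iff) (auto intro: integrable_std_normal_moment)

lemma integral_std_normal_square: "(LINT x|std_normal. x\<^sup>2) = 1"
  using integral_std_normal_moment_even[of 1] by (simp add: integral_std_normal_eq)

lemma integral_std_normal_fourth: "(LINT x|std_normal. x ^ 4) = 3"
  using integral_std_normal_moment_even[of 2] by (simp add: integral_std_normal_eq fact_numeral)

lemma integral_std_normal_id: "(LINT x|std_normal. x) = 0"
  using integral_std_normal_moment_odd[of 0] by (simp add: integral_std_normal_eq)

text \<open>\<open>trunc (- t) (- x)\<close> is the negative part of \<open>x + t\<close>, so the
  two squares add up to \<open>(x + t)\<^sup>2\<close>.\<close>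

lemma trunc_moment_2_add: "trunc_moment t 2 + trunc_moment (- t) 2 = 1 + t\<^sup>2"
proof -
  have "trunc_moment (- t) 2 = (LINT x|std_normal. trunc (- t) (- x) ^ 2)"
    unfolding trunc_moment_def by (rule integral_std_normal_reflect[symmetric]) simp
  moreover have i: "integrable std_normal (\<lambda>x. trunc (- t) (- x) ^ 2)"
    by (rule integrable_trunc_power_reflect)
  ultimately have "trunc_moment t 2 + trunc_moment (- t) 2 = (LINT x|std_normal. trunc t x ^ 2 + trunc (- t) (- x) ^ 2)"
    unfolding trunc_moment_def by (subst Bochner_Integration.integral_add) (auto intro: integrable_trunc_power)
  also have "\<dots> = (LINT x|std_normal. x\<^sup>2 + 2 * t * x + t\<^sup>2)"
    by (intro Bochner_Integration.integral_cong) (auto simp: trunc_def max_def power2_eq_square algebra_simps)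
  also have "\<dots> = (LINT x|std_normal. x\<^sup>2) + 2 * t * (LINT x|std_normal. x) + t\<^sup>2"
  proof -
    have 1: "integrable std_normal (\<lambda>x. x\<^sup>2)" and 2: "integrable std_normal (\<lambda>x. 2 * t * x)"
      using integrable_std_normal_power[of 2] integrable_std_normal_power[of 1] by auto
    have 3: "integrable std_normal (\<lambda>x. t\<^sup>2)" and "(LINT x|std_normal. t\<^sup>2) = t\<^sup>2"
      using finite_measure.integrable_const[OF prob_space.axioms(1)[OF prob_space_std_normal]]
        prob_space.prob_space[OF prob_space_std_normal] by simp_all
    then show ?thesis
      by (simp only: Bochner_Integration.integral_add[OF Bochner_Integration.integrable_add[OF 1 2] 3]
          Bochner_Integration.integral_add[OF 1 2] integral_mult_right_zero)
  qed
  finally show ?thesis by (simp add: integral_std_normal_square integral_std_normal_id)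
qed

text \<open>Adding the reflected tail turns the integrand into one in \<open>\<bar>x\<bar>\<close>.
  There AM-GM, \<open>t * (y - t) \<le> y\<^sup>2 / 4\<close>, leaves only the second and fourth
  moments, \<open>1 + 3 / 16\<close> in total, which is below the required \<open>2\<close>.\<close>

lemma trunc_moment_neg_small:
  assumes "0 \<le> t"
  shows "(1 + t\<^sup>2) * trunc_moment (- t) 2 \<le> 1"
proof -
  have r: "trunc_moment (- t) 2 = (LINT x|std_normal. trunc (- t) (- x) ^ 2)"
    unfolding trunc_moment_def by (rule integral_std_normal_reflect[symmetric]) simp
  have i: "integrable std_normal (\<lambda>x. trunc (- t) (- x) ^ 2)"
    by (rule integrable_trunc_power_reflect)
  have "2 * ((1 + t\<^sup>2) * trunc_moment (- t) 2) = (1 + t\<^sup>2) * (trunc_moment (- t) 2 + trunc_moment (- t) 2)" by simp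
  also have "\<dots> = (LINT x|std_normal. (1 + t\<^sup>2) * (trunc (- t) x ^ 2 + trunc (- t) (- x) ^ 2))"
    using i integrable_trunc_power[of "- t" 2] by (simp add: trunc_moment_def[symmetric] r[symmetric])
  also have "\<dots> \<le> (LINT x|std_normal. x\<^sup>2 + x ^ 4 / 16)"
  proof (rule integral_mono)
    fix x :: real
    have main: "(1 + t\<^sup>2) * (y - t)\<^sup>2 \<le> y\<^sup>2 + y ^ 4 / 16" if "t < y" for y
    proof -
      have "(y - t)\<^sup>2 \<le> y\<^sup>2" using that assms by (intro power_mono) auto
      moreover have "(t * (y - t))\<^sup>2 \<le> (y\<^sup>2 / 4)\<^sup>2"
      proof (rule power_mono)
        show "t * (y - t) \<le> y\<^sup>2 / 4"
          using zero_le_power2[of "y - 2 * t"] by (simp add: power2_eq_square field_simps)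
      qed (use that assms in auto)
      moreover have "(y\<^sup>2 / 4)\<^sup>2 = y ^ 4 / 16" by (simp add: power_divide)
      moreover have "(1 + t\<^sup>2) * (y - t)\<^sup>2 = (y - t)\<^sup>2 + (t * (y - t))\<^sup>2"
        by (simp only: power_mult_distrib distrib_right mult_1)
      ultimately show ?thesis by linarith
    qed
    have z: "0 \<le> x\<^sup>2 + x ^ 4 / 16" by simp
    show "(1 + t\<^sup>2) * (trunc (- t) x ^ 2 + trunc (- t) (- x) ^ 2) \<le> x\<^sup>2 + x ^ 4 / 16"
    proof -
      consider "t < x" | "t < - x" | "x \<le> t" "- x \<le> t" by linarith
      then show ?thesis
      proof cases
        case 1
        then show ?thesis using main[of x] assms by (simp add: trunc_def)
      next
        case 2
        then show ?thesis using main[of "- x"] assms by (simp add: trunc_def)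
      next
        case 3
        then show ?thesis using z by (simp add: trunc_def)
      qed
    qed
  qed (use i integrable_trunc_power[of "- t" 2] integrable_std_normal_power[of 2] integrable_std_normal_power[of 4] in auto)
  also have "\<dots> = 1 + 3 / 16"
    using integrable_std_normal_power[of 2] integrable_std_normal_power[of 4]
    by (simp add: integral_std_normal_square integral_std_normal_fourth)
  finally show ?thesis by simp
qed

text \<open>By Stein's relation the claim says that \<open>x\<close> times the truncation has mean
  at least \<open>1 / 2\<close>. Symmetrization shows this: for \<open>t \<ge> 0\<close> the
  truncation increases from \<open>- x\<close> to \<open>x\<close> by at least \<open>x\<close> when
  \<open>x \<ge> 0\<close>. It supplies the first moment, which the recursion does not
  reach.\<close>

lemma mult_trunc_moment_1_le:
  assumes "0 \<le> t"
  shows "t * trunc_moment t 1 \<le> trunc_moment t 2 - 1 / 2"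
proof -
  have i1: "integrable std_normal (\<lambda>x. x * trunc t x)"
    using integrable_mult_trunc_power[of t 1] by simp
  have i2: "integrable std_normal (\<lambda>x. x * trunc t (- x))"
  proof (rule integrable_std_normal_bound[where C = "exp \<bar>t\<bar>" and s = 2])
    fix x
    have "\<bar>x * trunc t (- x)\<bar> \<le> exp \<bar>x\<bar> * (exp \<bar>t\<bar> * exp \<bar>x\<bar>)"
      unfolding abs_mult using trunc_power_le[of t "- x" 1] by (intro mult_mono abs_le_exp) (auto simp: trunc_nonneg)
    then show "\<bar>x * trunc t (- x)\<bar> \<le> exp \<bar>t\<bar> * exp (2 * \<bar>x\<bar>)" by (simp add: exp_add[symmetric] algebra_simps)
  qed simp
  have r: "(LINT x|std_normal. x * trunc t x) = (LINT x|std_normal. (- x) * trunc t (- x))"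
    by (rule integral_std_normal_reflect[symmetric]) simp
  have "1 = (LINT x|std_normal. x\<^sup>2)" by (simp add: integral_std_normal_square)
  also have "\<dots> \<le> (LINT x|std_normal. x * trunc t x - x * trunc t (- x))"
  proof (rule integral_mono)
    fix x :: real
    have sq: "x\<^sup>2 \<le> x * (trunc t x - trunc t (- x))"
    proof (cases "0 \<le> x")
      case True
      then have "x \<le> trunc t x - trunc t (- x)" using assms by (auto simp: trunc_def)
      then show ?thesis using True by (simp add: power2_eq_square mult_left_mono)
    next
      case False
      then have "trunc t x - trunc t (- x) \<le> x" using assms by (auto simp: trunc_def)
      then show ?thesis using False by (simp add: power2_eq_square mult_left_mono_neg)
    qed
    then show "x\<^sup>2 \<le> x * trunc t x - x * trunc t (- x)" by (simp add: right_diff_distrib)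
  qed (use i1 i2 integrable_std_normal_power[of 2] in auto)
  also have "\<dots> = 2 * (LINT x|std_normal. x * trunc t x)"
    using i1 i2 r by simp
  finally have "1 / 2 \<le> (LINT x|std_normal. x * trunc t x)" by simp
  then show ?thesis
    using integral_mult_trunc_power[of t 0] by (simp add: numeral_2_eq_2)
qed

text \<open>
  The ratios \<open>4 p + a\<close> are those of the coefficients of \<open>(1 - 4 \<mu>) powr (- a/4)\<close> as an exponential generating
  function in \<open>\<mu>\<close>.
\<close>

lemma trunc_moment_even_step: "trunc_moment t (2 * (p + 1)) \<le> (4 * real p + trunc_moment t 2) * trunc_moment t (2 * p)"
proof (induction p)
  case 0
  then show ?case by (simp add: trunc_moment_0)
next
  case (Suc p)
  define a where "a = trunc_moment t 2"
  define b where "b = trunc_moment (- t) 2"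
  have a0: "0 \<le> a" and b0: "0 \<le> b" by (auto simp: a_def b_def trunc_moment_nonneg)
  have ab: "a + b = 1 + t\<^sup>2" by (simp add: a_def b_def trunc_moment_2_add)
  show ?case
  proof (cases "t \<le> 0")
    case True
    have "trunc_moment t (2 * Suc p + 2) = real (2 * Suc p + 1) * trunc_moment t (2 * Suc p) + t * trunc_moment t (2 * Suc p + 1)"
      by (rule trunc_moment_rec) simp
    also have "t * trunc_moment t (2 * Suc p + 1) \<le> 0"
      using True trunc_moment_nonneg by (rule mult_nonpos_nonneg)
    also have "real (2 * Suc p + 1) * trunc_moment t (2 * Suc p) + 0 \<le> (4 * real (Suc p) + a) * trunc_moment t (2 * Suc p)"
      using a0 by (simp only: add_0_right, intro mult_right_mono trunc_moment_nonneg) simp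
    finally show ?thesis by (simp add: a_def)
  next
    case False
    then have t: "0 \<le> t" by simp
    have "b \<le> (1 + t\<^sup>2) * b" using b0 by (simp add: algebra_simps)
    then have b1: "b \<le> 1" using trunc_moment_neg_small[OF t] by (simp add: b_def)
    \<comment> \<open>\<open>a + b = 1 + t\<^sup>2\<close> gives
      \<open>a \<le> 1 + t\<^sup>2\<close>, so the bound on \<open>(1 + t\<^sup>2) * b\<close> also
      controls the mixed product.\<close>
    have "b * a \<le> b * (1 + t\<^sup>2)" using ab b0 by (intro mult_left_mono) auto
    then have ba: "b * a \<le> 1" using trunc_moment_neg_small[OF t] by (simp add: b_def mult.commute)
    show ?thesis
    proof (cases "p = 0")
      case True
      \<comment> \<open>The recursion for even moments starts later; here the odd moments are
        resolved by hand and end in the first moment.\<close>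
      have 4: "trunc_moment t 4 = 3 * a + t * trunc_moment t 3" and 3: "trunc_moment t 3 = 2 * trunc_moment t 1 + t * a"
        using trunc_moment_rec[of 2 t] trunc_moment_rec[of 1 t] by (simp_all add: a_def eval_nat_numeral)
      have "trunc_moment t 4 = 3 * a + 2 * (t * trunc_moment t 1) + t\<^sup>2 * a"
        unfolding 4 3 by (simp add: power2_eq_square algebra_simps)
      also have "\<dots> \<le> 3 * a + 2 * (a - 1 / 2) + (a + b - 1) * a"
        using mult_trunc_moment_1_le[OF t] ab by (intro add_mono mult_left_mono mult_right_mono) (auto simp: a_def[symmetric] a0)
      also have "\<dots> \<le> (4 + a) * a"
        using ba by (simp add: algebra_simps)
      finally show ?thesis using True by (simp add: a_def)
    next
      case False
      define j where "j = trunc_moment t (2 * p)"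
      define J where "J = trunc_moment t (2 * Suc p)"
      have j: "0 \<le> j" "0 \<le> J" by (simp_all add: j_def J_def trunc_moment_nonneg)
      have IH: "J \<le> (4 * real p + a) * j" using Suc by (simp add: J_def j_def a_def)
      have rec: "trunc_moment t (2 * (Suc p + 1)) = (4 * real (Suc p) + a + b) * J - 2 * real (Suc p) * (2 * real (Suc p) - 1) * j"
      proof -
        have "trunc_moment t (2 * (Suc p + 1)) = (4 * real (Suc p) + 1 + t\<^sup>2) * J - 2 * real (Suc p) * (2 * real (Suc p) - 1) * j"
          using trunc_moment_even_rec[of "Suc p" t] False by (simp add: J_def j_def)
        moreover have "4 * real (Suc p) + 1 + t\<^sup>2 = 4 * real (Suc p) + a + b" using ab by simp
        ultimately show ?thesis by (simp only:)
      qed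
      \<comment> \<open>By \<open>rec\<close> it is enough to absorb \<open>b * J\<close> in the
        negative term. The induction hypothesis with \<open>b \<le> 1\<close> and
        \<open>b * a \<le> 1\<close> gives at most \<open>(4 p + 1) * j\<close>, against
        \<open>2 (p + 1) (2 p + 1) * j\<close>.\<close>
      have "b * J \<le> b * ((4 * real p + a) * j)" using IH b0 by (rule mult_left_mono)
      also have "\<dots> = (4 * real p * b + b * a) * j" by (simp add: algebra_simps)
      also have "\<dots> \<le> (4 * real p * 1 + 1) * j"
        using b1 ba j by (intro mult_right_mono add_mono mult_left_mono) auto
      also have "\<dots> \<le> (2 * real (Suc p) * (2 * real (Suc p) - 1)) * j"
        using j by (intro mult_right_mono) (auto simp: algebra_simps)
      finally have "b * J \<le> 2 * real (Suc p) * (2 * real (Suc p) - 1) * j" .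
      then show ?thesis unfolding rec by (simp add: J_def a_def distrib_right)
    qed
  qed
qed

lemma trunc_moment_even_le: "trunc_moment t (2 * p) \<le> (\<Prod>i<p. 4 * real i + trunc_moment t 2)"
proof (induction p)
  case (Suc p)
  have "trunc_moment t (2 * Suc p) \<le> (4 * real p + trunc_moment t 2) * trunc_moment t (2 * p)"
    using trunc_moment_even_step[of t p] by simp
  also have "\<dots> \<le> (4 * real p + trunc_moment t 2) * (\<Prod>i<p. 4 * real i + trunc_moment t 2)"
    using Suc trunc_moment_nonneg[of t 2] by (intro mult_left_mono) auto
  finally show ?case by (simp add: mult.commute)
qed (simp add: trunc_moment_0)

text \<open>The exponential series is integrated term by term and compared with the binomial series,
  whose radius of convergence is \<open>\<mu> = 1 / 4\<close>.\<close>

lemma nn_integral_exp_trunc_sq: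
  assumes \<mu>: "0 \<le> \<mu>" "\<mu> < 1 / 4"
  shows "(\<integral>\<^sup>+x. ennreal (exp (\<mu> * (trunc t x)\<^sup>2)) \<partial>std_normal) \<le> ennreal ((1 - 4 * \<mu>) powr (- trunc_moment t 2 / 4))"
proof -
  define a where "a = trunc_moment t 2"
  define g where "g = (\<lambda>p. \<mu> ^ p / fact p * (\<Prod>i<p. 4 * real i + a))"
  have a: "0 \<le> a" by (simp add: a_def trunc_moment_nonneg)
  have "(\<lambda>p. ((- a / 4) gchoose p) * (- 4 * \<mu>) ^ p) sums (1 + (- 4 * \<mu>)) powr (- a / 4)"
    by (rule gen_binomial_real) (use \<mu> in auto)
  moreover have "((- a / 4) gchoose p) * (- 4 * \<mu>) ^ p = g p" for p
  proof -
    have "(\<Prod>i<p. - a / 4 - real i) * (- 4) ^ p = (\<Prod>i<p. (- a / 4 - real i) * (- 4))"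
      by (simp only: prod.distrib prod_constant card_lessThan)
    also have "\<dots> = (\<Prod>i<p. 4 * real i + a)"
      by (intro prod.cong) auto
    finally have "(\<Prod>i<p. - a / 4 - real i) * (- 4) ^ p = (\<Prod>i<p. 4 * real i + a)" .
    moreover have "((- a / 4) gchoose p) * (- 4 * \<mu>) ^ p = \<mu> ^ p / fact p * ((\<Prod>i<p. - a / 4 - real i) * (- 4) ^ p)"
      by (simp only: gbinomial_prod_rev atLeast0LessThan power_mult_distrib) simp
    ultimately show ?thesis by (simp add: g_def)
  qed
  ultimately have g: "g sums (1 - 4 * \<mu>) powr (- a / 4)" by simp
  have g0: "0 \<le> g p" for p unfolding g_def using \<mu> a by (intro mult_nonneg_nonneg prod_nonneg) auto
  have e: "ennreal (exp (\<mu> * (trunc t x)\<^sup>2)) = (\<Sum>p. ennreal (\<mu> ^ p / fact p * trunc t x ^ (2 * p)))" for x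
  proof -
    have "(\<lambda>p. (\<mu> * (trunc t x)\<^sup>2) ^ p /\<^sub>R fact p) sums exp (\<mu> * (trunc t x)\<^sup>2)"
      by (rule exp_converges)
    moreover have "(\<mu> * (trunc t x)\<^sup>2) ^ p /\<^sub>R fact p = \<mu> ^ p / fact p * trunc t x ^ (2 * p)" for p
      by (simp add: power_mult_distrib power_mult[symmetric] divide_inverse mult_ac)
    ultimately have s: "(\<lambda>p. \<mu> ^ p / fact p * trunc t x ^ (2 * p)) sums exp (\<mu> * (trunc t x)\<^sup>2)" by simp
    show ?thesis
      unfolding sums_unique[OF s]
      by (rule suminf_ennreal2[symmetric, OF _ sums_summable[OF s]]) (use \<mu> in \<open>simp add: trunc_nonneg\<close>)
  qed
  have "(\<integral>\<^sup>+x. ennreal (exp (\<mu> * (trunc t x)\<^sup>2)) \<partial>std_normal) = (\<Sum>p. \<integral>\<^sup>+x. ennreal (\<mu> ^ p / fact p * trunc t x ^ (2 * p)) \<partial>std_normal)"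
    unfolding e by (rule nn_integral_suminf) simp
  also have "\<dots> = (\<Sum>p. ennreal (\<mu> ^ p / fact p * trunc_moment t (2 * p)))"
    using \<mu> by (intro suminf_cong, subst nn_integral_eq_integral)
       (auto intro!: integrable_mult_right integrable_trunc_power simp: trunc_moment_def trunc_nonneg)
  also have "\<dots> \<le> (\<Sum>p. ennreal (g p))"
    unfolding g_def a_def using \<mu> by (intro suminf_le ennreal_leI mult_left_mono trunc_moment_even_le) auto
  also have "\<dots> = ennreal ((1 - 4 * \<mu>) powr (- a / 4))"
    using g0 by (subst suminf_ennreal2[OF _ sums_summable[OF g]]) (auto simp: sums_unique[OF g, symmetric])
  finally show ?thesis by (simp add: a_def)
qed

section \<open>Kernels of Gaussian matrices and sign cones\<close>

lemma nn_integral_std_normal_reflect: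
  assumes [measurable]: "f \<in> borel_measurable borel"
  shows "(\<integral>\<^sup>+x. f (- x) \<partial>std_normal) = (\<integral>\<^sup>+x. f x \<partial>std_normal)"
proof -
  have "(\<integral>\<^sup>+x. ennreal (std_normal_density x) * f x \<partial>lborel) = (\<integral>\<^sup>+x. ennreal (std_normal_density (- x)) * f (- x) \<partial>lborel)"
    using nn_integral_real_affine[of "\<lambda>x. ennreal (std_normal_density x) * f x" "- 1" 0] by simp
  moreover have "std_normal_density (- x) = std_normal_density x" for x
    by (simp add: std_normal_density_def)
  ultimately have "(\<integral>\<^sup>+x. ennreal (std_normal_density x) * f x \<partial>lborel) = (\<integral>\<^sup>+x. ennreal (std_normal_density x) * f (- x) \<partial>lborel)"
    by (simp only:)
  then show ?thesis
    by (subst (1 2) nn_integral_density) auto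
qed

text \<open>For \<open>P \<subseteq> {..<N}\<close>: the unit vectors \<open>h\<close> such that
  moving from \<open>indicator P\<close> along \<open>- h\<close> stays in the unit box and does not
  increase the coordinate sum.\<close>

definition sign_cone :: "nat \<Rightarrow> nat set \<Rightarrow> (nat \<Rightarrow> real) set" where
  "sign_cone N P = {h. (\<forall>i\<ge>N. h i = 0) \<and> (\<forall>i<N. if i \<in> P then 0 \<le> h i else h i \<le> 0) \<and>
     0 \<le> (\<Sum>i<N. h i) \<and> (\<Sum>i<N. (h i)\<^sup>2) = 1}"

text \<open>Weak duality: \<open>\<tau>\<close> is a Lagrange multiplier for the constraint
  \<open>0 \<le> (\<Sum>i<N. h i)\<close>. The sign conditions then allow each
  \<open>\<tau> - x i\<close> to be replaced by its helpful part, and Cauchy-Schwarz finishes. This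
  multiplier is the \<open>\<tau>\<close> over which \<open>Delta_bin\<close> takes its
  infimum.\<close>

lemma sign_cone_support:
  assumes h: "h \<in> sign_cone N P" and \<tau>: "0 \<le> \<tau>"
  shows "- (\<Sum>i<N. x i * h i) \<le> sqrt (\<Sum>i<N. (if i \<in> P then trunc \<tau> (- x i) else trunc (- \<tau>) (x i))\<^sup>2)"
proof -
  let ?f = "\<lambda>i. if i \<in> P then trunc \<tau> (- x i) else trunc (- \<tau>) (x i)"
  have "- (\<Sum>i<N. x i * h i) \<le> - (\<Sum>i<N. x i * h i) + \<tau> * (\<Sum>i<N. h i)"
    using h \<tau> by (simp add: sign_cone_def)
  also have "\<dots> = (\<Sum>i<N. (\<tau> - x i) * h i)"
    by (simp add: sum_distrib_left sum_subtractf left_diff_distrib)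
  also have "\<dots> \<le> (\<Sum>i<N. \<bar>?f i\<bar> * \<bar>h i\<bar>)"
  proof (rule sum_mono)
    fix i assume "i \<in> {..<N}"
    then have i: "if i \<in> P then 0 \<le> h i else h i \<le> 0" using h by (auto simp: sign_cone_def)
    show "(\<tau> - x i) * h i \<le> \<bar>?f i\<bar> * \<bar>h i\<bar>"
    proof (cases "i \<in> P")
      case True
      then have "(\<tau> - x i) * h i \<le> trunc \<tau> (- x i) * h i"
        using i by (intro mult_right_mono) (auto simp: trunc_def)
      then show ?thesis using True i by (simp add: trunc_nonneg)
    next
      case False
      then have "(x i - \<tau>) * (- h i) \<le> trunc (- \<tau>) (x i) * (- h i)"
        using i by (intro mult_right_mono) (auto simp: trunc_def)
      moreover have "(x i - \<tau>) * (- h i) = (\<tau> - x i) * h i" by (simp add: algebra_simps)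
      ultimately show ?thesis using False i by (simp add: trunc_nonneg)
    qed
  qed
  also have "\<dots> \<le> L2_set ?f {..<N} * L2_set h {..<N}"
    by (rule L2_set_mult_ineq)
  also have "L2_set h {..<N} = 1" using h by (simp add: L2_set_def sign_cone_def)
  finally show ?thesis by (simp add: L2_set_def)
qed

lemma ennreal_le_exp_cancel:
  fixes X :: ennreal
  assumes "X * ennreal (exp r) \<le> ennreal (b * exp r)" "0 \<le> b"
  shows "X \<le> ennreal b"
proof -
  have "X * ennreal (exp r) * ennreal (exp (- r)) \<le> ennreal (b * exp r) * ennreal (exp (- r))"
    using assms(1) by (rule mult_right_mono) simp
  moreover have "ennreal (b * exp r) * ennreal (exp (- r)) = ennreal b"
    using assms(2) by (simp add: ennreal_mult[symmetric] exp_minus)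
  moreover have "X * ennreal (exp r) * ennreal (exp (- r)) = X"
  proof -
    have "ennreal (exp r) * ennreal (exp (- r)) = 1"
      by (simp add: ennreal_mult[symmetric] exp_minus)
    then show ?thesis by (simp add: mult.assoc)
  qed
  ultimately show ?thesis by simp
qed

lemma prod_ennreal_powr:
  fixes b :: real and n :: nat
  assumes "0 < b"
  shows "(\<Prod>i<n. ennreal (b powr f i)) = ennreal (b powr (\<Sum>i<n. f i))"
  using assms by (induction n) (simp_all add: powr_add ennreal_mult)

text \<open>The square root in the support function is linearized by AM-GM at \<open>sqrt m\<close>, hence \<open>s = 2 \<mu> sqrt m\<close>.\<close>

lemma kernel_meets_sign_cone_le:
  fixes m N :: nat and P :: "nat set"
  assumes m: "0 < m" and \<mu>: "0 < \<mu>" "\<mu> < 1 / 4" and \<tau>: "0 \<le> \<tau>"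
  defines "\<delta> \<equiv> \<Sum>i<N. if i \<in> P then trunc_moment \<tau> 2 else trunc_moment (- \<tau>) 2"
  shows "emeasure (gauss_mat m N) (kernel_meets m N (sign_cone N P))
     \<le> ennreal ((1 + sqrt pi) * exp (- \<mu> * real m) * (1 - 4 * \<mu>) powr (- \<delta> / 4))"
proof -
  define s where "s = 2 * \<mu> * sqrt m"
  define f where "f = (\<lambda>i x. if i \<in> P then trunc \<tau> (- x) else trunc (- \<tau>) x)"
  define u where "u = (\<lambda>i x. exp (\<mu> * (f i x)\<^sup>2))"
  have s: "0 < s" "s * sqrt m = 2 * (\<mu> * m)" using m \<mu> by (simp_all add: s_def)
  have um: "u i \<in> borel_measurable borel" for i
    unfolding u_def f_def by (cases "i \<in> P") (simp_all)
  have bd: "exp (- s * (\<Sum>i<N. x i * h i)) \<le> exp (\<mu> * m) * (\<Prod>i<N. u i (x i))"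
    if "h \<in> sign_cone N P" for h x
  proof -
    define Q where "Q = (\<Sum>i<N. (f i (x i))\<^sup>2)"
    have Q: "0 \<le> Q" unfolding Q_def by (intro sum_nonneg) auto
    have "s * - (\<Sum>i<N. x i * h i) \<le> s * sqrt Q"
      using sign_cone_support[OF that \<tau>, of x] s(1) unfolding Q_def f_def by (intro mult_left_mono) auto
    also have "\<dots> = \<mu> * (2 * sqrt m * sqrt Q)" by (simp add: s_def)
    also have "\<dots> \<le> \<mu> * ((sqrt m)\<^sup>2 + (sqrt Q)\<^sup>2)"
      using \<mu> by (intro mult_left_mono sum_squares_bound) auto
    also have "\<dots> = \<mu> * m + \<mu> * Q" using Q by (simp add: distrib_left)
    finally have "exp (- s * (\<Sum>i<N. x i * h i)) \<le> exp (\<mu> * m + \<mu> * Q)" by simp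
    also have "\<dots> = exp (\<mu> * m) * (\<Prod>i<N. u i (x i))"
      by (simp add: u_def Q_def exp_add exp_sum[symmetric] sum_distrib_left)
    finally show ?thesis .
  qed
  have iu: "(\<integral>\<^sup>+x. ennreal (u i x) \<partial>std_normal) \<le> ennreal ((1 - 4 * \<mu>) powr (- (if i \<in> P then trunc_moment \<tau> 2 else trunc_moment (- \<tau>) 2) / 4))" for i
  proof (cases "i \<in> P")
    case True
    have "(\<integral>\<^sup>+x. ennreal (exp (\<mu> * (trunc \<tau> (- x))\<^sup>2)) \<partial>std_normal) = (\<integral>\<^sup>+x. ennreal (exp (\<mu> * (trunc \<tau> x)\<^sup>2)) \<partial>std_normal)"
      by (rule nn_integral_std_normal_reflect[of "\<lambda>x. ennreal (exp (\<mu> * (trunc \<tau> x)\<^sup>2))"]) measurable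
    then show ?thesis
      using True nn_integral_exp_trunc_sq[of \<mu> \<tau>] \<mu> by (simp add: u_def f_def)
  next
    case False
    then show ?thesis using nn_integral_exp_trunc_sq[of \<mu> "- \<tau>"] \<mu> by (simp add: u_def f_def)
  qed
  let ?p = "(1 - 4 * \<mu>) powr (- \<delta> / 4)"
  have pu: "(\<Prod>i<N. \<integral>\<^sup>+x. ennreal (u i x) \<partial>std_normal) \<le> ennreal ?p"
  proof -
    have "(\<Prod>i<N. \<integral>\<^sup>+x. ennreal (u i x) \<partial>std_normal) \<le>
       (\<Prod>i<N. ennreal ((1 - 4 * \<mu>) powr (- (if i \<in> P then trunc_moment \<tau> 2 else trunc_moment (- \<tau>) 2) / 4)))"
      by (intro prod_mono_ennreal iu)
    also have "\<dots> = ennreal ?p"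
      using \<mu> by (subst prod_ennreal_powr) (simp_all add: \<delta>_def sum_negf sum_divide_distrib)
    finally show ?thesis .
  qed
  have chi: "chi_laplace ({..<m} \<times> {N}) s \<le> ennreal ((1 + sqrt pi) * exp (- s * sqrt m + s\<^sup>2 / 2))"
    using chi_laplace_le_exp[of "{..<m} \<times> {N}" s] m s by (simp add: card_cartesian_product lessThan_empty_iff)
  have "emeasure (gauss_mat m N) (kernel_meets m N (sign_cone N P)) * ennreal (exp (s\<^sup>2 / 2))
     \<le> ennreal (exp (\<mu> * m)) * chi_laplace ({..<m} \<times> {N}) s * (\<Prod>i<N. \<integral>\<^sup>+x. ennreal (u i x) \<partial>std_normal)"
    by (rule escape_mesh[OF _ s(1) um _ _ bd]) (auto simp: sign_cone_def u_def)
  also have "\<dots> \<le> ennreal (exp (\<mu> * m)) * ennreal ((1 + sqrt pi) * exp (- s * sqrt m + s\<^sup>2 / 2)) * ennreal ?p"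
    by (intro mult_mono pu chi) auto
  also have "\<dots> = ennreal (exp (\<mu> * m) * ((1 + sqrt pi) * exp (- s * sqrt m + s\<^sup>2 / 2)) * ?p)"
    by (simp add: ennreal_mult)
  \<comment> \<open>As \<open>s * sqrt m = 2 * \<mu> * m\<close>, the exponents combine to
    \<open>- \<mu> * m\<close>; the remaining \<open>exp (s\<^sup>2 / 2)\<close> cancels against the
    one on the left.\<close>
  also have "exp (\<mu> * m) * ((1 + sqrt pi) * exp (- s * sqrt m + s\<^sup>2 / 2)) * ?p =
     ((1 + sqrt pi) * exp (- \<mu> * real m) * ?p) * exp (s\<^sup>2 / 2)"
  proof -
    define E where "E = exp (- \<mu> * real m)"
    have "- s * sqrt m + s\<^sup>2 / 2 = - \<mu> * m + - \<mu> * m + s\<^sup>2 / 2" using s(2) by simp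
    then have "exp (- s * sqrt m + s\<^sup>2 / 2) = E * E * exp (s\<^sup>2 / 2)"
      unfolding E_def by (simp only: exp_add)
    moreover have "exp (\<mu> * m) * ((1 + sqrt pi) * (E * E * exp (s\<^sup>2 / 2))) * ?p =
        (exp (\<mu> * m) * E) * (((1 + sqrt pi) * E * ?p) * exp (s\<^sup>2 / 2))"
      by (simp only: mult_ac)
    moreover have "exp (\<mu> * m) * E = 1" by (simp add: E_def exp_minus)
    ultimately show ?thesis unfolding E_def[symmetric] by simp
  qed
  finally show ?thesis by (rule ennreal_le_exp_cancel) simp
qed

lemma ennreal_eq_0_of_le_inverse:
  fixes X :: ennreal
  assumes "\<And>s::real. 1 \<le> s \<Longrightarrow> X \<le> ennreal (K / s)"
  shows "X = 0"
proof -
  have "X \<le> 0"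
  proof (rule LIMSEQ_le_const)
    have "(\<lambda>n. K / real (Suc n)) \<longlonglongrightarrow> 0"
      using LIMSEQ_Suc[OF lim_const_over_n[of K]] .
    then have "(\<lambda>n. ennreal (K / real (Suc n))) \<longlonglongrightarrow> ennreal 0" by (rule tendsto_ennrealI)
    then show "(\<lambda>n. ennreal (K / real (Suc n))) \<longlonglongrightarrow> 0" by simp
    show "\<exists>N. \<forall>n\<ge>N. X \<le> ennreal (K / real (Suc n))" by (intro exI[of _ 0] allI impI, rule assms) simp
  qed
  then show ?thesis by simp
qed

lemma chi_laplace_column_le:
  "0 < m \<Longrightarrow> 0 < s \<Longrightarrow> chi_laplace ({..<m} \<times> {N::nat}) s \<le> ennreal ((sqrt m / s) ^ m)"
  using chi_laplace_le_power[of "{..<m} \<times> {N}" s] by (simp add: card_cartesian_product lessThan_empty_iff)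

text \<open>For one fixed direction, \<open>\<langle>g, h\<rangle>\<close> is standard normal and
  its transform \<open>exp (s\<^sup>2 / 2)\<close> cancels exactly, leaving only
  \<open>chi_laplace\<close>, which tends to zero with growing \<open>s\<close>. The escape bound
  thus also excludes coincidences with other binary points.\<close>

lemma kernel_meets_singleton_null:
  assumes m: "0 < m" and h: "(\<Sum>i<N. (h i)\<^sup>2) = 1"
  shows "emeasure (gauss_mat m N) (kernel_meets m N {h}) = 0"
proof (rule ennreal_eq_0_of_le_inverse)
  fix s :: real assume s: "1 \<le> s"
  define u where "u = (\<lambda>i x. exp (- s * h i * x))"
  have um: "u i \<in> borel_measurable borel" for i unfolding u_def by simp
  have "emeasure (gauss_mat m N) (kernel_meets m N {h}) * ennreal (exp (s\<^sup>2 / 2))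
     \<le> ennreal 1 * chi_laplace ({..<m} \<times> {N}) s * (\<Prod>i<N. \<integral>\<^sup>+x. ennreal (u i x) \<partial>std_normal)"
  proof (rule escape_mesh[OF _ _ um])
    show "exp (- s * (\<Sum>i<N. x i * h' i)) \<le> 1 * (\<Prod>i<N. u i (x i))" if "h' \<in> {h}" for h' x
      using that by (simp add: u_def exp_sum[symmetric] sum_distrib_left sum_negf mult_ac)
  qed (use h s in \<open>auto simp: u_def\<close>)
  also have "(\<Prod>i<N. \<integral>\<^sup>+x. ennreal (u i x) \<partial>std_normal) = ennreal (exp (s\<^sup>2 / 2))"
  proof -
    have "(\<Prod>i<N. \<integral>\<^sup>+x. ennreal (u i x) \<partial>std_normal) = (\<Prod>i<N. ennreal (exp ((- s * h i)\<^sup>2 / 2)))"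
      unfolding u_def by (intro prod.cong refl nn_integral_std_normal_exp)
    also have "\<dots> = ennreal (exp (\<Sum>i<N. (- s * h i)\<^sup>2 / 2))"
      by (simp add: prod_ennreal exp_sum)
    also have "(\<Sum>i<N. (- s * h i)\<^sup>2 / 2) = s\<^sup>2 / 2 * (\<Sum>i<N. (h i)\<^sup>2)"
      by (simp add: sum_distrib_left power_mult_distrib)
    finally show ?thesis by (simp add: h)
  qed
  also have "ennreal 1 * chi_laplace ({..<m} \<times> {N}) s * ennreal (exp (s\<^sup>2 / 2)) \<le> ennreal ((sqrt m / s) ^ m) * ennreal (exp (s\<^sup>2 / 2))"
    unfolding ennreal_1 mult_1_left using m s by (intro mult_right_mono chi_laplace_column_le) auto
  also have "\<dots> = ennreal ((sqrt m / s) ^ m * exp (s\<^sup>2 / 2))"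
    using s by (intro ennreal_mult[symmetric]) auto
  finally have "emeasure (gauss_mat m N) (kernel_meets m N {h}) \<le> ennreal ((sqrt m / s) ^ m)"
    by (rule ennreal_le_exp_cancel) (use s in auto)
  also have "\<dots> \<le> ennreal (sqrt m ^ m / s)"
    using s m self_le_power[of s m] unfolding power_divide by (intro ennreal_leI divide_left_mono) auto
  finally show "emeasure (gauss_mat m N) (kernel_meets m N {h}) \<le> ennreal (sqrt m ^ m / s)" .
qed

text \<open>
  The linearization point \<open>q = s + 1/s\<close> makes the right-hand side exceed \<open>exp (s^2/2)\<close> only by a factor of order \<open>s^N\<close>,
  which the factor \<open>s^(-m)\<close> coming from \<open>chi_laplace\<close> beats.
\<close>

lemma kernel_meets_null_of_gt:
  assumes m: "N < m" and C: "\<And>h. h \<in> C \<Longrightarrow> (\<Sum>i<N. (h i)\<^sup>2) = 1"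
  shows "emeasure (gauss_mat m N) (kernel_meets m N C) = 0"
proof (rule ennreal_eq_0_of_le_inverse)
  fix s :: real assume s: "1 \<le> s"
  define q where "q = s + 1 / s"
  define \<mu> where "\<mu> = s / (2 * q)"
  have q: "0 < q" using s by (simp add: q_def add_pos_pos)
  have \<mu>: "0 < \<mu>" "1 - 2 * \<mu> = 1 / (1 + s\<^sup>2)"
    using s q by (auto simp: \<mu>_def q_def field_simps power2_eq_square)
  have "0 < 1 / (1 + s\<^sup>2)" by (simp add: add_pos_nonneg)
  then have \<mu>2: "\<mu> * 2 < 1" using \<mu>(2) by linarith
  have sq: "s * q = s\<^sup>2 + 1" using s by (simp add: q_def field_simps power2_eq_square)
  define u where "u = (\<lambda>(i::nat) x. exp (\<mu> * x\<^sup>2))"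
  have um: "u i \<in> borel_measurable borel" for i unfolding u_def by simp
  have ui: "(\<integral>\<^sup>+x. ennreal (u i x) \<partial>std_normal) = ennreal (sqrt (1 + s\<^sup>2))" for i
    using nn_integral_std_normal_exp_sq[of "- \<mu>"] \<mu> \<mu>2
    by (simp add: u_def real_sqrt_divide)
  let ?b = "exp (1 / 2) * (sqrt m / s) ^ m * sqrt (1 + s\<^sup>2) ^ N"
  have "emeasure (gauss_mat m N) (kernel_meets m N C) * ennreal (exp (s\<^sup>2 / 2))
     \<le> ennreal (exp (s * q / 2)) * chi_laplace ({..<m} \<times> {N}) s * (\<Prod>i<N. \<integral>\<^sup>+x. ennreal (u i x) \<partial>std_normal)"
  proof (rule escape_mesh[OF C _ um])
    fix h x :: "nat \<Rightarrow> real" assume h: "h \<in> C"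
    define Q where "Q = (\<Sum>i<N. (x i)\<^sup>2)"
    have Q: "0 \<le> Q" unfolding Q_def by (intro sum_nonneg) auto
    have "- (\<Sum>i<N. x i * h i) \<le> (\<Sum>i<N. \<bar>x i\<bar> * \<bar>h i\<bar>)"
      unfolding sum_negf[symmetric] by (intro sum_mono) (metis abs_ge_minus_self abs_mult)
    also have "\<dots> \<le> L2_set x {..<N} * L2_set h {..<N}" by (rule L2_set_mult_ineq)
    also have "\<dots> = sqrt Q" using C[OF h] by (simp add: L2_set_def Q_def)
    also have "\<dots> \<le> q / 2 + Q / (2 * q)"
    proof -
      have "0 \<le> (sqrt Q - q)\<^sup>2" by simp
      then have "2 * q * sqrt Q \<le> q\<^sup>2 + Q" using Q by (simp add: power2_diff algebra_simps)
      then show ?thesis using q by (simp add: field_simps power2_eq_square)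
    qed
    finally have "s * - (\<Sum>i<N. x i * h i) \<le> s * (q / 2 + Q / (2 * q))" using s by (intro mult_left_mono) auto
    also have "\<dots> = s * q / 2 + \<mu> * Q" by (simp add: \<mu>_def algebra_simps)
    finally have "exp (- s * (\<Sum>i<N. x i * h i)) \<le> exp (s * q / 2 + \<mu> * Q)" by simp
    also have "\<dots> = exp (s * q / 2) * (\<Prod>i<N. u i (x i))"
      by (simp add: u_def Q_def exp_add exp_sum[symmetric] sum_distrib_left)
    finally show "exp (- s * (\<Sum>i<N. x i * h i)) \<le> exp (s * q / 2) * (\<Prod>i<N. u i (x i))" .
  qed (use s in \<open>auto simp: u_def\<close>)
  also have "(\<Prod>i<N. \<integral>\<^sup>+x. ennreal (u i x) \<partial>std_normal) = (\<Prod>i<N. ennreal (sqrt (1 + s\<^sup>2)))"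
    by (simp only: ui)
  also have "ennreal (exp (s * q / 2)) * chi_laplace ({..<m} \<times> {N}) s * (\<Prod>i<N. ennreal (sqrt (1 + s\<^sup>2)))
     \<le> ennreal (exp (s * q / 2)) * ennreal ((sqrt m / s) ^ m) * ennreal (sqrt (1 + s\<^sup>2) ^ N)"
    using m s by (intro mult_mono chi_laplace_column_le) (auto simp: ennreal_power)
  also have "\<dots> = ennreal (?b * exp (s\<^sup>2 / 2))"
  proof -
    have "exp (s * q / 2) = exp (1 / 2) * exp (s\<^sup>2 / 2)"
      unfolding sq by (simp add: exp_add[symmetric] add_divide_distrib)
    then show ?thesis using s by (simp add: ennreal_mult[symmetric] mult_ac)
  qed
  finally have "emeasure (gauss_mat m N) (kernel_meets m N C) \<le> ennreal ?b"
    by (rule ennreal_le_exp_cancel) (use s in auto)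
  also have "\<dots> \<le> ennreal (exp (1 / 2) * sqrt m ^ m * 2 ^ N / s)"
  proof (rule ennreal_leI)
    have "sqrt (1 + s\<^sup>2) \<le> 2 * s"
    proof -
      have "1 \<le> s\<^sup>2" using s by (rule one_le_power)
      moreover have "(2 * s)\<^sup>2 = 4 * s\<^sup>2" by (simp add: power_mult_distrib)
      ultimately have "1 + s\<^sup>2 \<le> (2 * s)\<^sup>2" by linarith
      then show ?thesis using s by (intro real_le_lsqrt) auto
    qed
    then have "sqrt (1 + s\<^sup>2) ^ N \<le> (2 * s) ^ N" by (intro power_mono) auto
    then have "?b \<le> exp (1 / 2) * (sqrt m / s) ^ m * (2 * s) ^ N" using s by (intro mult_left_mono) auto
    also have "\<dots> = exp (1 / 2) * sqrt m ^ m * 2 ^ N / s ^ (m - N)"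
      using s m by (simp add: power_divide power_mult_distrib power_diff)
    also have "\<dots> \<le> exp (1 / 2) * sqrt m ^ m * 2 ^ N / s"
      using s m self_le_power[of s "m - N"] by (intro divide_left_mono) auto
    finally show "?b \<le> exp (1 / 2) * sqrt m ^ m * 2 ^ N / s" .
  qed
  finally show "emeasure (gauss_mat m N) (kernel_meets m N C) \<le> ennreal (exp (1 / 2) * sqrt m ^ m * 2 ^ N / s)" .
qed

section \<open>The failure probability\<close>

lemma Delta_bin_eq:
  "Delta_bin N k = (INF \<tau>\<in>{0..}. real k * trunc_moment \<tau> 2 + real (N - k) * trunc_moment (- \<tau>) 2)"
proof -
  have "(LINT u:{..\<tau>}|lborel. (u - \<tau>)\<^sup>2 * std_normal_density u) = trunc_moment \<tau> 2" for \<tau>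
  proof -
    have "(LINT u:{..\<tau>}|lborel. (u - \<tau>)\<^sup>2 * std_normal_density u) = (LINT u|lborel. std_normal_density u * (trunc \<tau> (- u))\<^sup>2)"
      unfolding set_lebesgue_integral_def
      by (intro Bochner_Integration.integral_cong) (auto simp: trunc_def indicator_def power2_commute)
    also have "\<dots> = (LINT u|std_normal. (trunc \<tau> (- u))\<^sup>2)"
      by (rule integral_std_normal_eq[symmetric]) measurable
    also have "\<dots> = trunc_moment \<tau> 2"
      unfolding trunc_moment_def by (rule integral_std_normal_reflect[of "\<lambda>u. (trunc \<tau> u)\<^sup>2"]) measurable
    finally show ?thesis .
  qed
  moreover have "(LINT u:{\<tau>..}|lborel. (u - \<tau>)\<^sup>2 * std_normal_density u) = trunc_moment (- \<tau>) 2" for \<tau>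
  proof -
    have "(LINT u:{\<tau>..}|lborel. (u - \<tau>)\<^sup>2 * std_normal_density u) = (LINT u|lborel. std_normal_density u * (trunc (- \<tau>) u)\<^sup>2)"
      unfolding set_lebesgue_integral_def
      by (intro Bochner_Integration.integral_cong) (auto simp: trunc_def indicator_def)
    also have "\<dots> = trunc_moment (- \<tau>) 2"
      unfolding trunc_moment_def by (rule integral_std_normal_eq[symmetric]) measurable
    finally show ?thesis .
  qed
  ultimately show ?thesis by (simp only: Delta_bin_def)
qed

lemma Delta_bin_greatest:
  assumes "\<And>\<tau>. 0 \<le> \<tau> \<Longrightarrow> b \<le> real k * trunc_moment \<tau> 2 + real (N - k) * trunc_moment (- \<tau>) 2"
  shows "b \<le> Delta_bin N k"
  unfolding Delta_bin_eq using assms by (intro cINF_greatest) auto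

lemma Delta_bin_nonneg: "0 \<le> Delta_bin N k"
  by (intro Delta_bin_greatest add_nonneg_nonneg mult_nonneg_nonneg trunc_moment_nonneg) auto

lemma sum_trunc_moment_sign:
  assumes "P \<subseteq> {..<N}"
  shows "(\<Sum>i<N. if i \<in> P then a else b) = real (card P) * a + real (N - card P) * (b :: real)"
proof -
  have "(\<Sum>i<N. if i \<in> P then a else b) = (\<Sum>i\<in>P. a) + (\<Sum>i\<in>{..<N} - P. b)"
    using assms by (subst sum.If_cases) (auto simp: Int_absorb1 Diff_eq)
  then show ?thesis
    using assms by (simp add: card_Diff_subset finite_subset[OF assms])
qed

text \<open>Equality at \<open>w = 1\<close>, and the difference has derivative
  \<open>- (1 - x)\<^sup>2 / (2 * x\<^sup>2)\<close>. With \<open>w = \<delta> / m\<close> this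
  estimate turns the optimized exponent into
  \<open>- (m - \<delta>)\<^sup>2 / (8 * m)\<close>.\<close>

lemma ln_ge_half_diff:
  assumes "0 < w" "w \<le> (1::real)"
  shows "(w - 1 / w) / 2 \<le> ln w"
proof -
  have "ln 1 - (1 - 1 / 1) / 2 \<le> ln w - (w - 1 / w) / 2"
  proof (rule DERIV_nonpos_imp_nonincreasing[of w 1 "\<lambda>w. ln w - (w - 1 / w) / 2"])
    fix x assume x: "w \<le> x" "x \<le> 1"
    then have "0 < x" using assms by linarith
    then have "((\<lambda>w. ln w - (w - 1 / w) / 2) has_real_derivative - ((1 - x)\<^sup>2 / (2 * x\<^sup>2))) (at x)"
      by (auto intro!: derivative_eq_intros simp: field_simps power2_eq_square)
    then show "\<exists>y. ((\<lambda>w. ln w - (w - 1 / w) / 2) has_real_derivative y) (at x) \<and> y \<le> 0"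
      by (intro exI[of _ "- ((1 - x)\<^sup>2 / (2 * x\<^sup>2))"]) auto
  qed (use assms in auto)
  then show ?thesis by simp
qed

text \<open>If \<open>m \<le> N\<close>, the hypothesis gives
  \<open>(m - \<delta>)\<^sup>2 \<ge> 8 * L * N \<ge> 8 * L * m\<close>, so the rate is at least
  \<open>L = ln (4 / \<epsilon>)\<close>. Strictness comes from \<open>1 + sqrt pi < 4\<close>. For
  \<open>m > N\<close> the event is null.\<close>

lemma failure_probability_less:
  assumes P: "P \<subseteq> {..<N}" and N: "0 < N" and \<epsilon>: "0 < \<epsilon>" "\<epsilon> \<le> 1"
    and m: "real m \<ge> Delta_bin N (card P) + sqrt (8 * ln (4 / \<epsilon>) * real N)"
  shows "measure (gauss_mat m N) (kernel_meets m N (sign_cone N P)) < \<epsilon>"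
proof -
  define p where "p = measure (gauss_mat m N) (kernel_meets m N (sign_cone N P))"
  define \<delta> where "\<delta> = Delta_bin N (card P)"
  define L where "L = ln (4 / \<epsilon>)"
  define C where "C = 1 + sqrt pi"
  have C: "0 < C" "C < 4"
  proof -
    have "sqrt pi < sqrt 9" using pi_less_4 by (intro real_sqrt_less_mono) auto
    then show "0 < C" "C < 4" by (auto simp: C_def intro: add_pos_nonneg)
  qed
  have L: "0 < L" using \<epsilon> by (simp add: L_def)
  have eL: "exp (- L) = \<epsilon> / 4" using \<epsilon> by (simp add: L_def exp_minus)
  have \<delta>0: "0 \<le> \<delta>" by (simp add: \<delta>_def Delta_bin_nonneg)
  have q: "0 < sqrt (8 * L * real N)" using L N by simp
  have md: "\<delta> + sqrt (8 * L * real N) \<le> real m" using m by (simp add: \<delta>_def L_def)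
  have "0 < real m" using md q \<delta>0 by linarith
  then have m0: "0 < m" by simp
  have "p < \<epsilon>"
  proof (cases "N < m")
    case True
    have "emeasure (gauss_mat m N) (kernel_meets m N (sign_cone N P)) = 0"
      by (rule kernel_meets_null_of_gt[OF True]) (simp add: sign_cone_def)
    then show ?thesis using \<epsilon> by (simp add: p_def measure_def)
  next
    case False
    then have mN: "real m \<le> real N" by simp
    have bound: "p \<le> C * exp (- \<mu> * m) * (1 - 4 * \<mu>) powr (- \<delta> / 4)" if \<mu>: "0 < \<mu>" "\<mu> < 1 / 4" for \<mu> :: real
    proof (cases "p = 0")
      case True
      then show ?thesis using C by simp
    next
      case False
      then have p: "0 < p" by (simp add: p_def zero_less_measure_iff)
      define l where "l = - ln (1 - 4 * \<mu>)"
      have l: "0 < l" using \<mu> by (simp add: l_def)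
      have pw: "(1 - 4 * \<mu>) powr (- d / 4) = exp (d * l / 4)" for d
        using \<mu> by (simp add: powr_def l_def)
      \<comment> \<open>No minimizing \<open>\<tau>\<close> is assumed for the infimum. The bound
        for each \<open>\<tau>\<close> is solved for its \<open>?d\<close>, the resulting lower
        bound passes to the infimum \<open>\<delta>\<close>, and the inequality is then solved back
        for \<open>p\<close>.\<close>
      have "4 / l * (ln (p / C) + \<mu> * m) \<le> \<delta>"
        unfolding \<delta>_def
      proof (rule Delta_bin_greatest)
        fix \<tau> :: real assume \<tau>: "0 \<le> \<tau>"
        let ?d = "real (card P) * trunc_moment \<tau> 2 + real (N - card P) * trunc_moment (- \<tau>) 2"
        have "p \<le> C * exp (- \<mu> * m) * (1 - 4 * \<mu>) powr (- ?d / 4)"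
          using kernel_meets_sign_cone_le[OF m0 \<mu> \<tau>, of N P]
          unfolding sum_trunc_moment_sign[OF P] p_def C_def measure_def by (intro enn2real_leI) auto
        also have "\<dots> = C * (exp (- \<mu> * m) * exp (?d * l / 4))" unfolding pw by simp
        finally have "p / C \<le> exp (- \<mu> * m + ?d * l / 4)"
          using C by (simp add: field_simps exp_add[symmetric])
        then have "ln (p / C) \<le> - \<mu> * m + ?d * l / 4"
          using p C by (metis divide_pos_pos exp_gt_zero ln_exp ln_le_cancel_iff)
        then show "4 / l * (ln (p / C) + \<mu> * m) \<le> ?d" using l by (simp add: field_simps)
      qed
      then have "ln (p / C) \<le> - \<mu> * m + \<delta> * l / 4" using l by (simp add: field_simps)
      then have "exp (ln (p / C)) \<le> exp (- \<mu> * m + \<delta> * l / 4)" by simp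
      then have "p / C \<le> exp (- \<mu> * m) * exp (\<delta> * l / 4)"
        using p C by (simp add: exp_add[symmetric])
      then show ?thesis unfolding pw using C by (simp add: field_simps)
    qed
    have "p \<le> C * exp (- L)"
    proof (cases "\<delta> = 0")
      case True
      have "sqrt (8 * L * m) \<le> sqrt (8 * L * N)" using L mN by (intro real_sqrt_le_mono mult_left_mono) auto
      then have "sqrt (8 * L * m) \<le> m" using md True by linarith
      then have "8 * L * m \<le> (real m)\<^sup>2" by (rule sqrt_le_D)
      then have "8 * L \<le> m" using m0 by (simp add: power2_eq_square)
      then have "exp (- (1 / 8) * m) \<le> exp (- L)" by simp
      \<comment> \<open>For \<open>\<delta> = 0\<close> the minimizer would be the excluded
        \<open>\<mu> = 1 / 4\<close>; \<open>1 / 8\<close> already yields the required exponent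
        \<open>- m / 8\<close>.\<close>
      have "p \<le> C * exp (- (1 / 8) * m) * (1 - 4 * (1 / 8)) powr (- \<delta> / 4)" by (rule bound) auto
      also have "\<dots> = C * exp (- (1 / 8) * m)" using True by simp
      also have "\<dots> \<le> C * exp (- L)" using C \<open>exp (- (1 / 8) * m) \<le> exp (- L)\<close> by (intro mult_left_mono) auto
      finally show ?thesis .
    next
      case False
      define w where "w = \<delta> / m"
      have \<delta>m: "0 < \<delta>" "\<delta> < m" using False \<delta>0 md q by linarith+
      have w: "0 < w" "w < 1" "\<delta> = w * m" using \<delta>m m0 by (auto simp: w_def)
      define \<mu> where "\<mu> = (1 - w) / 4" \<comment> \<open>the minimizer of the bound\<close>
      have "p \<le> C * exp (- \<mu> * m) * (1 - 4 * \<mu>) powr (- \<delta> / 4)"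
        by (rule bound) (use w in \<open>auto simp: \<mu>_def\<close>)
      also have "(1 - 4 * \<mu>) powr (- \<delta> / 4) = exp (- \<delta> / 4 * ln w)"
      proof -
        have "1 - 4 * \<mu> = w" by (simp add: \<mu>_def field_simps)
        then show ?thesis using w(1) by (simp add: powr_def)
      qed
      also have "C * exp (- \<mu> * m) * exp (- \<delta> / 4 * ln w) = C * exp (- \<mu> * m + - \<delta> / 4 * ln w)"
        by (simp only: exp_add mult.assoc)
      also have "\<dots> \<le> C * exp (- L)"
      proof -
        have "\<delta> / 4 * ((w - 1 / w) / 2) \<le> \<delta> / 4 * ln w"
          using ln_ge_half_diff[of w] w \<delta>0 by (intro mult_left_mono) auto
        then have "- \<mu> * m + - \<delta> / 4 * ln w \<le> - \<mu> * m - \<delta> / 4 * ((w - 1 / w) / 2)" by simp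
        also have "\<dots> = - (m - \<delta>)\<^sup>2 / (8 * m)"
          using w m0 by (simp add: \<mu>_def w(3) field_simps power2_eq_square)
        also have "\<dots> \<le> - L"
        proof -
          have "8 * L * N \<le> (m - \<delta>)\<^sup>2" using md by (intro sqrt_le_D) linarith
          moreover have "8 * L * m \<le> 8 * L * N" using L mN by (intro mult_left_mono) auto
          ultimately have "L * (8 * m) \<le> (m - \<delta>)\<^sup>2" by linarith
          then show ?thesis using m0 by (simp add: field_simps)
        qed
        finally show ?thesis using C by (intro mult_left_mono) auto
      qed
      finally show ?thesis .
    qed
    also have "\<dots> = C / 4 * \<epsilon>" by (simp add: eL)
    also have "\<dots> < 1 * \<epsilon>" using C \<epsilon> by (intro mult_strict_right_mono) auto
    finally show ?thesis by simp
  qed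
  then show ?thesis by (simp add: p_def)
qed

section \<open>Measurability\<close>

lemma compact_box: "compact {y :: nat \<Rightarrow> real. (\<forall>i\<ge>N. y i = 0) \<and> (\<forall>i<N. a \<le> y i \<and> y i \<le> b)}"
proof -
  define S where "S = (\<lambda>i. if i < N then {a..b} else {0::real})"
  have "{y :: nat \<Rightarrow> real. (\<forall>i\<ge>N. y i = 0) \<and> (\<forall>i<N. a \<le> y i \<and> y i \<le> b)} = PiE UNIV S"
    by (auto simp: S_def PiE_def Pi_def not_less split: if_splits)
  moreover have "compactin (product_topology (\<lambda>i. euclidean) UNIV) (PiE UNIV S)"
    unfolding compactin_PiE by (auto simp: S_def)
  ultimately show ?thesis
    by (simp add: euclidean_product_topology)
qed

lemma continuous_on_linear_form: "continuous_on S (\<lambda>y :: nat \<Rightarrow> real. \<Sum>i<n. c i * y i)"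
  by (intro continuous_intros continuous_on_subset[OF continuous_on_product_coordinates]) auto

text \<open>
  Measurability of the success event has to be proved, since \<open>measure\<close> is zero on non-measurable sets. Compactness
  turns the existential quantifier over \<open>Y\<close> into one over a countable dense subset.
\<close>

lemma sets_solvable:
  fixes m N :: nat and Y :: "(nat \<Rightarrow> real) set"
  assumes Y: "compact Y"
  shows "{a \<in> space (gauss_mat m N). \<exists>y\<in>Y. \<forall>j<m. (\<Sum>i<N. a (j, i) * y i) = (\<Sum>i<N. a (j, i) * z i)}
    \<in> sets (gauss_mat m N)"
proof (cases "Y = {}")
  case False
  let ?M = "gauss_mat m N"
  define g where "g = (\<lambda>a y. \<Sum>j<m. \<bar>(\<Sum>i<N. a (j, i) * y i) - (\<Sum>i<N. a (j, i) * z i)\<bar>)"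
  obtain D where D: "countable D" "D \<subseteq> Y" "Y \<subseteq> closure D" by (rule separable[of Y])
  have cont: "continuous_on S (g a)" for S a
    unfolding g_def by (intro continuous_intros continuous_on_linear_form)
  have g0: "0 \<le> g a y" for a y unfolding g_def by (intro sum_nonneg) auto
  have geq: "(\<forall>j<m. (\<Sum>i<N. a (j, i) * y i) = (\<Sum>i<N. a (j, i) * z i)) \<longleftrightarrow> g a y = 0" for a y
    unfolding g_def by (subst sum_nonneg_eq_0_iff) auto
  have "(\<exists>y\<in>Y. g a y = 0) \<longleftrightarrow> (\<forall>n. \<exists>d\<in>D. g a d < 1 / real (Suc n))" for a
  proof
    assume "\<exists>y\<in>Y. g a y = 0"
    then obtain y where y: "y \<in> Y" "g a y = 0" by blast
    show "\<forall>n. \<exists>d\<in>D. g a d < 1 / real (Suc n)"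
    proof
      fix n
      have "open {y. g a y < 1 / real (Suc n)}"
        by (intro open_Collect_less cont continuous_on_const)
      moreover have "y \<in> {y. g a y < 1 / real (Suc n)}" using y by simp
      ultimately show "\<exists>d\<in>D. g a d < 1 / real (Suc n)"
        using y(1) D(3) open_Int_closure_eq_empty[of "{y. g a y < 1 / real (Suc n)}" D] by blast
    qed
  next
    assume *: "\<forall>n. \<exists>d\<in>D. g a d < 1 / real (Suc n)"
    obtain y where y: "y \<in> Y" "\<And>d. d \<in> Y \<Longrightarrow> g a y \<le> g a d"
      using continuous_attains_inf[OF Y False cont] by blast
    have "g a y \<le> 0"
    proof (rule LIMSEQ_le_const[OF LIMSEQ_Suc[OF lim_1_over_n]])
      show "\<exists>N. \<forall>n\<ge>N. g a y \<le> 1 / real (Suc n)"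
        using * y(2) D(2) by (meson less_imp_le order_trans subsetD)
    qed
    then show "\<exists>y\<in>Y. g a y = 0" using y(1) g0[of a y] by (intro bexI[of _ y]) auto
  qed
  then have "{a \<in> space ?M. \<exists>y\<in>Y. \<forall>j<m. (\<Sum>i<N. a (j, i) * y i) = (\<Sum>i<N. a (j, i) * z i)} =
    {a \<in> space ?M. \<forall>n. \<exists>d\<in>D. g a d < 1 / real (Suc n)}"
    by (simp only: geq)
  moreover have "(\<lambda>a. g a d) \<in> borel_measurable ?M" for d
    unfolding g_def
    by (intro borel_measurable_sum borel_measurable_abs borel_measurable_diff borel_measurable_times
        borel_measurable_const measurable_gauss_component) auto
  then have "{a \<in> space ?M. \<forall>n. \<exists>d\<in>D. g a d < 1 / real (Suc n)} \<in> sets ?M"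
    by (intro sets.sets_Collect_countable_All sets.sets_Collect_countable_Ex'[OF _ D(1)] borel_measurable_less borel_measurable_const)
  ultimately show ?thesis by simp
qed simp

lemma compact_sign_cone: "compact (sign_cone N P)"
proof -
  let ?B = "{y :: nat \<Rightarrow> real. (\<forall>i\<ge>N. y i = 0) \<and> (\<forall>i<N. - 1 \<le> y i \<and> y i \<le> 1)}"
  let ?C = "(\<Inter>i\<in>{..<N} \<inter> P. {h. 0 \<le> h i}) \<inter> (\<Inter>i\<in>{..<N} - P. {h :: nat \<Rightarrow> real. h i \<le> 0})"
  have "sign_cone N P = ?B \<inter> (?C \<inter> {h. 0 \<le> (\<Sum>i<N. h i)} \<inter> {h. (\<Sum>i<N. (h i)\<^sup>2) = 1})"
  proof -
    have "- 1 \<le> h i \<and> h i \<le> 1" if "(\<Sum>i<N. (h i)\<^sup>2) = 1" "i < N" for h :: "nat \<Rightarrow> real" and i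
    proof -
      have "(h i)\<^sup>2 \<le> (\<Sum>i<N. (h i)\<^sup>2)" using that by (intro member_le_sum) auto
      then have "\<bar>h i\<bar> \<le> 1" using that by (simp add: abs_square_le_1)
      then show ?thesis by (simp add: abs_le_iff)
    qed
    then show ?thesis unfolding sign_cone_def by (auto split: if_splits)
  qed
  moreover have "closed ?C"
    by (intro closed_Int closed_INT ballI closed_Collect_le continuous_intros continuous_on_product_coordinates)
  moreover have "closed {h :: nat \<Rightarrow> real. 0 \<le> (\<Sum>i<N. h i)}" "closed {h :: nat \<Rightarrow> real. (\<Sum>i<N. (h i)\<^sup>2) = 1}"
    by (intro closed_Collect_le closed_Collect_eq continuous_intros continuous_on_product_coordinates)+
  ultimately show ?thesis by (auto intro!: compact_Int_closed compact_box)
qed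

lemma sets_kernel_meets: "compact Y \<Longrightarrow> kernel_meets m N Y \<in> sets (gauss_mat m N)"
  using sets_solvable[of Y m N "\<lambda>_. 0"] by (simp add: kernel_meets_def)

section \<open>Mirrored basis pursuit\<close>

definition unit_box :: "nat \<Rightarrow> (nat \<Rightarrow> real) set" where
  "unit_box N = {x. (\<forall>i\<ge>N. x i = 0) \<and> (\<forall>i<N. 0 \<le> x i \<and> x i \<le> 1)}"

definition binary :: "nat \<Rightarrow> (nat \<Rightarrow> real) set" where
  "binary N = {x. (\<forall>i\<ge>N. x i = 0) \<and> (\<forall>i<N. x i = 0 \<or> x i = 1)}"

lemma finite_binary: "finite (binary N)"
proof -
  have "binary N \<subseteq> indicator ` Pow {..<N}"
  proof
    fix x assume x: "x \<in> binary N"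
    have "x = indicator {i. i < N \<and> x i = 1}"
    proof
      fix i show "x i = indicator {i. i < N \<and> x i = 1} i"
        using x by (cases "i < N") (auto simp: binary_def indicator_def)
    qed
    then show "x \<in> indicator ` Pow {..<N}" by blast
  qed
  then show ?thesis by (rule finite_subset) simp
qed

lemma binary_subset_unit_box: "binary N \<subseteq> unit_box N"
  by (auto simp: binary_def unit_box_def)

lemma round_err_nonneg:
  assumes "is_norm_on N nrm" "x \<in> unit_box N"
  shows "0 \<le> round_err nrm N x"
proof -
  have "supp_vec N (\<lambda>i. round_vec N x i - x i)"
    using assms(2) by (simp add: supp_vec_def round_vec_def unit_box_def)
  then show ?thesis using assms(1) unfolding is_norm_on_def round_err_def by blast
qed

lemma round_err_eq_0_iff:
  assumes "is_norm_on N nrm" "x \<in> unit_box N"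
  shows "round_err nrm N x = 0 \<longleftrightarrow> x \<in> binary N"
proof -
  have "supp_vec N (\<lambda>i. round_vec N x i - x i)"
    using assms(2) by (simp add: supp_vec_def round_vec_def unit_box_def)
  then have "round_err nrm N x = 0 \<longleftrightarrow> (\<forall>i. round_vec N x i - x i = 0)"
    using assms(1) unfolding is_norm_on_def round_err_def by blast
  also have "\<dots> \<longleftrightarrow> (\<forall>i<N. real_of_int (round (x i)) = x i)"
    using assms(2) by (auto simp: round_vec_def unit_box_def)
  also have "\<dots> \<longleftrightarrow> (\<forall>i<N. x i = 0 \<or> x i = 1)"
  proof (intro all_cong1 imp_cong refl)
    fix i assume "i < N"
    then have b: "0 \<le> x i" "x i \<le> 1" using assms(2) by (auto simp: unit_box_def)
    show "real_of_int (round (x i)) = x i \<longleftrightarrow> x i = 0 \<or> x i = 1"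
    proof
      assume r: "real_of_int (round (x i)) = x i"
      then have "0 \<le> round (x i)" "round (x i) \<le> 1" using b by linarith+
      then have "round (x i) = 0 \<or> round (x i) = 1" by linarith
      then show "x i = 0 \<or> x i = 1" using r by auto
    qed auto
  qed
  also have "\<dots> \<longleftrightarrow> x \<in> binary N"
    using assms(2) by (auto simp: binary_def unit_box_def)
  finally show ?thesis .
qed

text \<open>A point of \<open>B\<close> has error zero and can only be challenged by another point
  of error zero, hence of \<open>B\<close>. The equivalence, rather than one implication, lets the
  success event be written through finitely many events about single binary points, which makes it
  measurable.\<close>

lemma selection_unique_iff:
  fixes err :: "'a \<Rightarrow> real"
  assumes ne: "S1 \<noteq> {}" "S2 \<noteq> {}" and err: "\<And>x. x \<in> S1 \<union> S2 \<Longrightarrow> 0 \<le> err x \<and> (err x = 0 \<longleftrightarrow> x \<in> B)"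
    and x0: "x0 \<in> B"
  shows "{x. \<exists>x1\<in>S1. \<exists>x2\<in>S2. (x = x1 \<and> err x1 \<le> err x2) \<or> (x = x2 \<and> err x2 \<le> err x1)} = {x0} \<longleftrightarrow>
     (S1 = {x0} \<and> B \<inter> S2 \<subseteq> {x0}) \<or> (S2 = {x0} \<and> B \<inter> S1 \<subseteq> {x0})" (is "?O = {x0} \<longleftrightarrow> ?R")
proof
  assume O: "?O = {x0}"
  have pick: "(err x1 \<le> err x2 \<longrightarrow> x1 = x0) \<and> (err x2 \<le> err x1 \<longrightarrow> x2 = x0)" if "x1 \<in> S1" "x2 \<in> S2" for x1 x2
    using O that by blast
  have main: "?R"
    if S: "x0 \<in> S1 \<or> x0 \<in> S2"
  proof -
    have e0: "err x0 = 0" using S err x0 by auto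
    have bin: "B \<inter> S2 \<subseteq> {x0}" if "x0 \<in> S1"
    proof
      fix z assume z: "z \<in> B \<inter> S2"
      then have "err z = 0" using err[of z] by auto
      then show "z \<in> {x0}" using pick[OF that, of z] z e0 by auto
    qed
    have bin': "B \<inter> S1 \<subseteq> {x0}" if "x0 \<in> S2"
    proof
      fix z assume z: "z \<in> B \<inter> S1"
      then have "err z = 0" using err[of z] by auto
      then show "z \<in> {x0}" using pick[OF _ that, of z] z e0 by auto
    qed
    show ?R
    proof (cases "S1 = {x0}")
      case True
      then show ?thesis using bin by blast
    next
      case False
      \<comment> \<open>Such an \<open>x1\<close> must lose every comparison; so every
        \<open>x2\<close> wins one and has to be \<open>x0\<close>.\<close>
      then obtain x1 where x1: "x1 \<in> S1" "x1 \<noteq> x0" using ne(1) by blast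
      have "x2 = x0" if "x2 \<in> S2" for x2
        using pick[OF x1(1) that] x1(2) by linarith
      then have "S2 = {x0}" using ne(2) by blast
      then show ?thesis using bin' by blast
    qed
  qed
  obtain x1 x2 where "x1 \<in> S1" "x2 \<in> S2" using ne by blast
  then have "x0 \<in> S1 \<or> x0 \<in> S2" using pick[of x1 x2] by (cases "err x1 \<le> err x2") auto
  then show ?R by (rule main)
next
  assume R: ?R
  have e0: "err x0 = 0" using R err[of x0] x0 by auto
  have *: "{x. \<exists>x1\<in>{x0}. \<exists>x2\<in>S. (x = x1 \<and> err x1 \<le> err x2) \<or> (x = x2 \<and> err x2 \<le> err x1)} = {x0}"
    if S: "S \<noteq> {}" "B \<inter> S \<subseteq> {x0}" "S \<subseteq> S1 \<union> S2" for S
  proof -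
    obtain y where y: "y \<in> S" using S(1) by blast
    then have "err x0 \<le> err y" using err[of y] S(3) e0 by auto
    moreover have "z = x0" if "z \<in> S" "err z \<le> err x0" for z
      using that err[of z] S e0 by (metis Int_iff antisym singletonD subsetD)
    ultimately show ?thesis using y by auto
  qed
  show "?O = {x0}"
  proof (cases "S1 = {x0} \<and> B \<inter> S2 \<subseteq> {x0}")
    case True
    then show ?thesis using *[of S2] ne by auto
  next
    case False
    then have "S2 = {x0}" "B \<inter> S1 \<subseteq> {x0}" using R by auto
    then show ?thesis using *[of S1] ne by auto
  qed
qed

section \<open>The two optimization steps and their sign cones\<close>

lemma feasible_gauss_matrix:
  assumes "0 < m"
  shows "feasible m N (gauss_matrix m a) (mat_vec m N (gauss_matrix m a) z) =
    {x \<in> unit_box N. \<forall>j<m. (\<Sum>i<N. a (j, i) * x i) = (\<Sum>i<N. a (j, i) * z i)}"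
proof -
  have "(\<Sum>i<N. gauss_matrix m a j i * y i) = (\<Sum>i<N. a (j, i) * y i) / sqrt m" for j y
    by (simp add: gauss_matrix_def sum_divide_distrib)
  then show ?thesis
    using assms by (auto simp: feasible_def mat_vec_def unit_box_def supp_vec_def)
qed

lemma continuous_on_l1: "continuous_on S (\<lambda>x :: nat \<Rightarrow> real. \<Sum>i<N. x i)"
  by (intro continuous_intros continuous_on_subset[OF continuous_on_product_coordinates]) auto

lemma compact_unit_box: "compact (unit_box N)"
  unfolding unit_box_def by (rule compact_box)

lemma compact_slice: "compact {x \<in> unit_box N. s * (\<Sum>i<N. x i) \<le> c}"
proof -
  have "closed {x :: nat \<Rightarrow> real. s * (\<Sum>i<N. x i) \<le> c}"
    by (intro closed_Collect_le continuous_on_const continuous_on_mult continuous_on_l1)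
  then show ?thesis
    using compact_Int_closed[OF compact_unit_box] by (simp add: Collect_conj_eq)
qed

lemma normalized_difference:
  fixes N :: nat and d :: "nat \<Rightarrow> real"
  assumes y: "\<forall>i\<ge>N. d i = 0" "d \<noteq> (\<lambda>_. 0)"
  obtains c :: real where "0 < c" "(\<Sum>i<N. (c * d i)\<^sup>2) = 1"
proof -
  obtain i where "d i \<noteq> 0" using y(2) by auto
  then have "i < N" using y(1) by (meson not_less)
  have "(d i)\<^sup>2 \<le> (\<Sum>i<N. (d i)\<^sup>2)" using \<open>i < N\<close> by (intro member_le_sum) auto
  moreover have "0 < (d i)\<^sup>2" using \<open>d i \<noteq> 0\<close> by simp
  ultimately have Q: "0 < (\<Sum>i<N. (d i)\<^sup>2)" by linarith
  show thesis
  proof (rule that[of "1 / sqrt (\<Sum>i<N. (d i)\<^sup>2)"])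
    show "(\<Sum>i<N. (1 / sqrt (\<Sum>i<N. (d i)\<^sup>2) * d i)\<^sup>2) = 1"
      using Q by (simp add: power_divide sum_divide_distrib[symmetric])
  qed (use Q in simp)
qed

lemma sign_cone_scale:
  assumes "\<forall>i\<ge>N. d i = 0" "\<forall>i<N. if i \<in> P then 0 \<le> d i else d i \<le> 0" "0 \<le> (\<Sum>i<N. d i)"
    "0 < c" "(\<Sum>i<N. (c * d i)\<^sup>2) = 1"
  shows "(\<lambda>i. c * d i) \<in> sign_cone N P"
proof -
  have "0 \<le> c * (\<Sum>i<N. d i)" using assms by simp
  moreover have "if i \<in> P then 0 \<le> c * d i else c * d i \<le> 0" if "i < N" for i
    using assms(2,4) that by (auto simp: mult_le_0_iff split: if_splits)
  ultimately show ?thesis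
    using assms(1,5) unfolding sign_cone_def by (auto simp: sum_distrib_left)
qed

lemma sign_cone_abs_le: "h \<in> sign_cone N P \<Longrightarrow> i < N \<Longrightarrow> \<bar>h i\<bar> \<le> 1"
proof -
  assume h: "h \<in> sign_cone N P" "i < N"
  have "(h i)\<^sup>2 \<le> (\<Sum>i<N. (h i)\<^sup>2)" using h by (intro member_le_sum) auto
  then show "\<bar>h i\<bar> \<le> 1" using h by (simp add: sign_cone_def abs_square_le_1)
qed

lemma sign_cone_nonzero: "h \<in> sign_cone N P \<Longrightarrow> h \<noteq> (\<lambda>_. 0)"
  by (auto simp: sign_cone_def)

definition solvable_in :: "nat \<Rightarrow> nat \<Rightarrow> nat set \<Rightarrow> (nat \<times> nat \<Rightarrow> real) \<Rightarrow> (nat \<Rightarrow> real) set \<Rightarrow> bool" where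
  "solvable_in m N K a Y \<longleftrightarrow> (\<exists>y\<in>Y. \<forall>j<m. (\<Sum>i<N. a (j, i) * y i) = (\<Sum>i<N. a (j, i) * indicator K i))"

definition feasible_points :: "nat \<Rightarrow> nat \<Rightarrow> nat set \<Rightarrow> (nat \<times> nat \<Rightarrow> real) \<Rightarrow> (nat \<Rightarrow> real) set" where
  "feasible_points m N K a = {x \<in> unit_box N. \<forall>j<m. (\<Sum>i<N. a (j, i) * x i) = (\<Sum>i<N. a (j, i) * indicator K i)}"

text \<open>Step 1 corresponds to \<open>s = 1\<close>, step 2 to \<open>s = -1\<close>.\<close>

definition optima :: "nat \<Rightarrow> nat \<Rightarrow> nat set \<Rightarrow> (nat \<times> nat \<Rightarrow> real) \<Rightarrow> real \<Rightarrow> (nat \<Rightarrow> real) set" where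
  "optima m N K a s = {x \<in> feasible_points m N K a.
     \<forall>y\<in>feasible_points m N K a. s * (\<Sum>i<N. x i) \<le> s * (\<Sum>i<N. y i)}"

text \<open>On the unit box both objectives are affine in the coordinate sum: one step minimizes
  this sum, the other maximizes it.\<close>

lemma step_sols_eq_optima:
  assumes "0 < m"
  shows "step1_sols m N (gauss_matrix m a) (mat_vec m N (gauss_matrix m a) (indicator K)) = optima m N K a 1"
    and "step2_sols m N (gauss_matrix m a) (mat_vec m N (gauss_matrix m a) (indicator K)) = optima m N K a (- 1)"
proof -
  have "(\<Sum>i<N. \<bar>x i\<bar>) = (\<Sum>i<N. x i)" "(\<Sum>i<N. \<bar>1 - x i\<bar>) = real N - (\<Sum>i<N. x i)"
    if "x \<in> feasible_points m N K a" for x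
  proof -
    have x: "0 \<le> x i" "x i \<le> 1" if "i < N" for i
      using that \<open>x \<in> feasible_points m N K a\<close> by (auto simp: feasible_points_def unit_box_def)
    then show "(\<Sum>i<N. \<bar>x i\<bar>) = (\<Sum>i<N. x i)" by (intro sum.cong) auto
    have "(\<Sum>i<N. \<bar>1 - x i\<bar>) = (\<Sum>i<N. 1 - x i)" using x by (intro sum.cong) auto
    then show "(\<Sum>i<N. \<bar>1 - x i\<bar>) = real N - (\<Sum>i<N. x i)" by (simp add: sum_subtractf)
  qed
  then show "step1_sols m N (gauss_matrix m a) (mat_vec m N (gauss_matrix m a) (indicator K)) = optima m N K a 1"
    and "step2_sols m N (gauss_matrix m a) (mat_vec m N (gauss_matrix m a) (indicator K)) = optima m N K a (- 1)"
    unfolding step1_sols_def step2_sols_def feasible_gauss_matrix[OF assms] feasible_points_def[symmetric] optima_def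
    by auto
qed

context
  fixes m N :: nat and K :: "nat set" and a :: "nat \<times> nat \<Rightarrow> real" and s :: real
  assumes K: "K \<subseteq> {..<N}" and s: "s = 1 \<or> s = - 1"
begin

abbreviation "x0 \<equiv> indicator K :: nat \<Rightarrow> real"
abbreviation "feas \<equiv> feasible_points m N K a"
abbreviation "solvable \<equiv> solvable_in m N K a"

lemma x0_binary: "x0 \<in> binary N"
  using K by (auto simp: binary_def indicator_def)

lemma x0_feas: "x0 \<in> feas"
  using x0_binary binary_subset_unit_box by (auto simp: feasible_points_def)

lemma compact_feas: "compact feas"
proof -
  have "feas = unit_box N \<inter> (\<Inter>j\<in>{..<m}. {x. (\<Sum>i<N. a (j, i) * x i) = (\<Sum>i<N. a (j, i) * x0 i)})"
    by (auto simp: feasible_points_def)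
  moreover have "closed (\<Inter>j\<in>{..<m}. {x :: nat \<Rightarrow> real. (\<Sum>i<N. a (j, i) * x i) = (\<Sum>i<N. a (j, i) * x0 i)})"
    by (intro closed_INT ballI closed_Collect_eq continuous_on_const continuous_on_linear_form)
  ultimately show ?thesis using compact_Int_closed[OF compact_unit_box] by simp
qed

lemma optima_nonempty: "optima m N K a s \<noteq> {}"
proof -
  have "feas \<noteq> {}" using x0_feas by blast
  moreover have "continuous_on feas (\<lambda>x. s * (\<Sum>i<N. x i))"
    by (intro continuous_on_mult continuous_on_const continuous_on_l1)
  ultimately obtain x where "x \<in> feas" "\<forall>y\<in>feas. s * (\<Sum>i<N. x i) \<le> s * (\<Sum>i<N. y i)"
    using continuous_attains_inf[OF compact_feas] by blast
  then show ?thesis unfolding optima_def by blast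
qed

text \<open>A competitor \<open>y\<close> and a kernel vector \<open>h\<close> correspond through
  \<open>h = c * s * (x0 - y)\<close>. For \<open>s = -1\<close> all signs flip, which is why the
  cone then belongs to the complement of \<open>K\<close>.\<close>

lemma kernel_meets_sign_cone_iff:
  assumes a: "a \<in> space (gauss_mat m N)"
  shows "a \<in> kernel_meets m N (sign_cone N (if s = 1 then K else {..<N} - K)) \<longleftrightarrow>
    (\<exists>y\<in>feas. y \<noteq> x0 \<and> s * (\<Sum>i<N. y i) \<le> s * (\<Sum>i<N. x0 i))" (is "a \<in> kernel_meets m N (sign_cone N ?P) \<longleftrightarrow> _")
proof
  have ss: "s * s = 1" using s by auto
  assume "a \<in> kernel_meets m N (sign_cone N ?P)"
  then obtain h where h: "h \<in> sign_cone N ?P" "\<And>j. j < m \<Longrightarrow> (\<Sum>i<N. a (j, i) * h i) = 0"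
    by (auto simp: kernel_meets_def)
  \<comment> \<open>A full step along \<open>h\<close> stays in the box, since unit norm forces
    \<open>\<bar>h i\<bar> \<le> 1\<close>.\<close>
  define y where "y = (\<lambda>i. x0 i - s * h i)"
  have "0 \<le> y i \<and> y i \<le> 1" if "i < N" for i
    using sign_cone_abs_le[OF h(1) that] h(1) that s
    by (cases "i \<in> K") (auto simp: y_def sign_cone_def)
  moreover have "\<forall>i\<ge>N. y i = 0" using K h(1) by (auto simp: y_def sign_cone_def indicator_def)
  moreover have "(\<Sum>i<N. a (j, i) * y i) = (\<Sum>i<N. a (j, i) * x0 i)" if "j < m" for j
  proof -
    have "(\<Sum>i<N. a (j, i) * y i) = (\<Sum>i<N. a (j, i) * x0 i) - s * (\<Sum>i<N. a (j, i) * h i)"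
      unfolding y_def sum_distrib_left sum_subtractf[symmetric]
      by (intro sum.cong refl) (simp add: algebra_simps)
    then show ?thesis using h(2)[OF that] by simp
  qed
  ultimately have "y \<in> feas" by (simp add: feasible_points_def unit_box_def)
  moreover have "y \<noteq> x0" using sign_cone_nonzero[OF h(1)] s by (auto simp: y_def fun_eq_iff)
  moreover have "s * (\<Sum>i<N. y i) \<le> s * (\<Sum>i<N. x0 i)"
  proof -
    have "s * (\<Sum>i<N. y i) = s * (\<Sum>i<N. x0 i) - (s * s) * (\<Sum>i<N. h i)"
      by (simp only: y_def sum_subtractf sum_distrib_left[symmetric] right_diff_distrib mult.assoc)
    then show ?thesis using h(1) by (simp add: ss sign_cone_def)
  qed
  ultimately show "\<exists>y\<in>feas. y \<noteq> x0 \<and> s * (\<Sum>i<N. y i) \<le> s * (\<Sum>i<N. x0 i)" by blast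
next
  assume "\<exists>y\<in>feas. y \<noteq> x0 \<and> s * (\<Sum>i<N. y i) \<le> s * (\<Sum>i<N. x0 i)"
  then obtain y where y: "y \<in> feas" "y \<noteq> x0" "s * (\<Sum>i<N. y i) \<le> s * (\<Sum>i<N. x0 i)" by blast
  define d where "d = (\<lambda>i. s * (x0 i - y i))"
  have d0: "\<forall>i\<ge>N. d i = 0" using K y(1) by (auto simp: d_def feasible_points_def unit_box_def indicator_def)
  have "s \<noteq> 0" using s by auto
  then have "d \<noteq> (\<lambda>_. 0)" using y(2) unfolding d_def fun_eq_iff by (metis mult_eq_0_iff right_minus_eq)
  from normalized_difference[OF d0 this] obtain c :: real where c: "0 < c" "(\<Sum>i<N. (c * d i)\<^sup>2) = 1" .
  have "\<forall>i<N. if i \<in> ?P then 0 \<le> d i else d i \<le> 0"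
    using y(1) s by (auto simp: d_def feasible_points_def unit_box_def)
  moreover have "0 \<le> (\<Sum>i<N. d i)"
    using y(3) by (simp add: d_def sum_distrib_left[symmetric] sum_subtractf right_diff_distrib)
  ultimately have "(\<lambda>i. c * d i) \<in> sign_cone N ?P" using d0 c by (intro sign_cone_scale)
  moreover have "(\<Sum>i<N. a (j, i) * (c * d i)) = 0" if "j < m" for j
  proof -
    have "(\<Sum>i<N. a (j, i) * (c * d i)) = (c * s) * ((\<Sum>i<N. a (j, i) * x0 i) - (\<Sum>i<N. a (j, i) * y i))"
      unfolding d_def right_diff_distrib sum_distrib_left sum_subtractf[symmetric]
      by (intro sum.cong refl) (simp add: algebra_simps)
    then show ?thesis using y(1) that by (simp add: feasible_points_def)
  qed
  ultimately show "a \<in> kernel_meets m N (sign_cone N ?P)"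
    using a by (auto simp: kernel_meets_def intro!: bexI[of _ "\<lambda>i. c * d i"])
qed

lemma optima_eq_singleton_iff:
  assumes "a \<in> space (gauss_mat m N)"
  shows "optima m N K a s = {x0} \<longleftrightarrow> a \<notin> kernel_meets m N (sign_cone N (if s = 1 then K else {..<N} - K))"
  unfolding kernel_meets_sign_cone_iff[OF assms]
proof
  assume S: "optima m N K a s = {x0}"
  then have min: "s * (\<Sum>i<N. x0 i) \<le> s * (\<Sum>i<N. z i)" if "z \<in> feas" for z
    using that unfolding optima_def by blast
  show "\<not> (\<exists>y\<in>feas. y \<noteq> x0 \<and> s * (\<Sum>i<N. y i) \<le> s * (\<Sum>i<N. x0 i))"
  proof
    assume "\<exists>y\<in>feas. y \<noteq> x0 \<and> s * (\<Sum>i<N. y i) \<le> s * (\<Sum>i<N. x0 i)"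
    then obtain y where y: "y \<in> feas" "y \<noteq> x0" "s * (\<Sum>i<N. y i) \<le> s * (\<Sum>i<N. x0 i)" by blast
    have "y \<in> optima m N K a s" unfolding optima_def using y(1) order_trans[OF y(3) min] by blast
    then show False using S y(2) by blast
  qed
next
  assume N: "\<not> (\<exists>y\<in>feas. y \<noteq> x0 \<and> s * (\<Sum>i<N. y i) \<le> s * (\<Sum>i<N. x0 i))"
  have "x = x0" if "x \<in> optima m N K a s" for x
    using that N x0_feas unfolding optima_def by blast
  then show "optima m N K a s = {x0}" using optima_nonempty by blast
qed

text \<open>A strictly better feasible point is better by some \<open>1 / Suc n\<close>. Optimality
  thereby becomes a countable combination of solvability conditions over compact sets, each of which
  is a measurable event.\<close>

lemma mem_optima_iff:
  assumes "z \<in> binary N"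
  shows "z \<in> optima m N K a s \<longleftrightarrow>
    solvable {z} \<and> (\<forall>n. \<not> solvable {x \<in> unit_box N. s * (\<Sum>i<N. x i) \<le> s * (\<Sum>i<N. z i) - 1 / real (Suc n)})"
proof -
  define f where "f = (\<lambda>x :: nat \<Rightarrow> real. s * (\<Sum>i<N. x i))"
  have z: "z \<in> feas \<longleftrightarrow> solvable {z}"
    using assms binary_subset_unit_box by (auto simp: feasible_points_def solvable_in_def)
  have "(\<exists>y\<in>feas. f y < f z) \<longleftrightarrow> (\<exists>n. \<exists>y\<in>feas. f y \<le> f z - 1 / real (Suc n))"
  proof
    assume "\<exists>y\<in>feas. f y < f z"
    then obtain y where y: "y \<in> feas" "0 < f z - f y" by auto
    from reals_Archimedean[OF y(2)] obtain n where "inverse (real (Suc n)) < f z - f y" by blast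
    then show "\<exists>n. \<exists>y\<in>feas. f y \<le> f z - 1 / real (Suc n)"
      using y(1) by (intro exI[of _ n] bexI[of _ y]) (auto simp: inverse_eq_divide)
  next
    assume "\<exists>n. \<exists>y\<in>feas. f y \<le> f z - 1 / real (Suc n)"
    then obtain n y where y: "y \<in> feas" "f y \<le> f z - 1 / real (Suc n)" by blast
    moreover have "0 < 1 / real (Suc n)" by simp
    ultimately have "f y < f z" by linarith
    then show "\<exists>y\<in>feas. f y < f z" using y(1) by blast
  qed
  moreover have "(\<exists>y\<in>feas. f y \<le> c) \<longleftrightarrow> solvable {x \<in> unit_box N. f x \<le> c}" for c
    unfolding solvable_in_def feasible_points_def by blast
  moreover have "z \<in> optima m N K a s \<longleftrightarrow> z \<in> feas \<and> \<not> (\<exists>y\<in>feas. f y < f z)"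
    unfolding optima_def f_def by (auto simp: not_less)
  ultimately have "z \<in> optima m N K a s \<longleftrightarrow> solvable {z} \<and> (\<forall>n. \<not> solvable {x \<in> unit_box N. f x \<le> f z - 1 / real (Suc n)})"
    using z by simp
  then show ?thesis unfolding f_def .
qed

end

section \<open>The success event\<close>

lemma mibi_outputs_eq_singleton_iff:
  assumes m: "0 < m" and K: "K \<subseteq> {..<N}" and nrm: "is_norm_on N nrm"
  shows "mibi_outputs nrm m N (gauss_matrix m a) (mat_vec m N (gauss_matrix m a) (indicator K)) = {indicator K} \<longleftrightarrow>
    (optima m N K a 1 = {indicator K} \<and> (\<forall>z\<in>binary N - {indicator K}. z \<notin> optima m N K a (- 1))) \<or>
    (optima m N K a (- 1) = {indicator K} \<and> (\<forall>z\<in>binary N - {indicator K}. z \<notin> optima m N K a 1))"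
proof -
  have "optima m N K a 1 \<union> optima m N K a (- 1) \<subseteq> unit_box N"
    by (auto simp: optima_def feasible_points_def)
  then have "0 \<le> round_err nrm N x \<and> (round_err nrm N x = 0 \<longleftrightarrow> x \<in> binary N)"
    if "x \<in> optima m N K a 1 \<union> optima m N K a (- 1)" for x
    using that round_err_nonneg[OF nrm, of x] round_err_eq_0_iff[OF nrm, of x] by blast
  moreover have "optima m N K a 1 \<noteq> {}" "optima m N K a (- 1) \<noteq> {}"
    using optima_nonempty[OF K, of 1] optima_nonempty[OF K, of "- 1"] by simp_all
  moreover have "indicator K \<in> binary N" using K by (auto simp: binary_def indicator_def)
  ultimately have "mibi_outputs nrm m N (gauss_matrix m a) (mat_vec m N (gauss_matrix m a) (indicator K)) = {indicator K} \<longleftrightarrow>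
    (optima m N K a 1 = {indicator K} \<and> binary N \<inter> optima m N K a (- 1) \<subseteq> {indicator K}) \<or>
    (optima m N K a (- 1) = {indicator K} \<and> binary N \<inter> optima m N K a 1 \<subseteq> {indicator K})"
    unfolding mibi_outputs_def step_sols_eq_optima[OF m] by (intro selection_unique_iff) auto
  moreover have "B \<inter> S \<subseteq> {z} \<longleftrightarrow> (\<forall>x\<in>B - {z}. x \<notin> S)" for B S and z :: "nat \<Rightarrow> real" by blast
  ultimately show ?thesis by (simp only:)
qed

lemma sets_solvable_set:
  "compact Y \<Longrightarrow> {a \<in> space (gauss_mat m N). solvable_in m N K a Y} \<in> sets (gauss_mat m N)"
  unfolding solvable_in_def by (rule sets_solvable)

lemma sets_mem_optima:
  assumes "K \<subseteq> {..<N}" "s = 1 \<or> s = - 1" "z \<in> binary N"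
  shows "{a \<in> space (gauss_mat m N). z \<in> optima m N K a s} \<in> sets (gauss_mat m N)"
  unfolding mem_optima_iff[OF assms]
  by (intro sets.sets_Collect_conj sets.sets_Collect_countable_All sets.sets_Collect_neg sets_solvable_set
      compact_slice compact_sing)

text \<open>A binary point with the same image puts its normalized difference from
  \<open>indicator K\<close>, a fixed unit vector, into the kernel.\<close>

lemma collision_null:
  assumes m: "0 < m" and K: "K \<subseteq> {..<N}" and z: "z \<in> binary N" "z \<noteq> indicator K"
  shows "emeasure (gauss_mat m N) {a \<in> space (gauss_mat m N). solvable_in m N K a {z}} = 0"
proof -
  let ?M = "gauss_mat m N"
  define d where "d = (\<lambda>i. z i - indicator K i :: real)"
  have d0: "\<forall>i\<ge>N. d i = 0" using K z(1) by (auto simp: d_def binary_def indicator_def)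
  have "d \<noteq> (\<lambda>_. 0)" using z(2) unfolding d_def fun_eq_iff by (metis right_minus_eq)
  from normalized_difference[OF d0 this] obtain c :: real where c: "0 < c" "(\<Sum>i<N. (c * d i)\<^sup>2) = 1" .
  have "{a \<in> space ?M. solvable_in m N K a {z}} \<subseteq> kernel_meets m N {\<lambda>i. c * d i}"
  proof
    fix a assume a: "a \<in> {a \<in> space ?M. solvable_in m N K a {z}}"
    have "(\<Sum>i<N. a (j, i) * (c * d i)) = c * ((\<Sum>i<N. a (j, i) * z i) - (\<Sum>i<N. a (j, i) * indicator K i))" for j
      unfolding d_def right_diff_distrib sum_distrib_left sum_subtractf[symmetric]
      by (intro sum.cong refl) (simp add: algebra_simps)
    then show "a \<in> kernel_meets m N {\<lambda>i. c * d i}" using a by (simp add: kernel_meets_def solvable_in_def)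
  qed
  moreover have "kernel_meets m N {\<lambda>i. c * d i} \<in> sets ?M" by (rule sets_kernel_meets) simp
  ultimately have "emeasure ?M {a \<in> space ?M. solvable_in m N K a {z}} \<le> emeasure ?M (kernel_meets m N {\<lambda>i. c * d i})"
    by (rule emeasure_mono)
  then show ?thesis using kernel_meets_singleton_null[OF m c(2)] by simp
qed

theorem theorem2p1:
  fixes N m k :: nat and K :: "nat set" and \<epsilon> :: real
    and nrm :: "(nat \<Rightarrow> real) \<Rightarrow> real"
  assumes "K \<subseteq> {..<N}" and "card K = k" and "\<epsilon> > 0"
    and "is_norm_on N nrm"
    and "real m \<ge> min (Delta_bin N k) (Delta_bin N (N - k)) + sqrt (8 * ln (4 / \<epsilon>) * real N)"
  shows "measure (gauss_entries m N)
           {a \<in> space (gauss_entries m N).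
              mibi_outputs nrm m N (gauss_matrix m a)
                (mat_vec m N (gauss_matrix m a) (indicator K)) = {indicator K}}
         > 1 - \<epsilon>"
proof -
  let ?M = "gauss_mat m N"
  let ?E = "{a \<in> space ?M. mibi_outputs nrm m N (gauss_matrix m a)
                (mat_vec m N (gauss_matrix m a) (indicator K)) = {indicator K}}"
  have "measure ?M ?E > 1 - \<epsilon>"
  \<comment> \<open>For \<open>\<epsilon> > 1\<close> the claimed lower bound is negative. For
    \<open>N = 0\<close> the zero vector is the only feasible point, and \<open>m = 0\<close> may
    occur.\<close>
  proof (cases "\<epsilon> > 1 \<or> N = 0")
    case True
    show ?thesis
    proof (cases "\<epsilon> > 1")
      case True
      then show ?thesis using measure_nonneg[of ?M ?E] by linarith
    next
      case False
      then have N: "N = 0" using True by simp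
      then have K: "indicator K = (\<lambda>_::nat. 0::real)" using assms(1) by (auto simp: indicator_def)
      have "feasible m N A (mat_vec m N A (\<lambda>_. 0)) = {\<lambda>_. 0}" for A
        unfolding N by (auto simp: feasible_def supp_vec_def mat_vec_def)
      then have "?E = space ?M"
        unfolding K mibi_outputs_def step1_sols_def step2_sols_def by auto
      then show ?thesis using prob_space.prob_space[OF prob_space_gauss, of "{..<m} \<times> {..<N}"] assms(3) by simp
    qed
  next
    case False
    then have N: "0 < N" and \<epsilon>1: "\<epsilon> \<le> 1" by auto
    have q: "0 < sqrt (8 * ln (4 / \<epsilon>) * real N)" using N assms(3) \<epsilon>1 by simp
    \<comment> \<open>The root is positive, so \<open>m > 0\<close> follows, as the scaling by
      \<open>1 / sqrt m\<close> requires.\<close>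
    have "0 \<le> min (Delta_bin N k) (Delta_bin N (N - k))" by (simp add: Delta_bin_nonneg)
    then have "0 < real m" using assms(5) q by linarith
    then have m: "0 < m" by simp
    let ?B = "binary N - {indicator K}"
    define Z1 where "Z1 = (\<lambda>z. {a \<in> space ?M. z \<in> optima m N K a 1})"
    define Z2 where "Z2 = (\<lambda>z. {a \<in> space ?M. z \<in> optima m N K a (- 1)})"
    define G1 where "G1 = kernel_meets m N (sign_cone N K)"
    define G2 where "G2 = kernel_meets m N (sign_cone N ({..<N} - K))"
    \<comment> \<open>The null event that another binary point has the image of
      \<open>indicator K\<close>; only such points can defeat the selection rule once one step is
      exact.\<close>
    define X where "X = (\<Union>z\<in>?B. {a \<in> space ?M. solvable_in m N K a {z}})"
    have E: "?E = (space ?M - G1 - (\<Union>z\<in>?B. Z2 z)) \<union> (space ?M - G2 - (\<Union>z\<in>?B. Z1 z))"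
    proof -
      have "optima m N K a 1 = {indicator K} \<longleftrightarrow> a \<notin> G1" "optima m N K a (- 1) = {indicator K} \<longleftrightarrow> a \<notin> G2"
        if "a \<in> space ?M" for a
        using optima_eq_singleton_iff[OF assms(1) _ that, of 1] optima_eq_singleton_iff[OF assms(1) _ that, of "- 1"]
        by (simp_all add: G1_def G2_def)
      then show ?thesis
        unfolding Z1_def Z2_def mibi_outputs_eq_singleton_iff[OF m assms(1,4)] by blast
    qed
    have sG: "G1 \<in> sets ?M" "G2 \<in> sets ?M"
      unfolding G1_def G2_def by (intro sets_kernel_meets compact_sign_cone)+
    have sZ: "Z1 z \<in> sets ?M" "Z2 z \<in> sets ?M" if "z \<in> ?B" for z
      unfolding Z1_def Z2_def using that by (intro sets_mem_optima assms(1); simp)+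
    have fB: "finite ?B" using finite_binary by simp
    have sE: "?E \<in> sets ?M"
      unfolding E using sG sZ fB by (intro sets.Un sets.Diff sets.top sets.finite_UN) auto
    have sX: "{a \<in> space ?M. solvable_in m N K a {z}} \<in> sets ?M" for z
      by (rule sets_solvable_set) simp
    have X: "X \<in> null_sets ?M"
      unfolding X_def using fB sX collision_null[OF m assms(1)]
      by (intro null_sets.finite_UN) (auto simp: null_sets_def)
    have "solvable_in m N K a {z}" if "z \<in> binary N" "z \<in> optima m N K a 1 \<union> optima m N K a (- 1)" for z a
      using mem_optima_iff[OF assms(1) _ that(1), of 1 m a] mem_optima_iff[OF assms(1) _ that(1), of "- 1" m a] that(2)
      by auto
    then have ZX: "(\<Union>z\<in>?B. Z1 z) \<subseteq> X" "(\<Union>z\<in>?B. Z2 z) \<subseteq> X"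
      unfolding Z1_def Z2_def X_def by blast+
    have fin: "prob_space ?M" by (rule prob_space_gauss)
    \<comment> \<open>It is enough that one of the two steps is exact outside an event
      \<open>G\<close> of probability below \<open>\<epsilon>\<close>; removing \<open>X\<close>
      costs nothing.\<close>
    have concl: "measure ?M ?E > 1 - \<epsilon>" if G: "G \<in> sets ?M" "measure ?M G < \<epsilon>" "space ?M - G - X \<subseteq> ?E" for G
    proof -
      have "1 - measure ?M G = measure ?M (space ?M - G)"
        using prob_space.prob_compl[OF fin G(1)] by simp
      also have "\<dots> = measure ?M (space ?M - G - X)"
        using X G(1) by (intro measure_Diff_null_set[symmetric]) auto
      also have "\<dots> \<le> measure ?M ?E"
        by (rule finite_measure.finite_measure_mono[OF prob_space.axioms(1)[OF fin] G(3) sE])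
      finally show ?thesis using G(2) by linarith
    qed
    have card: "card ({..<N} - K) = N - k"
      using assms(1,2) by (simp add: card_Diff_subset finite_subset[OF assms(1)])
    show ?thesis
    \<comment> \<open>The smaller of the two values determines which step is shown to be
      exact.\<close>
    proof (cases "Delta_bin N k \<le> Delta_bin N (N - k)")
      case True
      show ?thesis
      proof (rule concl[OF sG(1)])
        show "measure ?M G1 < \<epsilon>"
          unfolding G1_def by (rule failure_probability_less) (use assms N \<epsilon>1 True in auto)
        show "space ?M - G1 - X \<subseteq> ?E" unfolding E using ZX by blast
      qed
    next
      case False
      show ?thesis
      proof (rule concl[OF sG(2)])
        show "measure ?M G2 < \<epsilon>"
          unfolding G2_def by (rule failure_probability_less) (use assms N \<epsilon>1 False card in auto)
        show "space ?M - G2 - X \<subseteq> ?E" unfolding E using ZX by blast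
      qed
    qed
  qed
  then show ?thesis by (simp only: gauss_entries_def)
qed



end
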